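(* Let $\mathbf{a}\in\mathfrak{A}_3$ be generic. In the Verma module $M_{(13)(23)}$ let $m_{\mathsf{soc}}=f_{13}((23))f_{23}((13))\,m_1-m_{\mathrm{top}}$ and put $N_{(13)(23)}=\mathcal{A}_{[\mathbf{a}]}\cdot M_{(13)(23)}[e]=M_{(13)(23)}[e]\oplus\mathcal{A}_{[\mathbf{a}]}\cdot m_{\mathsf{soc}}$. The nonzero submodules of $M_{(13)(23)}$ are $$\mathcal{A}_{[\mathbf{a}]}\cdot m_{\mathsf{soc}}\subsetneq\mathcal{A}_{[\mathbf{a}]}\cdot v\subsetneq N_{(13)(23)}\subsetneq M_{(13)(23)}$$ for all $v\in M_{(13)(23)}[e]\setminus\{0\}$. The submodules $\mathcal{A}_{[\mathbf{a}]}\cdot v$ and $\mathcal{A}_{[\mathbf{a}]}\cdot u$ (with $u,v\in M_{(13)(23)}[e]\setminus\{0\}$) coincide if and only if $v\in\langle u\rangle$. The quotients $\mathcal{A}_{[\mathbf{a}]}\cdot v/\mathcal{A}_{[\mathbf{a}]}\cdot m_{\mathsf{soc}}$ and $N_{(13)(23)}/\mathcal{A}_{[\mathbf{a}]}\cdot v$ are isomorphic to $\Bbbk_e$; and $M_{(13)(23)}/N_{(13)(23)}$ and $\mathcal{A}_{[\mathbf{a}]}\cdot m_{\mathsf{soc}}$ are isomorphic to $L$.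
   Context: $\Bbbk$ is an algebraically closed field of characteristic $0$; $\langle S\rangle$ denotes the linear span of $S$. $\mathcal{O}_2^3=\{(12),(13),(23)\}\subset\mathbb{S}_3$; $\Bbbk^{\mathbb{S}_3}$ is the algebra of functions on $\mathbb{S}_3$ with basis the characteristic functions $\delta_g$ of $\{g\}$, $g\in\mathbb{S}_3$. $\mathfrak{A}_3=\{\mathbf{a}=(a_{(12)},a_{(13)},a_{(23)})\in\Bbbk^3: a_{(12)}+a_{(13)}+a_{(23)}=0\}$. For $\mathbf{a}\in\mathfrak{A}_3$ and $(ij)\in\mathcal{O}_2^3$ put $f_{ij}=\sum_{g\in\mathbb{S}_3}(a_{(ij)}-a_{g^{-1}(ij)g})\delta_g\in\Bbbk^{\mathbb{S}_3}$. $\mathcal{A}_{[\mathbf{a}]}$ is the algebra generated by $\Bbbk^{\mathbb{S}_3}$ and $x_{(12)},x_{(13)},x_{(23)}$ with relations $\delta_h x_{(ij)}=x_{(ij)}\delta_{(ij)h}$ ($h\in\mathbb{S}_3$), $x_{(ij)}^2=f_{ij}$, $x_{(13)}x_{(23)}+x_{(23)}x_{(12)}+x_{(12)}x_{(13)}=0$ and $x_{(23)}x_{(13)}+x_{(13)}x_{(12)}+x_{(12)}x_{(23)}=0$. (It is known to have dimension $72$ and to contain $\Bbbk^{\mathbb{S}_3}$ as a subalgebra.) Modules are left modules. For an $\mathcal{A}_{[\mathbf{a}]}$-module $M$ and $g\in\mathbb{S}_3$, $M[g]=\delta_g\cdot M$. The Verma module is $M_g=\mathcal{A}_{[\mathbf{a}]}\otimes_{\Bbbk^{\mathbb{S}_3}}\Bbbk_g$,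 where $\Bbbk_g$ is the one-dimensional $\Bbbk^{\mathbb{S}_3}$-module with $f\cdot 1=f(g)1$. In $M_g$ write $m_1=1\otimes 1$ and $m_{\mathrm{top}}=x_{(13)}x_{(12)}x_{(23)}x_{(12)}\otimes 1$. $\mathbf{a}$ is generic when $a_{(12)},a_{(13)},a_{(23)}$ are pairwise distinct. $\Bbbk_e$ also denotes the one-dimensional $\mathcal{A}_{[\mathbf{a}]}$-module on which every $x_{(ij)}$ acts by $0$ and $f\in\Bbbk^{\mathbb{S}_3}$ acts by $f(e)$. For $\mathbf{a}$ generic, $L$ is the $\mathcal{A}_{[\mathbf{a}]}$-module with basis $\{v_g: e\neq g\in\mathbb{S}_3\}$, $v_g\in L[g]$, and $x_{(ij)}\cdot v_g=v_{(ij)g}$ if $\operatorname{sgn} g=1$, $x_{(ij)}\cdot v_g=f_{ij}(g)v_{(ij)g}$ if $\operatorname{sgn} g=-1$ (read as $0$ when $g=(ij)$, since $f_{ij}((ij))=0$). *)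

theory Defs
  imports
    "HOL-Algebra.Module"
    "HOL-Algebra.QuotRing"
    "HOL-Algebra.Free_Abelian_Groups"
    "HOL-Algebra.Sym_Groups"
    "HOL-Computational_Algebra.Polynomial"
begin

section \<open>Modules over a not necessarily commutative ring\<close>

text \<open>
  Modules use the record of \<^theory>\<open>HOL-Algebra.Module\<close>; its locale \<^locale>\<open>module\<close> asks for
  a commutative ring and so is not available, whereas \<^locale>\<open>submodule\<close> has no such restriction.
  The multiplicative fields of the record play no role and are left unspecified.
\<close>

text \<open>Additive subgroup generated by all products \<open>b \<odot> s\<close>, that is \<open>B \<cdot> S\<close>. It is the submodule
  generated by \<open>S\<close> if \<open>B\<close> is the whole ring, and the linear span of \<open>S\<close> if \<open>B\<close> is the set of
  scalars.\<close>

definition mod_span :: "('r, 'v, 'n) module_scheme \<Rightarrow> 'r set \<Rightarrow> 'v set \<Rightarrow> 'v set" where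
  "mod_span M B S = generate (add_monoid M) {b \<odot>\<^bsub>M\<^esub> s | b s. b \<in> B \<and> s \<in> S}"

definition sub_mod :: "('r, 'v) module \<Rightarrow> 'v set \<Rightarrow> ('r, 'v) module" where
  "sub_mod M H = M\<lparr>carrier := H\<rparr>"

definition quot_mod :: "('r, 'v) module \<Rightarrow> 'v set \<Rightarrow> ('r, 'v set) module" where
  "quot_mod M H =
    \<lparr>carrier = a_rcosets\<^bsub>M\<^esub> H, monoid.mult = undefined, one = undefined,
     ring.zero = H, ring.add = set_add M,
     module.smult = (\<lambda>b K. \<Union>x\<in>K. H +>\<^bsub>M\<^esub> (b \<odot>\<^bsub>M\<^esub> x))\<rparr>"

definition mod_isomorphic :: "'r ring \<Rightarrow> ('r, 'v) module \<Rightarrow> ('r, 'w) module \<Rightarrow> bool" where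
  "mod_isomorphic R M N \<longleftrightarrow>
    (\<exists>h \<in> iso (add_monoid M) (add_monoid N).
       \<forall>r \<in> carrier R. \<forall>x \<in> carrier M. h (r \<odot>\<^bsub>M\<^esub> x) = r \<odot>\<^bsub>N\<^esub> h x)"

text \<open>
  Extension of scalars \<open>A \<otimes>\<^sub>R V\<close> along \<open>\<phi> : R \<rightarrow> A\<close>: the free abelian group on \<open>A \<times> V\<close>, on which
  \<open>A\<close> acts by multiplication on the first component, modulo biadditivity and
  \<open>(x \<cdot> \<phi>(r)) \<otimes> v = x \<otimes> (r \<cdot> v)\<close>.
\<close>

definition tensor_free ::
    "'b ring \<Rightarrow> ('r, 'v) module \<Rightarrow> ('b, ('b \<times> 'v) \<Rightarrow>\<^sub>0 int) module" where
  "tensor_free A V =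
    \<lparr>carrier = carrier (free_Abelian_group (carrier A \<times> carrier V)),
     monoid.mult = undefined, one = undefined, ring.zero = 0, ring.add = (+),
     module.smult = (\<lambda>b. frag_extend (\<lambda>(x, v). frag_of (b \<otimes>\<^bsub>A\<^esub> x, v)))\<rparr>"

definition tensor_rels ::
    "'b ring \<Rightarrow> ('r \<Rightarrow> 'b) \<Rightarrow> 'r ring \<Rightarrow> ('r, 'v) module \<Rightarrow> (('b \<times> 'v) \<Rightarrow>\<^sub>0 int) set" where
  "tensor_rels A \<phi> R V =
     {frag_of (x \<oplus>\<^bsub>A\<^esub> y, v) - frag_of (x, v) - frag_of (y, v) | x y v.
        x \<in> carrier A \<and> y \<in> carrier A \<and> v \<in> carrier V}
   \<union> {frag_of (x, v \<oplus>\<^bsub>V\<^esub> w) - frag_of (x, v) - frag_of (x, w) | x v w.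
        x \<in> carrier A \<and> v \<in> carrier V \<and> w \<in> carrier V}
   \<union> {frag_of (x \<otimes>\<^bsub>A\<^esub> \<phi> r, v) - frag_of (x, r \<odot>\<^bsub>V\<^esub> v) | x r v.
        x \<in> carrier A \<and> r \<in> carrier R \<and> v \<in> carrier V}"

definition tensor_ker ::
    "'b ring \<Rightarrow> ('r \<Rightarrow> 'b) \<Rightarrow> 'r ring \<Rightarrow> ('r, 'v) module \<Rightarrow> (('b \<times> 'v) \<Rightarrow>\<^sub>0 int) set" where
  "tensor_ker A \<phi> R V =
     generate (free_Abelian_group (carrier A \<times> carrier V)) (tensor_rels A \<phi> R V)"

definition induced_mod ::
    "'b ring \<Rightarrow> ('r \<Rightarrow> 'b) \<Rightarrow> 'r ring \<Rightarrow> ('r, 'v) module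
      \<Rightarrow> ('b, (('b \<times> 'v) \<Rightarrow>\<^sub>0 int) set) module" where
  "induced_mod A \<phi> R V = quot_mod (tensor_free A V) (tensor_ker A \<phi> R V)"

definition pure_tensor ::
    "'b ring \<Rightarrow> ('r \<Rightarrow> 'b) \<Rightarrow> 'r ring \<Rightarrow> ('r, 'v) module
      \<Rightarrow> 'b \<Rightarrow> 'v \<Rightarrow> (('b \<times> 'v) \<Rightarrow>\<^sub>0 int) set" where
  "pure_tensor A \<phi> R V x v = tensor_ker A \<phi> R V +>\<^bsub>tensor_free A V\<^esub> frag_of (x, v)"


section \<open>Free associative algebras\<close>

text \<open>Lists form the free monoid, so \<open>'g list \<Rightarrow>\<^sub>0 'k\<close> with the convolution product of
  \<^theory>\<open>HOL-Library.Poly_Mapping\<close> is the free algebra on \<open>'g\<close>.\<close>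

instantiation list :: (type) monoid_add
begin

definition zero_list :: "'a list" where "zero_list = []"

definition plus_list :: "'a list \<Rightarrow> 'a list \<Rightarrow> 'a list" where "plus_list = (@)"

instance
  by standard (simp_all add: zero_list_def plus_list_def)

end

type_synonym ('g, 'k) nc_poly = "'g list \<Rightarrow>\<^sub>0 'k"

definition free_alg :: "'g set \<Rightarrow> ('g, 'k :: field) nc_poly ring" where
  "free_alg G =
    \<lparr>carrier = {p. \<forall>w \<in> Poly_Mapping.keys p. set w \<subseteq> G},
     monoid.mult = (*), one = 1, ring.zero = 0, ring.add = (+)\<rparr>"

lemma ring_free_alg: "ring (free_alg G :: ('a,'b::field) nc_poly ring)" (is "ring ?F")
proof (rule ringI)
  show "abelian_group ?F"
  proof (rule abelian_groupI)
    fix x y assume "x \<in> carrier ?F" "y \<in> carrier ?F"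
    then show "x \<oplus>\<^bsub>?F\<^esub> y \<in> carrier ?F"
      using Poly_Mapping.keys_add[of x y] by (auto simp: free_alg_def)
  next
    fix x assume "x \<in> carrier ?F"
    then have "- x \<in> carrier ?F" "- x \<oplus>\<^bsub>?F\<^esub> x = \<zero>\<^bsub>?F\<^esub>"
      by (auto simp: free_alg_def)
    then show "\<exists>y\<in>carrier ?F. y \<oplus>\<^bsub>?F\<^esub> x = \<zero>\<^bsub>?F\<^esub>" by blast
  qed (auto simp: free_alg_def algebra_simps)
  show "Group.monoid ?F"
  proof (rule monoidI)
    fix x y assume *: "x \<in> carrier ?F" "y \<in> carrier ?F"
    have "Poly_Mapping.keys (x * y)
        \<subseteq> {a + b | a b. a \<in> Poly_Mapping.keys x \<and> b \<in> Poly_Mapping.keys y}"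
      by (rule keys_mult)
    with * show "x \<otimes>\<^bsub>?F\<^esub> y \<in> carrier ?F"
      by (fastforce simp: free_alg_def plus_list_def)
  next
    have "Poly_Mapping.keys (1 :: ('a,'b) nc_poly) = {[]}"
      by (simp add: zero_list_def flip: single_one)
    then show "\<one>\<^bsub>?F\<^esub> \<in> carrier ?F" by (simp add: free_alg_def zero_list_def)
  qed (auto simp: free_alg_def algebra_simps)
qed (auto simp: free_alg_def algebra_simps)

text \<open>Action of a noncommutative polynomial on a vector space with scalar multiplication \<open>sc\<close>,
  when each generator \<open>s\<close> acts by \<open>\<rho> s\<close>.\<close>

definition nc_act ::
    "('k \<Rightarrow> 'v \<Rightarrow> 'v) \<Rightarrow> ('g \<Rightarrow> 'v \<Rightarrow> 'v) \<Rightarrow> ('g, 'k :: field) nc_poly \<Rightarrow> 'v \<Rightarrow> 'v :: comm_monoid_add" where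
  "nc_act sc \<rho> p v =
     (\<Sum>w \<in> Poly_Mapping.keys p. sc (Poly_Mapping.lookup p w) (foldr \<rho> w v))"

text \<open>Module over a quotient of a free algebra given by operators \<open>\<rho>\<close> that satisfy the relations,
  so that all representatives of a coset act in the same way.\<close>

definition rep_mod ::
    "'v set \<Rightarrow> ('k \<Rightarrow> 'v \<Rightarrow> 'v) \<Rightarrow> ('g \<Rightarrow> 'v \<Rightarrow> 'v)
      \<Rightarrow> (('g, 'k :: field) nc_poly set, 'v :: comm_monoid_add) module" where
  "rep_mod C sc \<rho> =
    \<lparr>carrier = C, monoid.mult = undefined, one = undefined, ring.zero = 0, ring.add = (+),
     module.smult = (\<lambda>K v. the_elem ((\<lambda>p. nc_act sc \<rho> p v) ` K))\<rparr>"


section \<open>The algebras over the symmetric group on three letters\<close>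

type_synonym perm3 = "nat \<Rightarrow> nat"

text \<open>The product of the group is composition of functions, and \<open>e = id\<close>.\<close>

abbreviation S3 :: "perm3 set" where
  "S3 \<equiv> carrier (sym_group 3)"

abbreviation t12 :: perm3 where "t12 \<equiv> Transposition.transpose 1 2"
abbreviation t13 :: perm3 where "t13 \<equiv> Transposition.transpose 1 3"
abbreviation t23 :: perm3 where "t23 \<equiv> Transposition.transpose 2 3"

definition O23 :: "perm3 set" where
  "O23 = {t12, t13, t23}"

text \<open>Only the values of \<open>a\<close> on the transpositions matter.\<close>

definition param_A3 :: "(perm3 \<Rightarrow> 'k :: field) \<Rightarrow> bool" where
  "param_A3 a \<longleftrightarrow> a t12 + a t13 + a t23 = 0"

definition generic :: "(perm3 \<Rightarrow> 'k :: field) \<Rightarrow> bool" where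
  "generic a \<longleftrightarrow> a t12 \<noteq> a t13 \<and> a t12 \<noteq> a t23 \<and> a t13 \<noteq> a t23"

definition ff :: "(perm3 \<Rightarrow> 'k :: field) \<Rightarrow> perm3 \<Rightarrow> perm3 \<Rightarrow> 'k" where
  "ff a t g = a t - a (Hilbert_Choice.inv g \<circ> t \<circ> g)"

text \<open>\<open>Dl g\<close> stands for \<open>\<delta>\<^sub>g\<close> and \<open>Xg t\<close> for \<open>x\<^sub>t\<close>.\<close>

datatype gen = Dl perm3 | Xg perm3

abbreviation free3 :: "(gen, 'k :: field) nc_poly ring" where
  "free3 \<equiv> free_alg (Dl ` S3 \<union> Xg ` O23)"

abbreviation dl :: "perm3 \<Rightarrow> (gen, 'k :: field) nc_poly" where
  "dl g \<equiv> Poly_Mapping.single [Dl g] 1"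

abbreviation xg :: "perm3 \<Rightarrow> (gen, 'k :: field) nc_poly" where
  "xg t \<equiv> Poly_Mapping.single [Xg t] 1"

definition fn_poly :: "(perm3 \<Rightarrow> 'k :: field) \<Rightarrow> (gen, 'k) nc_poly" where
  "fn_poly f = (\<Sum>g\<in>S3. Poly_Mapping.single [Dl g] (f g))"

text \<open>The first two families of relations present the function algebra on its basis \<open>\<delta>\<^sub>g\<close>.\<close>

definition alg_rels :: "(perm3 \<Rightarrow> 'k :: field) \<Rightarrow> (gen, 'k) nc_poly set" where
  "alg_rels a =
     {dl g * dl h - (if g = h then dl g else 0) | g h. g \<in> S3 \<and> h \<in> S3}
   \<union> {(\<Sum>g\<in>S3. dl g) - 1}
   \<union> {dl h * xg t - xg t * dl (t \<circ> h) | h t. h \<in> S3 \<and> t \<in> O23}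
   \<union> {xg t * xg t - fn_poly (ff a t) | t. t \<in> O23}
   \<union> {xg t13 * xg t23 + xg t23 * xg t12 + xg t12 * xg t13,
      xg t23 * xg t13 + xg t13 * xg t12 + xg t12 * xg t23}"

definition alg_ideal :: "(perm3 \<Rightarrow> 'k :: field) \<Rightarrow> (gen, 'k) nc_poly set" where
  "alg_ideal a = Idl\<^bsub>free3\<^esub> (alg_rels a)"

definition alg :: "(perm3 \<Rightarrow> 'k :: field) \<Rightarrow> (gen, 'k) nc_poly set ring" where
  "alg a = free3 Quot (alg_ideal a)"

definition alg_cls :: "(perm3 \<Rightarrow> 'k :: field) \<Rightarrow> (gen, 'k) nc_poly \<Rightarrow> (gen, 'k) nc_poly set" where
  "alg_cls a p = alg_ideal a +>\<^bsub>free3\<^esub> p"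

definition scalar :: "(perm3 \<Rightarrow> 'k :: field) \<Rightarrow> 'k \<Rightarrow> (gen, 'k) nc_poly set" where
  "scalar a c = alg_cls a (Poly_Mapping.single [] c)"

definition weight_space ::
    "(perm3 \<Rightarrow> 'k :: field) \<Rightarrow> ((gen, 'k) nc_poly set, 'v) module \<Rightarrow> perm3 \<Rightarrow> 'v set" where
  "weight_space a M g = (\<lambda>m. alg_cls a (dl g) \<odot>\<^bsub>M\<^esub> m) ` carrier M"


section \<open>Verma modules\<close>

definition fun_alg :: "(perm3 \<Rightarrow> 'k :: field) ring" where
  "fun_alg =
    \<lparr>carrier = S3 \<rightarrow>\<^sub>E UNIV,
     monoid.mult = (\<lambda>f f'. restrict (\<lambda>g. f g * f' g) S3), one = restrict (\<lambda>_. 1) S3,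
     ring.zero = restrict (\<lambda>_. 0) S3, ring.add = (\<lambda>f f'. restrict (\<lambda>g. f g + f' g) S3)\<rparr>"

definition fun_emb :: "(perm3 \<Rightarrow> 'k :: field) \<Rightarrow> (perm3 \<Rightarrow> 'k) \<Rightarrow> (gen, 'k) nc_poly set" where
  "fun_emb a f = alg_cls a (fn_poly f)"

definition eval_mod :: "perm3 \<Rightarrow> (perm3 \<Rightarrow> 'k :: field, 'k) module" where
  "eval_mod g =
    \<lparr>carrier = UNIV, monoid.mult = undefined, one = undefined, ring.zero = 0, ring.add = (+),
     module.smult = (\<lambda>f c. f g * c)\<rparr>"

type_synonym 'k verma_el = "(((gen, 'k) nc_poly set \<times> 'k) \<Rightarrow>\<^sub>0 int) set"

definition verma ::
    "(perm3 \<Rightarrow> 'k :: field) \<Rightarrow> perm3 \<Rightarrow> ((gen, 'k) nc_poly set, 'k verma_el) module" where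
  "verma a g = induced_mod (alg a) (fun_emb a) fun_alg (eval_mod g)"

definition verma_tensor ::
    "(perm3 \<Rightarrow> 'k :: field) \<Rightarrow> perm3 \<Rightarrow> (gen, 'k) nc_poly set \<Rightarrow> 'k \<Rightarrow> 'k verma_el" where
  "verma_tensor a g = pure_tensor (alg a) (fun_emb a) fun_alg (eval_mod g)"

definition m_one :: "(perm3 \<Rightarrow> 'k :: field) \<Rightarrow> perm3 \<Rightarrow> 'k verma_el" where
  "m_one a g = verma_tensor a g \<one>\<^bsub>alg a\<^esub> 1"

definition m_top :: "(perm3 \<Rightarrow> 'k :: field) \<Rightarrow> perm3 \<Rightarrow> 'k verma_el" where
  "m_top a g = verma_tensor a g (alg_cls a (xg t13 * xg t12 * xg t23 * xg t12)) 1"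


section \<open>The simple modules\<close>

definition k_e :: "((gen, 'k :: field) nc_poly set, 'k) module" where
  "k_e = rep_mod UNIV (*)
     (\<lambda>s c. case s of Dl g \<Rightarrow> (if g = id then c else 0) | Xg t \<Rightarrow> 0)"

text \<open>The basis vector \<open>v\<^sub>g\<close> of \<open>L\<close> is \<open>Poly_Mapping.single g 1\<close>.\<close>

definition L_gen ::
    "(perm3 \<Rightarrow> 'k :: field) \<Rightarrow> gen \<Rightarrow> (perm3 \<Rightarrow>\<^sub>0 'k) \<Rightarrow> (perm3 \<Rightarrow>\<^sub>0 'k)" where
  "L_gen a s u = (case s of
      Dl h \<Rightarrow> Poly_Mapping.single h (Poly_Mapping.lookup u h)
    | Xg t \<Rightarrow> (\<Sum>g \<in> S3 - {id}. Poly_Mapping.single (t \<circ> g)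
        (Poly_Mapping.lookup u g * (if sign g = 1 then 1 else ff a t g))))"

definition L_mod ::
    "(perm3 \<Rightarrow> 'k :: field) \<Rightarrow> ((gen, 'k) nc_poly set, perm3 \<Rightarrow>\<^sub>0 'k) module" where
  "L_mod a = rep_mod {u. Poly_Mapping.keys u \<subseteq> S3 - {id}}
     (\<lambda>c. Poly_Mapping.map (\<lambda>y. c * y)) (L_gen a)"


section \<open>The Verma module of \<open>(13)(23)\<close>\<close>

abbreviation M1323 ::
    "(perm3 \<Rightarrow> 'k :: field) \<Rightarrow> ((gen, 'k) nc_poly set, 'k verma_el) module" where
  "M1323 a \<equiv> verma a (t13 \<circ> t23)"

definition m_soc :: "(perm3 \<Rightarrow> 'k :: field) \<Rightarrow> 'k verma_el" where
  "m_soc a =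
     (scalar a (ff a t13 t23 * ff a t23 t13) \<odot>\<^bsub>M1323 a\<^esub> m_one a (t13 \<circ> t23))
       \<ominus>\<^bsub>M1323 a\<^esub> m_top a (t13 \<circ> t23)"

abbreviation M1323_e :: "(perm3 \<Rightarrow> 'k :: field) \<Rightarrow> 'k verma_el set" where
  "M1323_e a \<equiv> weight_space a (M1323 a) id"

definition cyc :: "(perm3 \<Rightarrow> 'k :: field) \<Rightarrow> 'k verma_el \<Rightarrow> 'k verma_el set" where
  "cyc a v = mod_span (M1323 a) (carrier (alg a)) {v}"

definition N1323 :: "(perm3 \<Rightarrow> 'k :: field) \<Rightarrow> 'k verma_el set" where
  "N1323 a = mod_span (M1323 a) (carrier (alg a)) (M1323_e a)"

definition line :: "(perm3 \<Rightarrow> 'k :: field) \<Rightarrow> 'k verma_el \<Rightarrow> 'k verma_el set" where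
  "line a u = mod_span (M1323 a) (range (scalar a)) {u}"

end

(* The weight spaces M[g] of the Verma module M = M_(13)(23) are all two-dimensional. In a suitable
   basis M is glued from a socle copy of L (basis b_g, g <> e), the trivial weight space M[e], and a
   top copy of L (basis c_g, g <> e): each x_t maps M[e] to the line of b_t, so M[e] embeds into the
   triples of coefficients, on which the cubic relations impose one linear condition; dually x_t maps
   c_t into M[e]. Writing this down gives a 12-dimensional representation generated by a vector of
   weight (13)(23), hence a surjection from M. It is injective because the relations rewrite every
   word applied to m_1 into twelve words whose images are linearly independent.
   A submodule of the model is the sum of its weight components. Since the a_t are distinct, the
   bottom copy of L is generated by any of its basis vectors; any nonzero vector of M[e] generates the
   bottom copy, and any weight vector with a nonzero top coordinate generates everything. So the
   submodules between the bottom copy and its sum with M[e] correspond to the subspaces of the plane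
   M[e]. *)

theory Submission
  imports Defs "HOL-Library.Product_Plus" "HOL-Library.Function_Algebras"
begin

text \<open>The vectors \<open>T p\<close>, that is p \<otimes> 1, exhaust \<open>M\<close>, and the
  isomorphism amounts to one equivalence: \<open>T p = T q\<close> exactly when \<open>p\<close> and
  \<open>q\<close> act alike on the vector \<open>v0\<close> of the model. Generators and relations
  only bound \<open>M\<close> from above; that nothing collapses further needs an explicit module,
  which is why the model is built without reference to \<open>M\<close>. The constants of the model
  at weight e are forced up to normalisation. Since f_t vanishes at e and at t, x_t kills x_t c_t,
  and a cubic relation makes the three vectors x_t c_t of M[e] sum to zero. The kernels of the three
  x_t are distinct lines in the plane M[e], so these vectors are determined up to a common factor,
  here q = a_13 - a_23. Paths of two steps from the top copy through M[e] to the bottom copy leave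
  terms with the factor q in the cubic relations; the coefficients \<open>eps\<close>, on edges that
  avoid e, cancel them.\<close>

section \<open>The symmetric group on three letters\<close>

text \<open>Constants of their own, since the simplifier rewrites \<open>1\<close> to \<open>Suc 0\<close> inside \<open>t12\<close> and \<open>t13\<close>.\<close>

definition s12 :: perm3 where "s12 = t12"
definition s13 :: perm3 where "s13 = t13"
definition s23 :: perm3 where "s23 = t23"
definition rot :: perm3 where "rot = t13 \<circ> t23"
definition tor :: perm3 where "tor = t23 \<circ> t13"

lemmas perm_defs = s12_def s13_def s23_def rot_def tor_def

lemma perm_mult [simp]:
  "s12 \<circ> s12 = id" "s12 \<circ> s13 = rot" "s12 \<circ> s23 = tor" "s12 \<circ> rot = s13" "s12 \<circ> tor = s23"
  "s13 \<circ> s12 = tor" "s13 \<circ> s13 = id" "s13 \<circ> s23 = rot" "s13 \<circ> rot = s23" "s13 \<circ> tor = s12"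
  "s23 \<circ> s12 = rot" "s23 \<circ> s13 = tor" "s23 \<circ> s23 = id" "s23 \<circ> rot = s12" "s23 \<circ> tor = s13"
  "rot \<circ> s12 = s23" "rot \<circ> s13 = s12" "rot \<circ> s23 = s13" "rot \<circ> rot = tor" "rot \<circ> tor = id"
  "tor \<circ> s12 = s13" "tor \<circ> s13 = s23" "tor \<circ> s23 = s12" "tor \<circ> rot = id" "tor \<circ> tor = rot"
  by (auto simp: perm_defs fun_eq_iff transpose_def)

lemma perm_neq [simp]:
  "s12 \<noteq> id" "s13 \<noteq> id" "s23 \<noteq> id" "rot \<noteq> id" "tor \<noteq> id"
  "s12 \<noteq> s13" "s12 \<noteq> s23" "s13 \<noteq> s23" "rot \<noteq> tor"
  "s12 \<noteq> rot" "s12 \<noteq> tor" "s13 \<noteq> rot" "s13 \<noteq> tor" "s23 \<noteq> rot" "s23 \<noteq> tor"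
proof -
  have *: "f \<noteq> g" if "f 1 \<noteq> g 1 \<or> f 2 \<noteq> g 2" for f g :: perm3
    using that by auto
  show "s12 \<noteq> id" "s13 \<noteq> id" "s23 \<noteq> id" "rot \<noteq> id" "tor \<noteq> id"
  "s12 \<noteq> s13" "s12 \<noteq> s23" "s13 \<noteq> s23" "rot \<noteq> tor"
  "s12 \<noteq> rot" "s12 \<noteq> tor" "s13 \<noteq> rot" "s13 \<noteq> tor" "s23 \<noteq> rot" "s23 \<noteq> tor"
    by (rule *; simp add: perm_defs transpose_def)+
qed

lemmas perm_neq' [simp] = perm_neq [symmetric]

lemma perm_inv [simp]:
  "Hilbert_Choice.inv s12 = s12" "Hilbert_Choice.inv s13 = s13" "Hilbert_Choice.inv s23 = s23"
  "Hilbert_Choice.inv rot = tor" "Hilbert_Choice.inv tor = rot"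
  by (rule inv_unique_comp; simp)+

lemma O23_eq: "O23 = {s12, s13, s23}"
  by (simp add: O23_def perm_defs)

text \<open>Counting: the six named elements are distinct permutations, and there are 3! of
  them.\<close>

lemma S3_eq: "S3 = {id, s12, s13, s23, rot, tor}"
proof -
  have "{1..3} = {1, 2, 3::nat}" by auto
  then have "S3 = {p. p permutes {1, 2, 3}}"
    by (auto simp: sym_group_carrier)
  also have "\<dots> = {id, s12, s13, s23, rot, tor}"
  proof
    have [simp]: "card {1, 2, 3::nat} = 3" by simp
    have sub: "{id, s12, s13, s23, rot, tor} \<subseteq> {p. p permutes {1, 2, 3::nat}}"
      by (auto simp: perm_defs intro!: permutes_swap_id permutes_compose permutes_id)
    have "card {p. p permutes {1, 2, 3::nat}} = 6"
      by (subst card_permutations[where n = 3]) (auto simp: fact_numeral)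
    moreover have "card {id, s12, s13, s23, rot, tor} = 6" by simp
    ultimately have "{id, s12, s13, s23, rot, tor} = {p. p permutes {1, 2, 3::nat}}"
      using sub by (intro card_subset_eq) (auto simp: finite_permutations)
    then show "{p. p permutes {1, 2, 3::nat}} \<subseteq> {id, s12, s13, s23, rot, tor}" by blast
    show "{id, s12, s13, s23, rot, tor} \<subseteq> {p. p permutes {1, 2, 3::nat}}" by (fact sub)
  qed
  finally show ?thesis .
qed

lemma O23_involution: "t \<in> O23 \<Longrightarrow> t \<circ> t = id"
  by (auto simp: O23_eq)

lemma O23_S3_closed: "t \<in> O23 \<Longrightarrow> g \<in> S3 \<Longrightarrow> t \<circ> g \<in> S3"
  by (auto simp: O23_eq S3_eq)

lemma perm_sign [simp]: "sign s12 = -1" "sign s13 = -1" "sign s23 = -1" "sign rot = 1" "sign tor = 1"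
proof -
  show 1: "sign s12 = -1" "sign s13 = -1" "sign s23 = -1"
    by (simp_all add: perm_defs sign_swap_id)
  have "permutation s12" "permutation s13" "permutation s23"
    by (simp_all add: perm_defs permutation_swap_id)
  then have "sign (s13 \<circ> s23) = 1" "sign (s23 \<circ> s13) = 1"
    unfolding sign_compose[OF \<open>permutation s13\<close> \<open>permutation s23\<close>]
      sign_compose[OF \<open>permutation s23\<close> \<open>permutation s13\<close>] by (simp_all only: 1)
  then show "sign rot = 1" "sign tor = 1" by simp_all
qed

lemma ff_eq [simp]:
  "ff a t id = 0"
  "ff a s12 s12 = 0" "ff a s13 s13 = 0" "ff a s23 s23 = 0"
  "ff a s12 s13 = a s12 - a s23" "ff a s12 s23 = a s12 - a s13"
  "ff a s13 s12 = a s13 - a s23" "ff a s13 s23 = a s13 - a s12"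
  "ff a s23 s12 = a s23 - a s13" "ff a s23 s13 = a s23 - a s12"
  "ff a s12 rot = a s12 - a s23" "ff a s13 rot = a s13 - a s12" "ff a s23 rot = a s23 - a s13"
  "ff a s12 tor = a s12 - a s13" "ff a s13 tor = a s13 - a s23" "ff a s23 tor = a s23 - a s12"
  by (simp_all add: ff_def)

section \<open>Representations of free algebras and their quotients\<close>

lemma nc_poly_sum_words:
  "p = (\<Sum>w\<in>Poly_Mapping.keys p. Poly_Mapping.single w (Poly_Mapping.lookup p w))"
  by (rule poly_mapping_eqI)
     (auto simp: lookup_sum lookup_single when_def in_keys_iff sum.delta)

lemma nc_poly_induct [case_names single add]:
  fixes p :: "'a \<Rightarrow>\<^sub>0 'b::comm_monoid_add"
  assumes "\<And>w c. P (Poly_Mapping.single w c)" "\<And>p q. P p \<Longrightarrow> P q \<Longrightarrow> P (p + q)"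
  shows "P p"
proof -
  \<comment> \<open>The empty sum is covered by a term with coefficient 0, so the induction rule has
    no case for zero.\<close>
  have "P (\<Sum>w\<in>S. Poly_Mapping.single w (f w))" for S and f :: "'a \<Rightarrow> 'b"
    by (induction S rule: infinite_finite_induct)
       (use assms(1)[of undefined 0] in \<open>auto intro: assms\<close>)
  then show ?thesis by (subst nc_poly_sum_words)
qed

lemma free_alg_sel [simp]:
  "x \<oplus>\<^bsub>free_alg G\<^esub> y = x + y" "x \<otimes>\<^bsub>free_alg G\<^esub> y = x * y"
  "\<zero>\<^bsub>free_alg G\<^esub> = 0" "\<one>\<^bsub>free_alg G\<^esub> = 1"
  by (simp_all add: free_alg_def)

lemma free_alg_closed [simp, intro]:
  fixes p q :: "('a, 'b::field) nc_poly"
  shows "(0 :: ('a, 'b) nc_poly) \<in> carrier (free_alg G)" "(1 :: ('a, 'b) nc_poly) \<in> carrier (free_alg G)"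
  "p \<in> carrier (free_alg G) \<Longrightarrow> q \<in> carrier (free_alg G) \<Longrightarrow> p + q \<in> carrier (free_alg G)"
  "p \<in> carrier (free_alg G) \<Longrightarrow> q \<in> carrier (free_alg G) \<Longrightarrow> p * q \<in> carrier (free_alg G)"
  "p \<in> carrier (free_alg G) \<Longrightarrow> - p \<in> carrier (free_alg G)"
  "p \<in> carrier (free_alg G) \<Longrightarrow> q \<in> carrier (free_alg G) \<Longrightarrow> p - q \<in> carrier (free_alg G)"
  "set w \<subseteq> G \<Longrightarrow> Poly_Mapping.single w c \<in> carrier (free_alg G)"
proof -
  interpret ring "free_alg G :: ('a, 'b) nc_poly ring" by (rule ring_free_alg)
  show "0 \<in> carrier (free_alg G :: ('a, 'b) nc_poly ring)"
      "1 \<in> carrier (free_alg G :: ('a, 'b) nc_poly ring)"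
    using zero_closed one_closed by simp_all
  show add: "p + q \<in> carrier (free_alg G)"
    if "p \<in> carrier (free_alg G)" "q \<in> carrier (free_alg G)" for p q :: "('a, 'b) nc_poly"
    using a_closed[OF that] by simp
  show "p * q \<in> carrier (free_alg G)"
    if "p \<in> carrier (free_alg G)" "q \<in> carrier (free_alg G)" for p q :: "('a, 'b) nc_poly"
    using m_closed[OF that] by simp
  show minus: "- p \<in> carrier (free_alg G)" if "p \<in> carrier (free_alg G)" for p :: "('a, 'b) nc_poly"
    using that by (simp add: free_alg_def)
  show "p - q \<in> carrier (free_alg G)"
    if "p \<in> carrier (free_alg G)" "q \<in> carrier (free_alg G)" for p q :: "('a, 'b) nc_poly"
    using add[OF that(1) minus[OF that(2)]] by simp
  show "Poly_Mapping.single w c \<in> carrier (free_alg G)" if "set w \<subseteq> G"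
    using that by (auto simp: free_alg_def)
qed

lemma free_alg_a_inv [simp]:
  "p \<in> carrier (free_alg G) \<Longrightarrow> \<ominus>\<^bsub>free_alg G\<^esub> p = - p"
  by (rule abelian_group.minus_equality[OF ring.is_abelian_group[OF ring_free_alg]]) simp_all

text \<open>Linearity is asked on the whole ambient type, stability only on \<open>C\<close>. The
  carrier can thus be a proper subspace, such as \<open>wcarrier\<close> among all families of
  pairs, or a submodule of it.\<close>

locale nc_rep = vector_space sc for sc :: "'k::field \<Rightarrow> 'v::ab_group_add \<Rightarrow> 'v" +
  fixes \<rho> :: "'g \<Rightarrow> 'v \<Rightarrow> 'v" and G :: "'g set" and C :: "'v set"
  assumes gen_add: "\<rho> s (u + v) = \<rho> s u + \<rho> s v"
    and gen_scale: "\<rho> s (sc c v) = sc c (\<rho> s v)"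
    and C_zero: "0 \<in> C"
    and C_add: "u \<in> C \<Longrightarrow> v \<in> C \<Longrightarrow> u + v \<in> C"
    and C_scale: "v \<in> C \<Longrightarrow> sc c v \<in> C"
    and C_gen: "s \<in> G \<Longrightarrow> v \<in> C \<Longrightarrow> \<rho> s v \<in> C"
begin

abbreviation act :: "('g, 'k) nc_poly \<Rightarrow> 'v \<Rightarrow> 'v" where
  "act \<equiv> nc_act sc \<rho>"

lemma act_superset:
  "finite S \<Longrightarrow> Poly_Mapping.keys p \<subseteq> S \<Longrightarrow>
     act p v = (\<Sum>w\<in>S. sc (Poly_Mapping.lookup p w) (foldr \<rho> w v))"
  unfolding nc_act_def by (rule sum.mono_neutral_left) (auto simp: in_keys_iff)

lemma act_add: "act (p + q) v = act p v + act q v"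
proof -
  let ?S = "Poly_Mapping.keys p \<union> Poly_Mapping.keys q"
  have "finite ?S" by simp
  then show ?thesis
    using Poly_Mapping.keys_add[of p q]
    by (simp add: act_superset[of ?S] lookup_add scale_left_distrib sum.distrib)
qed

lemma act_zero [simp]: "act 0 v = 0"
  by (simp add: nc_act_def)

lemma act_uminus: "act (- p) v = - act p v"
  using act_add[of p "- p" v] by (simp add: eq_neg_iff_add_eq_0 add.commute)

lemma act_diff: "act (p - q) v = act p v - act q v"
  using act_add[of p "- q" v] by (simp add: act_uminus)

lemma act_sum: "act (\<Sum>i\<in>I. p i) v = (\<Sum>i\<in>I. act (p i) v)"
  by (induction I rule: infinite_finite_induct) (auto simp: act_add)

lemma act_single [simp]: "act (Poly_Mapping.single w c) v = sc c (foldr \<rho> w v)"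
  by (cases "c = 0") (simp_all add: nc_act_def)

lemma act_one [simp]: "act 1 v = v"
  by (simp flip: single_one add: zero_list_def)

lemma word_add: "foldr \<rho> w (u + v) = foldr \<rho> w u + foldr \<rho> w v"
  by (induction w) (simp_all add: gen_add)

lemma word_scale: "foldr \<rho> w (sc c v) = sc c (foldr \<rho> w v)"
  by (induction w) (simp_all add: gen_scale)

lemma act_add_right: "act p (u + v) = act p u + act p v"
  by (simp add: nc_act_def word_add scale_right_distrib sum.distrib)

lemma act_scale_right: "act p (sc c v) = sc c (act p v)"
  by (simp add: nc_act_def word_scale scale_sum_right mult.commute)

lemma act_zero_right [simp]: "act p 0 = 0"
  using act_add_right[of p 0 0] by simp

text \<open>Both sides are additive in each factor, which reduces the claim to terms; there
  concatenation of words is composition of operators.\<close>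

lemma act_mult: "act (p * q) v = act p (act q v)"
proof -
  have 1: "act (Poly_Mapping.single w c * Poly_Mapping.single w' c') v
      = act (Poly_Mapping.single w c) (act (Poly_Mapping.single w' c') v)" for w w' c c'
    by (simp add: mult_single plus_list_def word_scale)
  have 2: "act (Poly_Mapping.single w c * q) v = act (Poly_Mapping.single w c) (act q v)" for w c
    by (induction q rule: nc_poly_induct)
       (simp_all only: 1 distrib_left act_add act_add_right)
  show ?thesis
    by (induction p rule: nc_poly_induct)
       (simp_all only: 2 distrib_right act_add act_add_right)
qed

lemma word_closed: "set w \<subseteq> G \<Longrightarrow> v \<in> C \<Longrightarrow> foldr \<rho> w v \<in> C"
  by (induction w) (auto intro: C_gen)

lemma C_sum: "(\<And>i. i \<in> I \<Longrightarrow> f i \<in> C) \<Longrightarrow> sum f I \<in> C"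
  by (induction I rule: infinite_finite_induct) (auto intro: C_zero C_add)

lemma act_closed: "p \<in> carrier (free_alg G) \<Longrightarrow> v \<in> C \<Longrightarrow> act p v \<in> C"
  unfolding nc_act_def by (intro C_sum C_scale word_closed) (auto simp: free_alg_def)

text \<open>The polynomials that kill all of \<open>C\<close> form a two-sided ideal: a factor on
  the right is harmless because \<open>C\<close> is stable under the action.\<close>

lemma act_ideal:
  assumes "R \<subseteq> carrier (free_alg G)" and "\<And>r v. r \<in> R \<Longrightarrow> v \<in> C \<Longrightarrow> act r v = 0"
    and "p \<in> Idl\<^bsub>free_alg G\<^esub> R" and "v \<in> C"
  shows "act p v = 0"
proof -
  let ?F = "free_alg G :: ('g, 'k) nc_poly ring"
  interpret F: ring ?F by (rule ring_free_alg)
  let ?I = "{p \<in> carrier ?F. \<forall>v\<in>C. act p v = 0}"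
  have "ideal ?I ?F"
  proof (rule idealI)
    show "ring ?F" by (rule ring_free_alg)
    show "subgroup ?I (add_monoid ?F)"
    proof (rule F.add.subgroupI)
      show "\<ominus>\<^bsub>?F\<^esub> x \<in> ?I" if "x \<in> ?I" for x
        using that by (auto simp: act_uminus)
    qed (auto simp: act_add)
  qed (auto simp: act_mult intro: act_closed)
  then have "Idl\<^bsub>?F\<^esub> R \<subseteq> ?I"
    by (rule F.genideal_minimal) (use assms(1,2) in auto)
  with assms(3,4) show ?thesis by blast
qed

end

section \<open>The algebra as a quotient of the free algebra, and its representations\<close>

abbreviation gens3 :: "gen set" where
  "gens3 \<equiv> Dl ` S3 \<union> Xg ` O23"

lemma finite_S3 [simp]: "finite S3"
  by (simp add: S3_eq)

lemma dl_closed [simp, intro]: "g \<in> S3 \<Longrightarrow> dl g \<in> carrier free3"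
  and xg_closed [simp, intro]: "t \<in> O23 \<Longrightarrow> xg t \<in> carrier free3"
  and scalar_closed [simp, intro]: "Poly_Mapping.single [] c \<in> carrier free3"
  by auto

lemma free_alg_sum_closed [intro]:
  fixes p :: "'i \<Rightarrow> ('a, 'b::field) nc_poly"
  shows "(\<And>i. i \<in> I \<Longrightarrow> p i \<in> carrier (free_alg G)) \<Longrightarrow> sum p I \<in> carrier (free_alg G)"
  by (induction I rule: infinite_finite_induct) auto

lemma fn_poly_closed [simp, intro]: "fn_poly f \<in> carrier free3"
  unfolding fn_poly_def by (intro free_alg_sum_closed) auto

lemma s_in_O23 [simp]: "s12 \<in> O23" "s13 \<in> O23" "s23 \<in> O23"
  by (auto simp: O23_eq)

lemma in_S3 [simp]: "id \<in> S3" "s12 \<in> S3" "s13 \<in> S3" "s23 \<in> S3" "rot \<in> S3" "tor \<in> S3"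
  by (auto simp: S3_eq)

lemmas alg_rels_eq = alg_rels_def [folded s12_def s13_def s23_def]

lemma alg_rels_closed: "alg_rels a \<subseteq> carrier free3"
  unfolding alg_rels_eq
  by (auto intro!: free_alg_closed(3-6) dl_closed xg_closed free_alg_sum_closed O23_S3_closed)

lemma ideal_alg_ideal: "ideal (alg_ideal a) free3"
  unfolding alg_ideal_def by (intro ring.genideal_ideal ring_free_alg alg_rels_closed)

lemma ring_alg: "ring (alg a)"
  unfolding alg_def by (intro ideal.quotient_is_ring ideal_alg_ideal)

lemma carrier_alg: "carrier (alg a) = alg_cls a ` carrier free3"
  by (auto simp: alg_def FactRing_def A_RCOSETS_def' alg_cls_def)

lemma alg_cls_closed [intro]: "p \<in> carrier free3 \<Longrightarrow> alg_cls a p \<in> carrier (alg a)"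
  by (auto simp: carrier_alg)

lemma alg_cls_add:
  "p \<in> carrier free3 \<Longrightarrow> q \<in> carrier free3 \<Longrightarrow>
     alg_cls a p \<oplus>\<^bsub>alg a\<^esub> alg_cls a q = alg_cls a (p + q)"
  using ideal.a_rcos_sum[OF ideal_alg_ideal] by (simp add: alg_def FactRing_def alg_cls_def)

lemma alg_cls_mult:
  "p \<in> carrier free3 \<Longrightarrow> q \<in> carrier free3 \<Longrightarrow>
     alg_cls a p \<otimes>\<^bsub>alg a\<^esub> alg_cls a q = alg_cls a (p * q)"
  using ideal.rcoset_mult_add[OF ideal_alg_ideal] by (simp add: alg_def FactRing_def alg_cls_def)

lemma alg_one: "\<one>\<^bsub>alg a\<^esub> = alg_cls a 1"
  by (simp add: alg_def FactRing_def alg_cls_def)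

lemma alg_cls_eqI:
  assumes "p \<in> carrier free3" "q \<in> carrier free3" "p - q \<in> alg_ideal a"
  shows "alg_cls a p = alg_cls a q"
proof -
  interpret I: ideal "alg_ideal a" free3 by (rule ideal_alg_ideal)
  have "p \<in> alg_ideal a +>\<^bsub>free3\<^esub> q"
    unfolding a_r_coset_def' using assms by (auto intro!: bexI[of _ "p - q"])
  then show ?thesis
    unfolding alg_cls_def using assms by (metis I.a_repr_independence I.is_additive_subgroup additive_subgroup.a_subgroup)
qed

lemma alg_ideal_rel: "r \<in> alg_rels a \<Longrightarrow> r \<in> alg_ideal a"
  unfolding alg_ideal_def by (rule subsetD[OF ring.genideal_self[OF ring_free_alg alg_rels_closed]])

lemma alg_ideal_mult:
  assumes "r \<in> alg_ideal a" "p \<in> carrier free3" "q \<in> carrier free3"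
  shows "p * r * q \<in> alg_ideal a"
  using ideal.I_l_closed[OF ideal_alg_ideal assms(1,2)] assms(3)
    ideal.I_r_closed[OF ideal_alg_ideal] by simp

locale alg_rep = nc_rep sc \<rho> gens3 C
  for sc :: "'k::field \<Rightarrow> 'v::ab_group_add \<Rightarrow> 'v" and \<rho> C +
  fixes a :: "perm3 \<Rightarrow> 'k"
  assumes Dl_Dl: "v \<in> C \<Longrightarrow> g \<in> S3 \<Longrightarrow> h \<in> S3 \<Longrightarrow> 
      \<rho> (Dl g) (\<rho> (Dl h) v) = (if g = h then \<rho> (Dl g) v else 0)"
    and sum_Dl: "v \<in> C \<Longrightarrow> (\<Sum>g\<in>S3. \<rho> (Dl g) v) = v"
    and Dl_Xg: "v \<in> C \<Longrightarrow> h \<in> S3 \<Longrightarrow> t \<in> O23 \<Longrightarrow>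
      \<rho> (Dl h) (\<rho> (Xg t) v) = \<rho> (Xg t) (\<rho> (Dl (t \<circ> h)) v)"
    and Xg_sq: "v \<in> C \<Longrightarrow> t \<in> O23 \<Longrightarrow>
      \<rho> (Xg t) (\<rho> (Xg t) v) = (\<Sum>g\<in>S3. sc (ff a t g) (\<rho> (Dl g) v))"
    and Xg_cubic1: "v \<in> C \<Longrightarrow>
      \<rho> (Xg s13) (\<rho> (Xg s23) v) + \<rho> (Xg s23) (\<rho> (Xg s12) v) + \<rho> (Xg s12) (\<rho> (Xg s13) v) = 0"
    and Xg_cubic2: "v \<in> C \<Longrightarrow>
      \<rho> (Xg s23) (\<rho> (Xg s13) v) + \<rho> (Xg s13) (\<rho> (Xg s12) v) + \<rho> (Xg s12) (\<rho> (Xg s23) v) = 0"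
begin

lemma act_rels: "r \<in> alg_rels a \<Longrightarrow> v \<in> C \<Longrightarrow> act r v = 0"
  unfolding alg_rels_eq
  using Dl_Dl sum_Dl Dl_Xg Xg_sq Xg_cubic1 Xg_cubic2
  by (auto simp: act_diff act_mult act_sum act_add fn_poly_def)

lemma act_alg_ideal: "p \<in> alg_ideal a \<Longrightarrow> v \<in> C \<Longrightarrow> act p v = 0"
  unfolding alg_ideal_def by (rule act_ideal[OF alg_rels_closed act_rels])

text \<open>Representatives of one coset differ by an element of the ideal, which kills
  \<open>C\<close>. The set of their values is therefore a singleton, as \<open>the_elem\<close>
  requires.\<close>

lemma rep_mod_smult:
  assumes "p \<in> carrier free3" "v \<in> C"
  shows "alg_cls a p \<odot>\<^bsub>rep_mod C sc \<rho>\<^esub> v = act p v"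
proof -
  have "(\<lambda>q. act q v) ` alg_cls a p = {act p v}"
    unfolding alg_cls_def a_r_coset_def'
    using act_alg_ideal[OF _ assms(2)] ideal.axioms(1)[OF ideal_alg_ideal[of a], THEN additive_subgroup.zero_closed]
    by (auto simp: act_add)
  then show ?thesis by (simp add: rep_mod_def)
qed

end

section \<open>A twelve-dimensional model\<close>

text \<open>A vector is a family of pairs indexed by the weights. For \<open>g \<noteq> id\<close> the pair at \<open>g\<close> holds the
  coordinates in the bottom and the top copy of \<open>L\<close>; at \<open>id\<close> it holds two of the three coefficients
  (with sum zero) with which the three generators \<open>x\<^sub>t\<close> map \<open>M[e]\<close> to the bottom copy.\<close>

type_synonym 'k wvec = "perm3 \<Rightarrow> 'k \<times> 'k"

definition wscale :: "'k::field \<Rightarrow> 'k wvec \<Rightarrow> 'k wvec" where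
  "wscale c v = (\<lambda>g. (c * fst (v g), c * snd (v g)))"

definition wcarrier :: "'k::field wvec set" where
  "wcarrier = {v. \<forall>g. g \<notin> S3 \<longrightarrow> v g = 0}"

text \<open>The coefficients that glue the top copy of \<open>L\<close> to the bottom one.\<close>

definition eps :: "perm3 \<Rightarrow> perm3 \<Rightarrow> 'k::field" where
  "eps t g = (if t = s12 \<and> g \<in> {s23, tor} then 1 else if t = s23 \<and> g \<in> {s13, tor} then -1 else 0)"

text \<open>The component at \<open>g\<close> of \<open>x\<^sub>t v\<close> as a function of the component of \<open>v\<close> at \<open>t \<circ> g\<close>.\<close>

definition wstep :: "(perm3 \<Rightarrow> 'k::field) \<Rightarrow> perm3 \<Rightarrow> perm3 \<Rightarrow> 'k \<times> 'k \<Rightarrow> 'k \<times> 'k" where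
  "wstep a t g w =
    (if g = id then
       (if t = s12 then (0, - (a s13 - a s23) * snd w)
        else if t = s13 then ((a s13 - a s23) * snd w, 0)
        else (- (a s13 - a s23) * snd w, (a s13 - a s23) * snd w))
     else if g = t then
       (if t = s12 then fst w else if t = s13 then snd w else - fst w - snd w, 0)
     else if sign g = 1 then (fst w + eps t g * snd w, ff a t g * snd w)
     else (ff a t g * fst w - eps t g * snd w, snd w))"

definition wgen :: "(perm3 \<Rightarrow> 'k::field) \<Rightarrow> gen \<Rightarrow> 'k wvec \<Rightarrow> 'k wvec" where
  "wgen a s v = (case s of
      Dl h \<Rightarrow> (\<lambda>g. if g = h then v g else 0)
    | Xg t \<Rightarrow> (\<lambda>g. if g \<in> S3 then wstep a t g (v (t \<circ> g)) else 0))"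

lemma wgen_Dl: "wgen a (Dl h) v = (\<lambda>g. if g = h then v g else 0)"
  and wgen_Xg: "wgen a (Xg t) v = (\<lambda>g. if g \<in> S3 then wstep a t g (v (t \<circ> g)) else 0)"
  by (simp_all add: wgen_def)

lemma wstep_add: "wstep a t g (u + v) = wstep a t g u + wstep a t g v"
  by (simp add: wstep_def algebra_simps)

lemma wstep_scale: "wstep a t g (c * x, c * y) = (c * fst (wstep a t g (x, y)), c * snd (wstep a t g (x, y)))"
  by (simp add: wstep_def algebra_simps)

lemma wstep_zero [simp]: "wstep a t g 0 = 0"
  by (simp add: wstep_def zero_prod_def)

text \<open>\<open>eps\<close> has the same value at the two ends of an edge but enters with
  opposite signs at even and odd weights, so it cancels when the edge is walked back and forth.
  Between e and t both sides vanish.\<close>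

lemma wstep_sq:
  assumes "t \<in> O23" "g \<in> S3"
  shows "wstep a t g (wstep a t (t \<circ> g) w) = (ff a t g * fst w, ff a t g * snd w)"
  using assms unfolding S3_eq O23_eq
  by (elim insertE emptyE; simp add: wstep_def eps_def prod_eq_iff; (simp add: algebra_simps)?)

text \<open>This is where \<open>eps\<close> is needed. For example, from the top vector of weight
  \<open>s13\<close> to the bottom vector of weight \<open>s12\<close> the path through
  \<open>id\<close> contributes q = \<open>a s13 - a s23\<close>, the path through
  \<open>tor\<close> contributes -q because \<open>eps s23 tor = -1\<close>, and the path through
  \<open>rot\<close> contributes nothing.\<close>

lemma wstep_cubic1:
  assumes "g \<in> S3"
  shows "wstep a s13 g (wstep a s23 (s13 \<circ> g) w) + wstep a s23 g (wstep a s12 (s23 \<circ> g) w)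
    + wstep a s12 g (wstep a s13 (s12 \<circ> g) w) = 0"
  using assms unfolding S3_eq
  by (elim insertE emptyE; simp add: wstep_def eps_def prod_eq_iff; (simp add: algebra_simps)?)

lemma wstep_cubic2:
  assumes "g \<in> S3"
  shows "wstep a s23 g (wstep a s13 (s23 \<circ> g) w) + wstep a s13 g (wstep a s12 (s13 \<circ> g) w)
    + wstep a s12 g (wstep a s23 (s12 \<circ> g) w) = 0"
  using assms unfolding S3_eq
  by (elim insertE emptyE; simp add: wstep_def eps_def prod_eq_iff; (simp add: algebra_simps)?)

lemma sum_fun_apply: "(\<Sum>i\<in>I. f i) x = (\<Sum>i\<in>I. f i x)"
  by (induction I rule: infinite_finite_induct) auto

lemma alg_rep_wgen: "alg_rep wscale (wgen a) wcarrier a" for a :: "perm3 \<Rightarrow> 'k::field"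
proof unfold_locales
  show "wgen a s (u + v) = wgen a s u + wgen a s v" for s and u v :: "'k wvec"
    by (cases s) (auto simp: wgen_Dl wgen_Xg fun_eq_iff wstep_add)
  show "wgen a s (wscale c v) = wscale c (wgen a s v)" for s c and v :: "'k wvec"
    by (cases s) (auto simp: wgen_Dl wgen_Xg fun_eq_iff wscale_def wstep_scale zero_prod_def)
  show "(\<Sum>g\<in>S3. wgen a (Dl g) v) = v" if "v \<in> wcarrier" for v :: "'k wvec"
    using that by (intro ext) (auto simp: wgen_Dl wcarrier_def sum_fun_apply sum.delta)
  show "wgen a (Xg t) (wgen a (Xg t) v) = (\<Sum>g\<in>S3. wscale (ff a t g) (wgen a (Dl g) v))"
    if "v \<in> wcarrier" "t \<in> O23" for t and v :: "'k wvec"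
  proof
    fix g
    show "wgen a (Xg t) (wgen a (Xg t) v) g = (\<Sum>g\<in>S3. wscale (ff a t g) (wgen a (Dl g) v)) g"
    proof (cases "g \<in> S3")
      case True
      then have "wgen a (Xg t) (wgen a (Xg t) v) g = wscale (ff a t g) v g"
        using that(2) O23_S3_closed[of t g] O23_involution[of t]
        by (simp add: wgen_Xg wstep_sq o_assoc wscale_def)
      also have "\<dots> = (\<Sum>h\<in>S3. if h = g then wscale (ff a t g) v g else 0)"
        using True by (simp add: sum.delta)
      also have "\<dots> = (\<Sum>h\<in>S3. wscale (ff a t h) (wgen a (Dl h) v) g)"
        by (intro sum.cong) (auto simp: wgen_Dl wscale_def zero_prod_def)
      finally show ?thesis by (simp add: sum_fun_apply)
    next
      case False
      then have "wscale (ff a t h) (wgen a (Dl h) v) g = 0" if "h \<in> S3" for h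
        using that by (auto simp: wgen_Dl wscale_def zero_prod_def)
      with False show ?thesis by (simp add: sum_fun_apply wgen_Xg)
    qed
  qed
  show "wgen a (Dl h) (wgen a (Xg t) v) = wgen a (Xg t) (wgen a (Dl (t \<circ> h)) v)"
    if "v \<in> wcarrier" "h \<in> S3" "t \<in> O23" for h t and v :: "'k wvec"
  proof
    have "t \<circ> g = t \<circ> h \<Longrightarrow> g = h" for g
      using O23_involution[OF that(3)] by (metis fun.map_comp id_comp comp_assoc)
    then show "wgen a (Dl h) (wgen a (Xg t) v) g = wgen a (Xg t) (wgen a (Dl (t \<circ> h)) v) g" for g
      using that by (auto simp: wgen_Dl wgen_Xg)
  qed
  show "wgen a (Xg s13) (wgen a (Xg s23) v) + wgen a (Xg s23) (wgen a (Xg s12) v)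
      + wgen a (Xg s12) (wgen a (Xg s13) v) = 0" for v :: "'k wvec"
  proof
    show "(wgen a (Xg s13) (wgen a (Xg s23) v) + wgen a (Xg s23) (wgen a (Xg s12) v)
      + wgen a (Xg s12) (wgen a (Xg s13) v)) g = 0 g" for g
      \<comment> \<open>Each of the three words reads \<open>v\<close> at the same weight, since
        \<open>s23 \<circ> s13\<close>, \<open>s12 \<circ> s23\<close> and
        \<open>s13 \<circ> s12\<close> all equal \<open>tor\<close>.\<close>
      using wstep_cubic1[of g a "v (tor \<circ> g)"]
      by (cases "g \<in> S3") (auto simp: wgen_Xg o_assoc O23_S3_closed)
  qed
  show "wgen a (Xg s23) (wgen a (Xg s13) v) + wgen a (Xg s13) (wgen a (Xg s12) v)
      + wgen a (Xg s12) (wgen a (Xg s23) v) = 0" for v :: "'k wvec"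
  proof
    show "(wgen a (Xg s23) (wgen a (Xg s13) v) + wgen a (Xg s13) (wgen a (Xg s12) v)
      + wgen a (Xg s12) (wgen a (Xg s23) v)) g = 0 g" for g
      using wstep_cubic2[of g a "v (rot \<circ> g)"]
      by (cases "g \<in> S3") (auto simp: wgen_Xg o_assoc O23_S3_closed)
  qed
  show "wgen a s v \<in> wcarrier" if "s \<in> gens3" "v \<in> wcarrier" for s and v :: "'k wvec"
    using that by (auto simp: wcarrier_def wgen_Dl wgen_Xg)
  show "wgen a (Dl g) (wgen a (Dl h) v) = (if g = h then wgen a (Dl g) v else 0)"
    for g h and v :: "'k wvec"
    by (intro ext) (simp add: wgen_Dl)
  show "wscale c (u + v) = wscale c u + wscale c v" "wscale (c + d) u = wscale c u + wscale d u"
    "wscale c (wscale d u) = wscale (c * d) u" "wscale 1 u = u" for c d and u v :: "'k wvec"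
    by (rule ext, simp add: wscale_def algebra_simps)+
  show "0 \<in> wcarrier" by (simp add: wcarrier_def)
  show "u + v \<in> wcarrier" if "u \<in> wcarrier" "v \<in> wcarrier" for u v :: "'k wvec"
    using that by (simp add: wcarrier_def)
  show "wscale c v \<in> wcarrier" if "v \<in> wcarrier" for c and v :: "'k wvec"
    using that by (simp add: wcarrier_def wscale_def flip: zero_prod_def)
qed

section \<open>Extension of scalars\<close>

text \<open>Carries the group laws across records that may differ in type, here from
  \<open>F Mod K\<close> to the additive group of the induced module.\<close>

lemma comm_group_cong:
  assumes "comm_group G" and "carrier H = carrier G" and "\<one>\<^bsub>H\<^esub> = \<one>\<^bsub>G\<^esub>"
    and "\<And>x y. x \<otimes>\<^bsub>H\<^esub> y = x \<otimes>\<^bsub>G\<^esub> y"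
  shows "comm_group H"
proof -
  interpret G: comm_group G by fact
  show ?thesis
    by (rule comm_groupI) (auto simp: assms(2-) G.m_assoc intro: G.m_comm G.l_inv_ex)
qed

locale induced =
  fixes A :: "'b ring" and \<phi> :: "'r \<Rightarrow> 'b" and R :: "'r ring" and V :: "('r, 'v) module"
  assumes ring_A: "ring A"
    and map_closed: "r \<in> carrier R \<Longrightarrow> \<phi> r \<in> carrier A"
    and V_add_closed: "v \<in> carrier V \<Longrightarrow> w \<in> carrier V \<Longrightarrow> v \<oplus>\<^bsub>V\<^esub> w \<in> carrier V"
    and V_smult_closed: "r \<in> carrier R \<Longrightarrow> v \<in> carrier V \<Longrightarrow> r \<odot>\<^bsub>V\<^esub> v \<in> carrier V"
begin

abbreviation "F \<equiv> free_Abelian_group (carrier A \<times> carrier V)"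
abbreviation "K \<equiv> tensor_ker A \<phi> R V"
abbreviation "I \<equiv> induced_mod A \<phi> R V"
abbreviation "pt \<equiv> pure_tensor A \<phi> R V"

sublocale A: ring A by (rule ring_A)
sublocale F: comm_group F by (rule abelian_free_Abelian_group)

lemma tensor_rels_closed: "tensor_rels A \<phi> R V \<subseteq> carrier F"
proof -
  have diff: "x - y \<in> carrier F" if "x \<in> carrier F" "y \<in> carrier F" for x y :: "('b \<times> 'v) \<Rightarrow>\<^sub>0 int"
    using that Poly_Mapping.keys_diff[of x y] by auto
  show ?thesis
    unfolding tensor_rels_def
    by (intro Un_least subsetI; elim CollectE exE conjE; hypsubst; intro diff)
       (simp_all add: V_add_closed V_smult_closed map_closed)
qed

lemma subgroup_K: "subgroup K F"
  unfolding tensor_ker_def by (rule F.generate_is_subgroup[OF tensor_rels_closed])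

lemma normal_K: "K \<lhd> F"
  by (rule F.normal_iff_subgroup[THEN iffD2, OF subgroup_K])

lemma a_r_coset_tensor_free: "a_r_coset (tensor_free A V) = r_coset F"
  by (intro ext) (simp add: a_r_coset_def r_coset_def tensor_free_def)

lemma carrier_induced: "carrier I = r_coset F K ` carrier F"
  unfolding induced_mod_def quot_mod_def
  by (auto simp: A_RCOSETS_def' a_r_coset_tensor_free) (auto simp: tensor_free_def)

lemma comm_group_induced: "comm_group (add_monoid I)"
proof (rule comm_group_cong)
  show "comm_group (F Mod K)" by (rule F.abelian_FactGroup[OF subgroup_K])
  show "carrier (add_monoid I) = carrier (F Mod K)"
    by (simp add: carrier_induced carrier_FactGroup)
  show "\<one>\<^bsub>add_monoid I\<^esub> = \<one>\<^bsub>F Mod K\<^esub>"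
    by (simp add: induced_mod_def quot_mod_def)
  show "x \<otimes>\<^bsub>add_monoid I\<^esub> y = x \<otimes>\<^bsub>F Mod K\<^esub> y" for x y
    by (simp add: induced_mod_def quot_mod_def set_add_defs tensor_free_def)
qed

sublocale I: abelian_group I
  by (rule abelian_group.intro)
     (use comm_group_induced in \<open>auto simp: abelian_monoid_def comm_group_def abelian_group_axioms_def\<close>)

lemma coset_add:
  "x \<in> carrier F \<Longrightarrow> y \<in> carrier F \<Longrightarrow> r_coset F K x \<oplus>\<^bsub>I\<^esub> r_coset F K y = r_coset F K (x + y)"
  using normal.rcos_sum[OF normal_K, of x y]
  by (simp add: induced_mod_def quot_mod_def set_add_defs tensor_free_def)

lemma coset_eqI:
  assumes "x \<in> carrier F" "y \<in> carrier F" "x - y \<in> K"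
  shows "r_coset F K x = r_coset F K y"
proof -
  have "x \<in> r_coset F K y"
    using assms(3) unfolding r_coset_def by (auto intro!: bexI[of _ "x - y"])
  then show ?thesis using F.repr_independence assms(2) subgroup_K by blast
qed

lemma coset_diff:
  assumes "x \<in> carrier F" "y \<in> carrier F"
  shows "r_coset F K x \<ominus>\<^bsub>I\<^esub> r_coset F K y = r_coset F K (x - y)"
proof -
  have "- y \<in> carrier F" "x - y \<in> carrier F"
    using assms Poly_Mapping.keys_diff[of x y] by auto
  moreover have "\<zero>\<^bsub>I\<^esub> = r_coset F K 0"
    using F.coset_join2[OF _ subgroup_K, of 0] subgroup.one_closed[OF subgroup_K]
    by (simp add: induced_mod_def quot_mod_def)
  ultimately have "\<ominus>\<^bsub>I\<^esub> r_coset F K y = r_coset F K (- y)"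
    using assms by (intro I.minus_equality) (auto simp: coset_add carrier_induced)
  with assms \<open>- y \<in> carrier F\<close> show ?thesis
    by (simp add: a_minus_def coset_add)
qed

lemma pt_eq: "pt x v = r_coset F K (frag_of (x, v))"
  by (simp add: pure_tensor_def a_r_coset_tensor_free)

lemma pt_closed: "x \<in> carrier A \<Longrightarrow> v \<in> carrier V \<Longrightarrow> pt x v \<in> carrier I"
  by (auto simp: pt_eq carrier_induced)

lemma pt_add_left:
  assumes "x \<in> carrier A" "y \<in> carrier A" "v \<in> carrier V"
  shows "pt (x \<oplus>\<^bsub>A\<^esub> y) v = pt x v \<oplus>\<^bsub>I\<^esub> pt y v"
proof -
  have "frag_of (x \<oplus>\<^bsub>A\<^esub> y, v) - frag_of (x, v) - frag_of (y, v) \<in> K"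
    unfolding tensor_ker_def tensor_rels_def using assms by (intro generate.incl) blast
  then have "r_coset F K (frag_of (x \<oplus>\<^bsub>A\<^esub> y, v)) = r_coset F K (frag_of (x, v) + frag_of (y, v))"
    using assms Poly_Mapping.keys_add[of "frag_of (x, v)" "frag_of (y, v)"]
    by (intro coset_eqI) (auto simp: algebra_simps)
  with assms show ?thesis by (simp add: pt_eq coset_add)
qed

lemma pt_balanced:
  assumes "x \<in> carrier A" "r \<in> carrier R" "v \<in> carrier V"
  shows "pt (x \<otimes>\<^bsub>A\<^esub> \<phi> r) v = pt x (r \<odot>\<^bsub>V\<^esub> v)"
proof -
  have "frag_of (x \<otimes>\<^bsub>A\<^esub> \<phi> r, v) - frag_of (x, r \<odot>\<^bsub>V\<^esub> v) \<in> K"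
    unfolding tensor_ker_def tensor_rels_def using assms by (intro generate.incl) blast
  with assms show ?thesis
    unfolding pt_eq by (intro coset_eqI) (auto simp: map_closed V_smult_closed)
qed

lemma induced_induct [consumes 1, case_names pure diff]:
  assumes "X \<in> carrier I"
    and pure: "\<And>x v. x \<in> carrier A \<Longrightarrow> v \<in> carrier V \<Longrightarrow> P (pt x v)"
    and diff: "\<And>X Y. X \<in> carrier I \<Longrightarrow> Y \<in> carrier I \<Longrightarrow> P X \<Longrightarrow> P Y \<Longrightarrow> P (X \<ominus>\<^bsub>I\<^esub> Y)"
    and V_ne: "carrier V \<noteq> {}"
  shows "P X"
proof -
  obtain v where "v \<in> carrier V" using V_ne by blast
  \<comment> \<open>Zero arises as a pure tensor minus itself, which takes some element of
    \<open>V\<close>.\<close>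
  have zero: "P (r_coset F K 0)"
    using diff[OF pt_closed pt_closed pure pure, of \<open>\<zero>\<^bsub>A\<^esub>\<close> v \<open>\<zero>\<^bsub>A\<^esub>\<close> v] \<open>v \<in> carrier V\<close>
    by (simp add: pt_eq coset_diff)
  obtain x where "X = r_coset F K x" "x \<in> carrier F"
    using assms(1) by (auto simp: carrier_induced)
  have "P (r_coset F K x)" if "Poly_Mapping.keys x \<subseteq> carrier A \<times> carrier V" for x
    using that
  proof (rule free_Abelian_group_induct)
    show "P (r_coset F K (x - y))"
      if "Poly_Mapping.keys x \<subseteq> carrier A \<times> carrier V" "Poly_Mapping.keys y \<subseteq> carrier A \<times> carrier V"
        "P (r_coset F K x)" "P (r_coset F K y)" for x y
    proof -
      have "x \<in> carrier F" "y \<in> carrier F" using that by simp_all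
      then show ?thesis
        using diff[OF _ _ that(3,4)] by (simp add: coset_diff carrier_induced del: carrier_free_Abelian_group_iff)
    qed
    show "P (r_coset F K (frag_of z))" if "z \<in> carrier A \<times> carrier V" for z
      using that pure[of "fst z" "snd z"] by (cases z) (simp add: pt_eq)
  qed (rule zero)
  with \<open>X = _\<close> \<open>x \<in> _\<close> show ?thesis by simp
qed

lemma smult_coset_closed:
  assumes "b \<in> carrier A" "x \<in> carrier F"
  shows "b \<odot>\<^bsub>tensor_free A V\<^esub> x \<in> carrier F"
proof -
  have "Poly_Mapping.keys (frag_extend (\<lambda>(x, v). frag_of (b \<otimes>\<^bsub>A\<^esub> x, v)) x)
      \<subseteq> (\<Union>(y, v)\<in>Poly_Mapping.keys x. {(b \<otimes>\<^bsub>A\<^esub> y, v)})"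
    using keys_frag_extend[of "\<lambda>(x, v). frag_of (b \<otimes>\<^bsub>A\<^esub> x, v)" x]
    by (simp add: case_prod_unfold)
  also have "\<dots> \<subseteq> carrier A \<times> carrier V"
    using assms by auto
  finally show ?thesis by (simp add: tensor_free_def)
qed

lemma smult_diff:
  "b \<odot>\<^bsub>tensor_free A V\<^esub> (x - y) = b \<odot>\<^bsub>tensor_free A V\<^esub> x - b \<odot>\<^bsub>tensor_free A V\<^esub> y"
  "b \<odot>\<^bsub>tensor_free A V\<^esub> (x + y) = b \<odot>\<^bsub>tensor_free A V\<^esub> x + b \<odot>\<^bsub>tensor_free A V\<^esub> y"
  "b \<odot>\<^bsub>tensor_free A V\<^esub> (- x) = - (b \<odot>\<^bsub>tensor_free A V\<^esub> x)"
  "b \<odot>\<^bsub>tensor_free A V\<^esub> 0 = 0"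
  by (simp_all add: tensor_free_def frag_extend_diff frag_extend_add frag_extend_minus)

lemma smult_frag_of: "b \<odot>\<^bsub>tensor_free A V\<^esub> frag_of (x, v) = frag_of (b \<otimes>\<^bsub>A\<^esub> x, v)"
  by (simp add: tensor_free_def)

text \<open>Multiplication by \<open>b\<close> acts on the left of the first factor, while the
  balancing relation moves scalars across its right side; so each of the three families of relations
  is mapped to itself.\<close>

lemma tensor_rels_smult:
  assumes b: "b \<in> carrier A" and "z \<in> tensor_rels A \<phi> R V"
  shows "b \<odot>\<^bsub>tensor_free A V\<^esub> z \<in> tensor_rels A \<phi> R V"
proof -
  consider (left) x y v where "z = frag_of (x \<oplus>\<^bsub>A\<^esub> y, v) - frag_of (x, v) - frag_of (y, v)"
      "x \<in> carrier A" "y \<in> carrier A" "v \<in> carrier V"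
    | (right) x v w where "z = frag_of (x, v \<oplus>\<^bsub>V\<^esub> w) - frag_of (x, v) - frag_of (x, w)"
      "x \<in> carrier A" "v \<in> carrier V" "w \<in> carrier V"
    | (bal) x r v where "z = frag_of (x \<otimes>\<^bsub>A\<^esub> \<phi> r, v) - frag_of (x, r \<odot>\<^bsub>V\<^esub> v)"
      "x \<in> carrier A" "r \<in> carrier R" "v \<in> carrier V"
    using assms(2) unfolding tensor_rels_def by blast
  then show ?thesis
  proof cases
    case left
    then have "b \<odot>\<^bsub>tensor_free A V\<^esub> z = frag_of ((b \<otimes>\<^bsub>A\<^esub> x) \<oplus>\<^bsub>A\<^esub> (b \<otimes>\<^bsub>A\<^esub> y), v)
        - frag_of (b \<otimes>\<^bsub>A\<^esub> x, v) - frag_of (b \<otimes>\<^bsub>A\<^esub> y, v)"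
      using b by (simp add: smult_diff smult_frag_of A.r_distr)
    then show ?thesis
      unfolding tensor_rels_def using b left A.m_closed by blast
  next
    case right
    then have "b \<odot>\<^bsub>tensor_free A V\<^esub> z = frag_of (b \<otimes>\<^bsub>A\<^esub> x, v \<oplus>\<^bsub>V\<^esub> w)
        - frag_of (b \<otimes>\<^bsub>A\<^esub> x, v) - frag_of (b \<otimes>\<^bsub>A\<^esub> x, w)"
      by (simp add: smult_diff smult_frag_of)
    then show ?thesis
      unfolding tensor_rels_def using b right A.m_closed by blast
  next
    case bal
    then have "b \<odot>\<^bsub>tensor_free A V\<^esub> z = frag_of ((b \<otimes>\<^bsub>A\<^esub> x) \<otimes>\<^bsub>A\<^esub> \<phi> r, v)
        - frag_of (b \<otimes>\<^bsub>A\<^esub> x, r \<odot>\<^bsub>V\<^esub> v)"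
      using b by (simp add: smult_diff smult_frag_of A.m_assoc map_closed)
    then show ?thesis
      unfolding tensor_rels_def using b bal A.m_closed by blast
  qed
qed

lemma K_smult:
  assumes "b \<in> carrier A" "x \<in> K"
  shows "b \<odot>\<^bsub>tensor_free A V\<^esub> x \<in> K"
  using assms(2) unfolding tensor_ker_def
proof (induction x rule: generate.induct)
  case one
  show ?case using generate.one[of F] by (simp add: smult_diff)
next
  case (incl h)
  then show ?case by (intro generate.incl tensor_rels_smult assms(1))
next
  case (inv h)
  then have "h \<in> carrier F" using tensor_rels_closed by blast
  then have "b \<odot>\<^bsub>tensor_free A V\<^esub> (inv\<^bsub>F\<^esub> h) = inv\<^bsub>F\<^esub> (b \<odot>\<^bsub>tensor_free A V\<^esub> h)"
    using smult_coset_closed[OF assms(1)] by (simp add: smult_diff)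
  then show ?case
    using generate.inv[OF tensor_rels_smult[OF assms(1) inv], of F] by simp
next
  case (eng h1 h2)
  then show ?case using generate.eng[OF eng.IH] by (simp add: smult_diff)
qed

text \<open>\<open>quot_mod\<close> defines the action by a union over the coset. As
  \<open>K\<close> is stable under multiplication, the members of this union coincide.\<close>

lemma smult_coset:
  assumes "b \<in> carrier A" "x \<in> carrier F"
  shows "b \<odot>\<^bsub>I\<^esub> r_coset F K x = r_coset F K (b \<odot>\<^bsub>tensor_free A V\<^esub> x)"
proof -
  have "r_coset F K (b \<odot>\<^bsub>tensor_free A V\<^esub> y) = r_coset F K (b \<odot>\<^bsub>tensor_free A V\<^esub> x)"
    if y: "y \<in> r_coset F K x" for y
  proof -
    obtain k where k: "k \<in> K" "y = k + x" using y by (auto simp: r_coset_def)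
    then have "y \<in> carrier F"
      using assms(2) subgroup.mem_carrier[OF subgroup_K, of k] F.m_closed[of k x] by simp
    then show ?thesis
      using assms k K_smult[OF assms(1) k(1)]
      by (intro coset_eqI smult_coset_closed) (simp_all add: smult_diff)
  qed
  moreover have "x \<in> r_coset F K x" using F.rcos_self[OF assms(2) subgroup_K] .
  ultimately have "(\<Union>y\<in>r_coset F K x. r_coset F K (b \<odot>\<^bsub>tensor_free A V\<^esub> y))
      = r_coset F K (b \<odot>\<^bsub>tensor_free A V\<^esub> x)" by blast
  then show ?thesis
    by (simp add: induced_mod_def quot_mod_def a_r_coset_tensor_free)
qed

lemma smult_pt:
  "b \<in> carrier A \<Longrightarrow> x \<in> carrier A \<Longrightarrow> v \<in> carrier V \<Longrightarrow> b \<odot>\<^bsub>I\<^esub> pt x v = pt (b \<otimes>\<^bsub>A\<^esub> x) v"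
  by (simp add: pt_eq smult_coset smult_frag_of)

text \<open>A balanced biadditive map extends to the free abelian group and kills the relations,
  hence factors through the quotient. Only its values on pure tensors are recorded: the purpose is
  to tell pure tensors apart.\<close>

lemma induced_universal:
  assumes "comm_group G"
    and "\<And>x v. x \<in> carrier A \<Longrightarrow> v \<in> carrier V \<Longrightarrow> f x v \<in> carrier G"
    and "\<And>x y v. x \<in> carrier A \<Longrightarrow> y \<in> carrier A \<Longrightarrow> v \<in> carrier V \<Longrightarrow> 
      f (x \<oplus>\<^bsub>A\<^esub> y) v = f x v \<otimes>\<^bsub>G\<^esub> f y v"
    and "\<And>x v w. x \<in> carrier A \<Longrightarrow> v \<in> carrier V \<Longrightarrow> w \<in> carrier V \<Longrightarrow>
      f x (v \<oplus>\<^bsub>V\<^esub> w) = f x v \<otimes>\<^bsub>G\<^esub> f x w"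
    and "\<And>x r v. x \<in> carrier A \<Longrightarrow> r \<in> carrier R \<Longrightarrow> v \<in> carrier V \<Longrightarrow>
      f (x \<otimes>\<^bsub>A\<^esub> \<phi> r) v = f x (r \<odot>\<^bsub>V\<^esub> v)"
  obtains h where "\<And>x v. x \<in> carrier A \<Longrightarrow> v \<in> carrier V \<Longrightarrow> h (pt x v) = f x v"
proof -
  interpret G: comm_group G by fact
  obtain k where k: "k \<in> hom F G" and k_f: "\<And>x. x \<in> carrier A \<times> carrier V \<Longrightarrow> k (frag_of x) = case_prod f x"
    by (rule G.free_Abelian_group_universal[of "case_prod f" "carrier A \<times> carrier V"])
       (use assms(2) in auto)
  interpret k: group_hom F G k using k by unfold_locales
  have k_diff: "k (x - y) = k x \<otimes>\<^bsub>G\<^esub> inv\<^bsub>G\<^esub> k y" if "x \<in> carrier F" "y \<in> carrier F" for x y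
  proof -
    have "x - y = x \<otimes>\<^bsub>F\<^esub> inv\<^bsub>F\<^esub> y" using that by simp
    then show ?thesis using that by (metis k.hom_inv k.hom_mult F.inv_closed)
  qed
  have F_diff: "x - y \<in> carrier F" if "x \<in> carrier F" "y \<in> carrier F" for x y
    using that Poly_Mapping.keys_diff[of x y] by auto
  have cancel: "(x \<otimes>\<^bsub>G\<^esub> y) \<otimes>\<^bsub>G\<^esub> inv\<^bsub>G\<^esub> x \<otimes>\<^bsub>G\<^esub> inv\<^bsub>G\<^esub> y = \<one>\<^bsub>G\<^esub>" if "x \<in> carrier G" "y \<in> carrier G" for x y
  proof -
    have "(x \<otimes>\<^bsub>G\<^esub> y) \<otimes>\<^bsub>G\<^esub> inv\<^bsub>G\<^esub> x \<otimes>\<^bsub>G\<^esub> inv\<^bsub>G\<^esub> y = (x \<otimes>\<^bsub>G\<^esub> y) \<otimes>\<^bsub>G\<^esub> inv\<^bsub>G\<^esub> (x \<otimes>\<^bsub>G\<^esub> y)"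
      using that by (simp add: G.m_assoc G.inv_mult)
    then show ?thesis using that by simp
  qed
  have k3: "k (frag_of x - frag_of y - frag_of z) =
      case_prod f x \<otimes>\<^bsub>G\<^esub> inv\<^bsub>G\<^esub> case_prod f y \<otimes>\<^bsub>G\<^esub> inv\<^bsub>G\<^esub> case_prod f z"
    if "x \<in> carrier A \<times> carrier V" "y \<in> carrier A \<times> carrier V" "z \<in> carrier A \<times> carrier V" for x y z
  proof -
    have *: "frag_of x \<in> carrier F" "frag_of y \<in> carrier F" "frag_of z \<in> carrier F"
      using that by simp_all
    show ?thesis
      unfolding k_diff[OF F_diff[OF *(1,2)] *(3)] k_diff[OF *(1,2)] using that by (simp add: k_f)
  qed
  have rels: "tensor_rels A \<phi> R V \<subseteq> kernel F G k"
    unfolding tensor_rels_def kernel_def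
    by (intro Un_least subsetI; elim CollectE exE conjE; hypsubst; intro CollectI conjI F_diff)
       (simp_all add: k_diff k3 k_f assms V_add_closed V_smult_closed map_closed cancel)
  have "K \<subseteq> kernel F G k"
    unfolding tensor_ker_def by (rule F.generate_subgroup_incl[OF rels k.subgroup_kernel])
  then obtain h where h: "\<And>x. x \<in> carrier F \<Longrightarrow> h (r_coset F K x) = k x"
    using k.FactGroup_universal_kernel[OF normal_K] by metis
  show thesis
    by (rule that[of h]) (simp add: pt_eq h k_f)
qed

end

section \<open>Verma modules\<close>

locale verma_module =
  fixes a :: "perm3 \<Rightarrow> 'k :: field" and g :: perm3
  assumes g_in_S3: "g \<in> S3"
begin

abbreviation "M \<equiv> verma a g"
abbreviation "T p \<equiv> verma_tensor a g (alg_cls a p) 1"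

sublocale V: induced "alg a" "fun_emb a" fun_alg "eval_mod g"
  by (rule induced.intro) (auto simp: ring_alg fun_emb_def eval_mod_def intro: alg_cls_closed)

sublocale M: abelian_group M
  unfolding verma_def by (rule V.I.abelian_group_axioms)

lemma fun_alg_carrier: "restrict f S3 \<in> carrier fun_alg"
  by (simp add: fun_alg_def)

lemma fn_poly_restrict: "fn_poly (restrict f S3) = fn_poly f"
  by (simp add: fn_poly_def)

lemma fn_poly_const: "fn_poly (\<lambda>_. c) - Poly_Mapping.single [] c \<in> alg_ideal a"
proof -
  have "((\<Sum>g\<in>S3. dl g) - 1) \<in> alg_ideal a"
    by (rule alg_ideal_rel) (simp add: alg_rels_eq)
  then have "1 * ((\<Sum>g\<in>S3. dl g) - 1) * Poly_Mapping.single [] c \<in> alg_ideal a"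
    by (rule alg_ideal_mult) auto
  also have "1 * ((\<Sum>g\<in>S3. dl g) - 1) * Poly_Mapping.single [] c = fn_poly (\<lambda>_. c) - Poly_Mapping.single [] c"
    by (simp add: fn_poly_def algebra_simps sum_distrib_right mult_single plus_list_def)
  finally show ?thesis .
qed

lemma tensor_eq:
  assumes "p \<in> carrier free3"
  shows "verma_tensor a g (alg_cls a p) (f g) = T (p * fn_poly f)"
proof -
  have "verma_tensor a g (alg_cls a p \<otimes>\<^bsub>alg a\<^esub> fun_emb a (restrict f S3)) 1
      = verma_tensor a g (alg_cls a p) (restrict f S3 \<odot>\<^bsub>eval_mod g\<^esub> 1)"
    unfolding verma_tensor_def using assms
    by (intro V.pt_balanced fun_alg_carrier alg_cls_closed) (auto simp: eval_mod_def)
  then show ?thesis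
    using assms g_in_S3
    by (simp add: fun_emb_def fn_poly_restrict alg_cls_mult eval_mod_def)
qed

lemma T_cong_ideal:
  "p \<in> carrier free3 \<Longrightarrow> q \<in> carrier free3 \<Longrightarrow> p - q \<in> alg_ideal a \<Longrightarrow> T p = T q"
  using alg_cls_eqI by metis

text \<open>A scalar in the second factor is the action of a constant function; balancing moves this
  function to the left, where it is the scalar again because the \<delta>_g sum to 1. Every pure
  tensor thereby takes the form \<open>T p\<close>.\<close>

lemma tensor_scalar:
  assumes "p \<in> carrier free3"
  shows "verma_tensor a g (alg_cls a p) c = T (p * Poly_Mapping.single [] c)"
proof -
  have "p * (fn_poly (\<lambda>_. c) - Poly_Mapping.single [] c) * 1 \<in> alg_ideal a"
    using fn_poly_const assms by (rule alg_ideal_mult) auto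
  then have "T (p * fn_poly (\<lambda>_. c)) = T (p * Poly_Mapping.single [] c)"
    using assms by (intro T_cong_ideal) (auto simp: algebra_simps)
  with tensor_eq[OF assms, of "\<lambda>_. c"] show ?thesis by simp
qed

lemma T_fn_poly: "p \<in> carrier free3 \<Longrightarrow> T (p * fn_poly f) = T (p * Poly_Mapping.single [] (f g))"
  using tensor_eq tensor_scalar by metis

lemma T_closed [intro]: "p \<in> carrier free3 \<Longrightarrow> T p \<in> carrier M"
  unfolding verma_tensor_def verma_def by (rule V.pt_closed) (auto simp: eval_mod_def)

lemma T_add: "p \<in> carrier free3 \<Longrightarrow> q \<in> carrier free3 \<Longrightarrow> T (p + q) = T p \<oplus>\<^bsub>M\<^esub> T q"
  using V.pt_add_left[of "alg_cls a p" "alg_cls a q" 1]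
  by (auto simp: alg_cls_add verma_tensor_def verma_def eval_mod_def)

lemma T_zero: "T 0 = \<zero>\<^bsub>M\<^esub>"
  using T_add[of 0 0] T_closed[of 0] M.add.l_cancel_one' by auto

lemma T_diff:
  assumes "p \<in> carrier free3" "q \<in> carrier free3"
  shows "T (p - q) = T p \<ominus>\<^bsub>M\<^esub> T q"
proof -
  have "T p = T (p - q) \<oplus>\<^bsub>M\<^esub> T q" using T_add[of "p - q" q] assms by auto
  then show ?thesis
    using assms T_closed by (simp add: M.minus_eq M.a_assoc M.r_neg)
qed

lemma T_smult:
  "p \<in> carrier free3 \<Longrightarrow> q \<in> carrier free3 \<Longrightarrow> alg_cls a p \<odot>\<^bsub>M\<^esub> T q = T (p * q)"
  using V.smult_pt[of "alg_cls a p" "alg_cls a q" 1]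
  by (auto simp: alg_cls_mult verma_tensor_def verma_def eval_mod_def)

lemma T_surj:
  assumes "X \<in> carrier M"
  obtains p where "p \<in> carrier free3" "X = T p"
proof -
  have "X \<in> carrier V.I" using assms by (simp add: verma_def)
  then have "\<exists>p \<in> carrier free3. X = T p"
  proof (induction X rule: V.induced_induct)
    case (pure x c)
    then obtain p where p: "x = alg_cls a p" "p \<in> carrier free3" by (auto simp: carrier_alg)
    then show ?case
      using tensor_scalar[of p c] by (intro bexI[of _ "p * Poly_Mapping.single [] c"]) (auto simp: verma_tensor_def)
  next
    case (diff X Y)
    then show ?case using T_diff by (metis free_alg_closed(6) verma_def)
  qed (simp add: eval_mod_def)
  then show thesis using that by blast
qed

lemma T_mult_left:
  assumes "p \<in> carrier free3" "q \<in> carrier free3" "r \<in> carrier free3" "T p = T q"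
  shows "T (r * p) = T (r * q)"
  using assms by (metis T_smult)

text \<open>A vector \<open>v\<close> of weight \<open>g\<close> in any representation receives a
  map from \<open>M\<close> that sends x \<otimes> c to c (x v). It is balanced since a function
  acts on \<open>v\<close> by its value at \<open>g\<close>. For the model this says that the map
  from \<open>M\<close> is well defined.\<close>

lemma T_eq_imp_act_eq:
  fixes sc :: "'k \<Rightarrow> 'v \<Rightarrow> 'v :: ab_group_add"
  assumes "alg_rep sc \<rho> C a" and v: "v \<in> C"
    and Dl: "\<And>h. h \<in> S3 \<Longrightarrow> \<rho> (Dl h) v = (if h = g then v else 0)"
    and p: "p \<in> carrier free3" and q: "q \<in> carrier free3" and "T p = T q"
  shows "nc_act sc \<rho> p v = nc_act sc \<rho> q v"
proof -
  interpret alg_rep sc \<rho> C a by fact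
  let ?G = "\<lparr>carrier = UNIV, monoid.mult = (+), one = 0\<rparr> :: 'v monoid"
  have G: "comm_group ?G"
    by (rule comm_groupI) (auto simp: algebra_simps intro: exI[of _ "- x" for x])
  have fn: "act (fn_poly r) v = sc (r g) v" for r
    using g_in_S3 by (simp add: fn_poly_def act_sum Dl if_distrib[of "sc _"] cong: if_cong)
  obtain h where h: "\<And>x c. x \<in> carrier (alg a) \<Longrightarrow> c \<in> carrier (eval_mod g :: (_, 'k) module) \<Longrightarrow>
      h (V.pt x c) = sc c (x \<odot>\<^bsub>rep_mod C sc \<rho>\<^esub> v)"
  proof (rule V.induced_universal[OF G, of "\<lambda>x c. sc c (x \<odot>\<^bsub>rep_mod C sc \<rho>\<^esub> v)"])
    fix x y c assume "x \<in> carrier (alg a)" "y \<in> carrier (alg a)"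
    then show "sc c ((x \<oplus>\<^bsub>alg a\<^esub> y) \<odot>\<^bsub>rep_mod C sc \<rho>\<^esub> v)
       = sc c (x \<odot>\<^bsub>rep_mod C sc \<rho>\<^esub> v) \<otimes>\<^bsub>?G\<^esub> sc c (y \<odot>\<^bsub>rep_mod C sc \<rho>\<^esub> v)"
      by (auto simp: carrier_alg alg_cls_add rep_mod_smult v act_add scale_right_distrib)
  next
    fix x and r :: "perm3 \<Rightarrow> 'k" and c assume "x \<in> carrier (alg a)" "r \<in> carrier fun_alg"
    then show "sc c ((x \<otimes>\<^bsub>alg a\<^esub> fun_emb a r) \<odot>\<^bsub>rep_mod C sc \<rho>\<^esub> v)
        = sc (r \<odot>\<^bsub>eval_mod g\<^esub> c) (x \<odot>\<^bsub>rep_mod C sc \<rho>\<^esub> v)"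
      by (auto simp: carrier_alg fun_emb_def alg_cls_mult rep_mod_smult v act_mult fn
          act_scale_right eval_mod_def mult.commute)
  qed (auto simp: eval_mod_def scale_left_distrib)
  have "h (T p) = act p v" if "p \<in> carrier free3" for p
    using h[of "alg_cls a p" 1] that v
    by (auto simp: verma_tensor_def eval_mod_def rep_mod_smult)
  with p q \<open>T p = T q\<close> show ?thesis by metis
qed

end

section \<open>Rewriting words in a Verma module\<close>

abbreviation xw :: "perm3 list \<Rightarrow> (gen, 'k :: field) nc_poly" where
  "xw w \<equiv> Poly_Mapping.single (map Xg w) 1"

lemma xw_closed [simp, intro]: "set w \<subseteq> O23 \<Longrightarrow> xw w \<in> carrier free3"
  by (intro free_alg_closed) auto

lemma single_Nil_one [simp]: "Poly_Mapping.single [] 1 = (1 :: ('a, 'b::field) nc_poly)"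
  by (simp flip: single_one add: zero_list_def)

lemma xw_append: "xw (u @ w) = xw u * xw w"
  by (simp add: mult_single plus_list_def)

lemma xw_Cons: "xw (t # w) = xg t * xw w"
  by (simp add: mult_single plus_list_def)

lemma alg_ideal_add: "p \<in> alg_ideal a \<Longrightarrow> q \<in> alg_ideal a \<Longrightarrow> p + q \<in> alg_ideal a"
  using additive_subgroup.a_closed[OF ideal.axioms(1)[OF ideal_alg_ideal], of p a q] by simp

lemma alg_ideal_sum: "(\<And>i. i \<in> I \<Longrightarrow> p i \<in> alg_ideal a) \<Longrightarrow> sum p I \<in> alg_ideal a"
  using additive_subgroup.zero_closed[OF ideal.axioms(1)[OF ideal_alg_ideal], of a]
  by (induction I rule: infinite_finite_induct) (auto intro: alg_ideal_add)

text \<open>Reindexing one sum along \<open>h \<mapsto> t \<circ> h\<close> gives both sums the same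
  coefficients, and the difference becomes a combination of the commutation relations.\<close>

lemma fn_poly_xg:
  assumes "t \<in> O23"
  shows "fn_poly f * xg t - xg t * fn_poly (\<lambda>h. f (t \<circ> h)) \<in> alg_ideal a"
proof -
  have bij: "bij_betw (\<lambda>h. t \<circ> h) S3 S3"
    using assms O23_S3_closed O23_involution
    by (intro bij_betwI[where g = "\<lambda>h. t \<circ> h"]) (auto simp: o_assoc)
  have "fn_poly (\<lambda>h. f (t \<circ> h)) = (\<Sum>h\<in>S3. Poly_Mapping.single [Dl (t \<circ> h)] (f h))"
    unfolding fn_poly_def
    by (subst sum.reindex_bij_betw[OF bij, symmetric]) (simp add: o_assoc O23_involution assms)
  then have "fn_poly f * xg t - xg t * fn_poly (\<lambda>h. f (t \<circ> h))
      = (\<Sum>h\<in>S3. Poly_Mapping.single [] (f h) * (dl h * xg t - xg t * dl (t \<circ> h)) * 1)"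
    by (simp add: fn_poly_def sum_distrib_left sum_distrib_right right_diff_distrib sum_subtractf
        mult_single plus_list_def)
  also have "\<dots> \<in> alg_ideal a"
  proof (intro alg_ideal_sum alg_ideal_mult alg_ideal_rel)
    show "dl h * xg t - xg t * dl (t \<circ> h) \<in> alg_rels a" if "h \<in> S3" for h
      using that assms by (auto simp: alg_rels_eq)
  qed auto
  finally show ?thesis .
qed

text \<open>Functions can be pushed through a word to its right end, where they meet the generator
  of \<open>M\<close> and turn into scalars. Which function arrives there is irrelevant for that
  purpose.\<close>

lemma fn_poly_xw:
  "set w \<subseteq> O23 \<Longrightarrow> \<exists>f'. fn_poly f * xw w - xw w * fn_poly f' \<in> alg_ideal a"
proof (induction w arbitrary: f)
  case Nil
  show ?case
    using additive_subgroup.zero_closed[OF ideal.axioms(1)[OF ideal_alg_ideal], of a]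
    by (intro exI[of _ f]) simp
next
  case (Cons t w)
  then obtain f' where f': "fn_poly (\<lambda>h. f (t \<circ> h)) * xw w - xw w * fn_poly f' \<in> alg_ideal a"
    by auto
  have "1 * (fn_poly f * xg t - xg t * fn_poly (\<lambda>h. f (t \<circ> h))) * xw w
      + xg t * (fn_poly (\<lambda>h. f (t \<circ> h)) * xw w - xw w * fn_poly f') * 1 \<in> alg_ideal a"
    using Cons.prems f' by (intro alg_ideal_add alg_ideal_mult fn_poly_xg) auto
  also have "1 * (fn_poly f * xg t - xg t * fn_poly (\<lambda>h. f (t \<circ> h))) * xw w
      + xg t * (fn_poly (\<lambda>h. f (t \<circ> h)) * xw w - xw w * fn_poly f') * 1
    = fn_poly f * xw (t # w) - xw (t # w) * fn_poly f'"
    by (simp only: xw_Cons) (simp add: algebra_simps)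
  finally show ?case by blast
qed

text \<open>In each degree as many words as the Fomin--Kirillov algebra has dimensions: 1, 3, 4, 3, 1.\<close>

definition normal_words :: "perm3 list set" where
  "normal_words = {[], [s12], [s13], [s23], [s12, s13], [s12, s23], [s13, s12], [s23, s12],
     [s12, s13, s12], [s12, s23, s12], [s13, s12, s23], [s13, s12, s23, s12]}"

lemma normal_words_O23: "w \<in> normal_words \<Longrightarrow> set w \<subseteq> O23"
  by (auto simp: normal_words_def)

context verma_module
begin

text \<open>Reduction is modulo the kernel of \<open>T\<close> rather than modulo the ideal: applied
  to the generator, functions become scalars, so that words in the x_t alone can serve as normal
  forms.\<close>

definition reducible :: "(gen, 'k) nc_poly \<Rightarrow> bool" where
  "reducible p \<longleftrightarrow> p \<in> carrier free3 \<and>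
     (\<exists>q. Poly_Mapping.keys q \<subseteq> map Xg ` normal_words \<and> T p = T q)"

lemma normal_closed: "Poly_Mapping.keys q \<subseteq> map Xg ` normal_words \<Longrightarrow> q \<in> carrier free3"
  using normal_words_O23 by (fastforce simp: free_alg_def)

lemma redI: "p \<in> carrier free3 \<Longrightarrow> reducible q \<Longrightarrow> T p = T q \<Longrightarrow> reducible p"
  unfolding reducible_def by metis

lemma red_add: "reducible p \<Longrightarrow> reducible q \<Longrightarrow> reducible (p + q)"
proof -
  assume "reducible p" "reducible q"
  then obtain p' q' where *: "Poly_Mapping.keys p' \<subseteq> map Xg ` normal_words" "T p = T p'"
      "Poly_Mapping.keys q' \<subseteq> map Xg ` normal_words" "T q = T q'"
      "p \<in> carrier free3" "q \<in> carrier free3"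
    by (auto simp: reducible_def)
  then have "T (p + q) = T (p' + q')"
    using normal_closed[OF *(1)] normal_closed[OF *(3)] by (simp add: T_add)
  moreover have "Poly_Mapping.keys (p' + q') \<subseteq> map Xg ` normal_words"
    using * Poly_Mapping.keys_add[of p' q'] by blast
  ultimately show ?thesis using * unfolding reducible_def by blast
qed

lemma single_Nil_mult: "Poly_Mapping.single [] c * q = q * Poly_Mapping.single [] c"
  for q :: "(gen, 'k) nc_poly"
  by (induction q rule: nc_poly_induct) (simp_all add: mult_single plus_list_def algebra_simps)

lemma red_scale: "reducible p \<Longrightarrow> reducible (p * Poly_Mapping.single [] c)"
proof -
  assume "reducible p"
  then obtain q where q: "Poly_Mapping.keys q \<subseteq> map Xg ` normal_words" "T p = T q"
      "p \<in> carrier free3" by (auto simp: reducible_def)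
  have "T (Poly_Mapping.single [] c * p) = T (Poly_Mapping.single [] c * q)"
    using q normal_closed by (intro T_mult_left) auto
  moreover have "Poly_Mapping.keys (Poly_Mapping.single [] c * q) \<subseteq> map Xg ` normal_words"
    using q(1) keys_mult[of "Poly_Mapping.single [] c" q]
    by (fastforce simp: plus_list_def split: if_splits)
  ultimately show ?thesis
    using q(3) unfolding reducible_def by (auto simp: single_Nil_mult[symmetric])
qed

lemma red_zero: "reducible 0"
  unfolding reducible_def by (auto intro!: exI[of _ 0])

lemma red_uminus: "reducible p \<Longrightarrow> reducible (- p)"
proof -
  assume "reducible p"
  then have "reducible (p * Poly_Mapping.single [] (- 1))" by (rule red_scale)
  also have "p * Poly_Mapping.single [] (- 1) = - p"
    by (simp add: single_uminus)
  finally show ?thesis .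
qed

lemma red_sum: "(\<And>i. i \<in> I \<Longrightarrow> reducible (p i)) \<Longrightarrow> reducible (sum p I)"
  by (induction I rule: infinite_finite_induct) (auto intro: red_add red_zero)

lemma red_cong_ideal:
  assumes "p \<in> carrier free3" "reducible q" "p - q \<in> alg_ideal a"
  shows "reducible p"
  by (rule redI[OF assms(1,2) T_cong_ideal]) (use assms in \<open>auto simp: reducible_def\<close>)

text \<open>After the function has been moved to the right end it contributes only the scalar
  \<open>f' g\<close>.\<close>

lemma red_fn_poly_xw:
  assumes "reducible (xw u * xw w)" "set u \<subseteq> O23" "set w \<subseteq> O23"
  shows "reducible (xw u * fn_poly f * xw w)"
proof -
  obtain f' where "fn_poly f * xw w - xw w * fn_poly f' \<in> alg_ideal a"
    using fn_poly_xw assms(3) by blast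
  then have "xw u * (fn_poly f * xw w - xw w * fn_poly f') * 1 \<in> alg_ideal a"
    using assms by (intro alg_ideal_mult) auto
  then have "xw u * fn_poly f * xw w - (xw u * xw w) * fn_poly f' \<in> alg_ideal a"
    by (simp add: algebra_simps)
  moreover have "reducible ((xw u * xw w) * fn_poly f')"
  proof (rule redI)
    show "xw u * xw w * fn_poly f' \<in> carrier free3" using assms by auto
    show "T (xw u * xw w * fn_poly f') = T (xw u * xw w * Poly_Mapping.single [] (f' g))"
      using assms by (intro T_fn_poly) auto
  qed (rule red_scale[OF assms(1)])
  moreover have "xw u * fn_poly f * xw w \<in> carrier free3" using assms by auto
  ultimately show ?thesis by (metis red_cong_ideal)
qed

definition reducible_word :: "perm3 list \<Rightarrow> bool" where
  "reducible_word w \<longleftrightarrow> set w \<subseteq> O23 \<and> reducible (xw w)"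

lemma red_sq:
  assumes "reducible_word (u @ w)" "t \<in> O23"
  shows "reducible_word (u @ t # t # w)"
proof -
  note assms = assms[unfolded reducible_word_def]
  have "reducible (xw u * xw w)"
    using assms(1) unfolding xw_append by blast
  then have "reducible (xw u * fn_poly (ff a t) * xw w)"
    using assms by (intro red_fn_poly_xw) auto
  moreover have "xw u * (xg t * xg t - fn_poly (ff a t)) * xw w \<in> alg_ideal a"
    using assms by (intro alg_ideal_mult alg_ideal_rel) (auto simp: alg_rels_eq)
  then have "xw u * (xg t * xg t) * xw w - xw u * fn_poly (ff a t) * xw w \<in> alg_ideal a"
    by (simp only: algebra_simps)
  moreover have "xw u * (xg t * xg t) * xw w \<in> carrier free3" using assms by auto
  ultimately have "reducible (xw u * (xg t * xg t) * xw w)" by (metis red_cong_ideal)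
  then show ?thesis
    using assms by (simp add: reducible_word_def mult_single plus_list_def)
qed

lemma red_cubic:
  assumes "xw p + xw q + xw r \<in> alg_ideal a" "reducible_word (u @ q @ w)" "reducible_word (u @ r @ w)" "set p \<subseteq> O23"
  shows "reducible_word (u @ p @ w)"
proof -
  note assms = assms[unfolded reducible_word_def]
  have "xw u * (xw p + xw q + xw r) * xw w \<in> alg_ideal a"
    using assms by (intro alg_ideal_mult) auto
  moreover have "reducible (- (xw (u @ q @ w) + xw (u @ r @ w)))"
    using assms by (intro red_uminus red_add) auto
  moreover have "xw (u @ p @ w) - - (xw (u @ q @ w) + xw (u @ r @ w))
      = xw u * (xw p + xw q + xw r) * xw w"
    unfolding xw_append by (simp only: algebra_simps diff_minus_eq_add)
  moreover have "xw (u @ p @ w) \<in> carrier free3"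
    using assms by (intro xw_closed) auto
  ultimately have "reducible (xw (u @ p @ w))"
    by (metis red_cong_ideal)
  then show ?thesis using assms by (simp add: reducible_word_def)
qed

lemma cubic1: "xw [s13, s23] + xw [s23, s12] + xw [s12, s13] \<in> alg_ideal a"
  and cubic2: "xw [s23, s13] + xw [s13, s12] + xw [s12, s23] \<in> alg_ideal a"
  by (rule alg_ideal_rel, simp add: alg_rels_eq mult_single plus_list_def)+

text \<open>Rotations of the two cubic relations. The last letter of the name tells which of the
  three words, in the order of \<open>cubic1\<close> or \<open>cubic2\<close>, is solved
  for.\<close>

lemmas red_c1a = red_cubic[OF cubic1]
lemmas red_c1b = red_cubic[OF cubic1[unfolded add.assoc, unfolded add.commute[of "xw [s13, s23]"]]]
lemmas red_c1c = red_cubic[OF cubic1[unfolded add.commute[of _ "xw [s12, s13]"], folded add.assoc]]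
lemmas red_c2a = red_cubic[OF cubic2]
lemmas red_c2b = red_cubic[OF cubic2[unfolded add.assoc, unfolded add.commute[of "xw [s23, s13]"]]]

lemma red_normal: "w \<in> normal_words \<Longrightarrow> reducible_word w"
  unfolding reducible_word_def reducible_def using normal_words_O23[of w] by (auto intro!: exI[of _ "xw w"])

text \<open>A square inside a word can be cancelled up to a scalar, and the words of a cubic relation are
  reducible as soon as two of them are; the derivation below was found by exhaustive search with
  these two rules. In the names of the facts \<open>x\<close>, \<open>y\<close>, \<open>z\<close> stand for \<open>s12\<close>, \<open>s13\<close>, \<open>s23\<close>.\<close>

lemma red_xg_normal:
  assumes "t \<in> O23" "w \<in> normal_words"
  shows "reducible_word (t # w)"
proof -
  note n = red_normal[unfolded normal_words_def]
  have r_nil: "reducible_word []" and r_x: "reducible_word [s12]" and r_y: "reducible_word [s13]" and r_z: "reducible_word [s23]"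
    and r_xy: "reducible_word [s12, s13]" and r_xz: "reducible_word [s12, s23]" and r_yx: "reducible_word [s13, s12]" and r_zx: "reducible_word [s23, s12]"
    and r_xyx: "reducible_word [s12, s13, s12]" and r_xzx: "reducible_word [s12, s23, s12]" and r_yxz: "reducible_word [s13, s12, s23]"
    and r_yxzx: "reducible_word [s13, s12, s23, s12]"
    by (rule n; simp)+
  have r_xx: "reducible_word [s12, s12]" using red_sq[of "[]" "[]" s12] r_nil by simp
  have r_yy: "reducible_word [s13, s13]" using red_sq[of "[]" "[]" s13] r_nil by simp
  have r_yz: "reducible_word [s13, s23]" using red_c1a[of "[]" "[]"] r_zx r_xy by simp
  have r_zy: "reducible_word [s23, s13]" using red_c2a[of "[]" "[]"] r_yx r_xz by simp
  have r_zz: "reducible_word [s23, s23]" using red_sq[of "[]" "[]" s23] r_nil by simp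
  have r_xxy: "reducible_word [s12, s12, s13]" using red_sq[of "[]" "[s13]" s12] r_y by simp
  have r_xxz: "reducible_word [s12, s12, s23]" using red_sq[of "[]" "[s23]" s12] r_z by simp
  have r_xyy: "reducible_word [s12, s13, s13]" using red_sq[of "[s12]" "[]" s13] r_x by simp
  have r_yxx: "reducible_word [s13, s12, s12]" using red_sq[of "[s13]" "[]" s12] r_y by simp
  have r_yyx: "reducible_word [s13, s13, s12]" using red_sq[of "[]" "[s12]" s13] r_x by simp
  have r_yzz: "reducible_word [s13, s23, s23]" using red_sq[of "[s13]" "[]" s23] r_y by simp
  have r_zxx: "reducible_word [s23, s12, s12]" using red_sq[of "[s23]" "[]" s12] r_z by simp
  have r_zyy: "reducible_word [s23, s13, s13]" using red_sq[of "[s23]" "[]" s13] r_z by simp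
  have r_zzx: "reducible_word [s23, s23, s12]" using red_sq[of "[]" "[s12]" s23] r_x by simp
  have r_xxyx: "reducible_word [s12, s12, s13, s12]" using red_sq[of "[]" "[s13, s12]" s12] r_yx by simp
  have r_xxzx: "reducible_word [s12, s12, s23, s12]" using red_sq[of "[]" "[s23, s12]" s12] r_zx by simp
  have r_xyxx: "reducible_word [s12, s13, s12, s12]" using red_sq[of "[s12, s13]" "[]" s12] r_xy by simp
  have r_xzxx: "reducible_word [s12, s23, s12, s12]" using red_sq[of "[s12, s23]" "[]" s12] r_xz by simp
  have r_yyxz: "reducible_word [s13, s13, s12, s23]" using red_sq[of "[]" "[s12, s23]" s13] r_xz by simp
  have r_yzzx: "reducible_word [s13, s23, s23, s12]" using red_sq[of "[s13]" "[s12]" s23] r_yx by simp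
  have r_zxzz: "reducible_word [s23, s12, s23, s23]" using red_sq[of "[s23, s12]" "[]" s23] r_zx by simp
  have r_zyyx: "reducible_word [s23, s13, s13, s12]" using red_sq[of "[s23]" "[s12]" s13] r_zx by simp
  have r_yxzxx: "reducible_word [s13, s12, s23, s12, s12]" using red_sq[of "[s13, s12, s23]" "[]" s12] r_yxz by simp
  have r_yyxzx: "reducible_word [s13, s13, s12, s23, s12]" using red_sq[of "[]" "[s12, s23, s12]" s13] r_xzx by simp
  have r_xyz: "reducible_word [s12, s13, s23]" using red_c1a[of "[s12]" "[]"] r_xzx r_xxy by simp
  have r_xzy: "reducible_word [s12, s23, s13]" using red_c2a[of "[s12]" "[]"] r_xyx r_xxz by simp
  have r_yzx: "reducible_word [s13, s23, s12]" using red_c1a[of "[]" "[s12]"] r_zxx r_xyx by simp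
  have r_yzy: "reducible_word [s13, s23, s13]" using red_c2a[of "[s13]" "[]"] r_yyx r_yxz by simp
  have r_zyx: "reducible_word [s23, s13, s12]" using red_c2a[of "[]" "[s12]"] r_yxx r_xzx by simp
  have r_xyyx: "reducible_word [s12, s13, s13, s12]" using red_sq[of "[s12]" "[s12]" s13] r_xx by simp
  have r_xyzx: "reducible_word [s12, s13, s23, s12]" using red_c1a[of "[s12]" "[s12]"] r_xzxx r_xxyx by simp
  have r_xzyx: "reducible_word [s12, s23, s13, s12]" using red_c2a[of "[s12]" "[s12]"] r_xyxx r_xxzx by simp
  have r_yxxy: "reducible_word [s13, s12, s12, s13]" using red_sq[of "[s13]" "[s13]" s12] r_yy by simp
  have r_yyxx: "reducible_word [s13, s13, s12, s12]" using red_sq[of "[]" "[s12, s12]" s13] r_xx by simp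
  have r_yyzz: "reducible_word [s13, s13, s23, s23]" using red_sq[of "[]" "[s23, s23]" s13] r_zz by simp
  have r_zxxz: "reducible_word [s23, s12, s12, s23]" using red_sq[of "[s23]" "[s23]" s12] r_zz by simp
  have r_zzyz: "reducible_word [s23, s23, s13, s23]" using red_sq[of "[]" "[s13, s23]" s23] r_yz by simp
  have r_yxxyx: "reducible_word [s13, s12, s12, s13, s12]" using red_sq[of "[s13]" "[s13, s12]" s12] r_yyx by simp
  have r_yyzzx: "reducible_word [s13, s13, s23, s23, s12]" using red_sq[of "[]" "[s23, s23, s12]" s13] r_zzx by simp
  have r_zxxzx: "reducible_word [s23, s12, s12, s23, s12]" using red_sq[of "[s23]" "[s23, s12]" s12] r_zzx by simp
  have r_zxzzx: "reducible_word [s23, s12, s23, s23, s12]" using red_sq[of "[s23, s12]" "[s12]" s23] r_zxx by simp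
  have r_yxy: "reducible_word [s13, s12, s13]" using red_c2b[of "[]" "[s13]"] r_xzy r_zyy by simp
  have r_zxy: "reducible_word [s23, s12, s13]" using red_c1b[of "[]" "[s13]"] r_xyy r_yzy by simp
  have r_zxz: "reducible_word [s23, s12, s23]" using red_c1b[of "[]" "[s23]"] r_xyz r_yzz by simp
  have r_yxyx: "reducible_word [s13, s12, s13, s12]" using red_c2b[of "[]" "[s13, s12]"] r_xzyx r_zyyx by simp
  have r_yxyz: "reducible_word [s13, s12, s13, s23]" using red_c1a[of "[s13, s12]" "[]"] r_yxzx r_yxxy by simp
  have r_yzyx: "reducible_word [s13, s23, s13, s12]" using red_c2a[of "[s13]" "[s12]"] r_yyxx r_yxzx by simp
  have r_zxzx: "reducible_word [s23, s12, s23, s12]" using red_c1b[of "[]" "[s23, s12]"] r_xyzx r_yzzx by simp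
  have r_zyxz: "reducible_word [s23, s13, s12, s23]" using red_c2b[of "[s23]" "[s23]"] r_zxzz r_zzyz by simp
  have r_yxyzx: "reducible_word [s13, s12, s13, s23, s12]" using red_c1a[of "[s13, s12]" "[s12]"] r_yxzxx r_yxxyx by simp
  have r_zzyzx: "reducible_word [s23, s23, s13, s23, s12]" using red_sq[of "[]" "[s13, s23, s12]" s23] r_yzx by simp
  have r_yzxz: "reducible_word [s13, s23, s12, s23]" using red_c1b[of "[s13]" "[s23]"] r_yxyz r_yyzz by simp
  have r_zxyx: "reducible_word [s23, s12, s13, s12]" using red_c1b[of "[]" "[s13, s12]"] r_xyyx r_yzyx by simp
  have r_yzxzx: "reducible_word [s13, s23, s12, s23, s12]" using red_c1b[of "[s13]" "[s23, s12]"] r_yxyzx r_yyzzx by simp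
  have r_zyxzx: "reducible_word [s23, s13, s12, s23, s12]" using red_c2b[of "[s23]" "[s23, s12]"] r_zxzzx r_zzyzx by simp
  have r_xyxz: "reducible_word [s12, s13, s12, s23]" using red_c1c[of "[]" "[s12, s23]"] r_yzxz r_zxxz by simp
  have r_xyxzx: "reducible_word [s12, s13, s12, s23, s12]" using red_c1c[of "[]" "[s12, s23, s12]"] r_yzxzx r_zxxzx by simp
  have "\<forall>t\<in>O23. \<forall>w\<in>normal_words. reducible_word (t # w)"
    unfolding O23_eq normal_words_def ball_simps by (intro conjI TrueI; fact)
  with assms show ?thesis by blast
qed

text \<open>By linearity only normal words have to be multiplied. A generator \<open>Dl h\<close> is
  the indicator function of \<open>h\<close> and passes to the right as a scalar; for
  \<open>Xg t\<close> the product was treated above.\<close>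

lemma red_gen_mult:
  assumes "s \<in> gens3" "reducible p"
  shows "reducible (Poly_Mapping.single [s] 1 * p)"
proof -
  obtain q where q: "Poly_Mapping.keys q \<subseteq> map Xg ` normal_words" "T p = T q"
      "p \<in> carrier free3" using assms(2) by (auto simp: reducible_def)
  have word: "reducible (Poly_Mapping.single [s] 1 * xw w)" if "w \<in> normal_words" for w
  proof (cases s)
    case (Dl h)
    then have "h \<in> S3" using assms(1) by auto
    have "fn_poly (\<lambda>x. if x = h then 1 else 0)
        = (\<Sum>x\<in>S3. if x = h then dl h else 0 :: (gen, 'k) nc_poly)"
      unfolding fn_poly_def by (intro sum.cong) auto
    also have "\<dots> = dl h" using \<open>h \<in> S3\<close> by simp
    finally show ?thesis
      using red_fn_poly_xw[of "[]" w "\<lambda>x. if x = h then 1 else 0"] red_normal[OF that] Dl by (simp add: reducible_word_def)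
  next
    case (Xg t)
    then show ?thesis
      using red_xg_normal[of t w] assms(1) that by (auto simp: reducible_word_def mult_single plus_list_def)
  qed
  have "Poly_Mapping.single [s] 1 * q
      = (\<Sum>w\<in>Poly_Mapping.keys q. Poly_Mapping.single [s] 1 * Poly_Mapping.single w 1
          * Poly_Mapping.single [] (Poly_Mapping.lookup q w))"
    by (subst (1) nc_poly_sum_words[of q])
       (simp add: sum_distrib_left mult_single plus_list_def)
  also have "reducible \<dots>"
    using q(1) by (intro red_sum red_scale) (auto intro: word)
  finally have "reducible (Poly_Mapping.single [s] 1 * q)" .
  moreover have "T (Poly_Mapping.single [s] 1 * p) = T (Poly_Mapping.single [s] 1 * q)"
    using q assms(1) normal_closed by (intro T_mult_left) auto
  moreover have "Poly_Mapping.single [s] 1 * p \<in> carrier free3"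
    using q(3) assms(1) by auto
  ultimately show ?thesis by (metis redI)
qed

text \<open>Reducible polynomials contain 1 and are stable under generators and linear combinations.
  This is the upper bound: twelve vectors span \<open>M\<close>.\<close>

lemma red_all:
  assumes "p \<in> carrier free3"
  shows "reducible p"
proof -
  have "reducible (Poly_Mapping.single w 1)" if "set w \<subseteq> gens3" for w
    using that
  proof (induction w)
    case Nil
    show ?case using red_normal[of "[]"] by (simp add: reducible_word_def normal_words_def)
  next
    case (Cons s w)
    then show ?case
      using red_gen_mult[of s "Poly_Mapping.single w 1"] by (simp add: mult_single plus_list_def)
  qed
  then have "reducible (Poly_Mapping.single w 1 * Poly_Mapping.single [] c)" if "set w \<subseteq> gens3" for w c
    using that by (intro red_scale)
  then have "reducible (Poly_Mapping.single w c)" if "set w \<subseteq> gens3" for w c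
    using that by (simp add: mult_single plus_list_def)
  then have "reducible (\<Sum>w\<in>Poly_Mapping.keys p. Poly_Mapping.single w (Poly_Mapping.lookup p w))"
    using assms by (intro red_sum) (auto simp: free_alg_def)
  then show ?thesis by (simp flip: nc_poly_sum_words)
qed

end

section \<open>Submodules of the model\<close>

interpretation W: alg_rep wscale "wgen a" wcarrier a for a :: "perm3 \<Rightarrow> 'k::field"
  by (rule alg_rep_wgen)

definition wsingle :: "perm3 \<Rightarrow> 'k \<times> 'k \<Rightarrow> 'k::field wvec" where
  "wsingle g w = (\<lambda>h. if h = g then w else 0)"

definition wsub :: "(perm3 \<Rightarrow> 'k::field) \<Rightarrow> 'k wvec set \<Rightarrow> bool" where
  "wsub a H \<longleftrightarrow> H \<subseteq> wcarrier \<and> 0 \<in> H \<and> (\<forall>u\<in>H. \<forall>v\<in>H. u + v \<in> H) \<and>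
     (\<forall>c. \<forall>v\<in>H. wscale c v \<in> H) \<and> (\<forall>s\<in>gens3. \<forall>v\<in>H. wgen a s v \<in> H)"

definition wsoc :: "'k::field wvec set" where
  "wsoc = {v \<in> wcarrier. v id = 0 \<and> (\<forall>g. snd (v g) = 0)}"

definition wN :: "'k::field wvec set" where
  "wN = {v \<in> wcarrier. \<forall>g. g \<noteq> id \<longrightarrow> snd (v g) = 0}"

text \<open>For \<open>w = 0\<close> this is \<open>wsoc\<close>; for \<open>w \<noteq> 0\<close> it
  turns out to be the submodule generated by the vector \<open>w\<close> of weight e.\<close>

definition wcyc :: "'k \<times> 'k \<Rightarrow> 'k::field wvec set" where
  "wcyc w = {v \<in> wN. \<exists>c. v id = (c * fst w, c * snd w)}"

lemma wsingle_apply [simp]: "wsingle g w g = w" "h \<noteq> g \<Longrightarrow> wsingle g w h = 0"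
  by (simp_all add: wsingle_def)

lemma wsingle_closed [simp, intro]: "g \<in> S3 \<Longrightarrow> wsingle g w \<in> wcarrier"
  by (auto simp: wsingle_def wcarrier_def)

lemma wsingle_add: "wsingle g w + wsingle g w' = wsingle g (w + w')"
  by (auto simp: wsingle_def)

lemma wsingle_scale: "wscale c (wsingle g w) = wsingle g (c * fst w, c * snd w)"
  by (auto simp: wsingle_def wscale_def zero_prod_def)

lemma wsingle_zero [simp]: "wsingle g 0 = 0"
  by (auto simp: wsingle_def)

lemma wgen_Dl_eq: "wgen a (Dl g) v = wsingle g (v g)"
  by (auto simp: wsingle_def wgen_Dl)

lemma wgen_Xg_wsingle:
  assumes "t \<in> O23" "g \<in> S3"
  shows "wgen a (Xg t) (wsingle g w) = wsingle (t \<circ> g) (wstep a t (t \<circ> g) w)"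
proof -
  have "t \<circ> h = g \<longleftrightarrow> h = t \<circ> g" for h
    using O23_involution[OF assms(1)] by (metis id_comp comp_assoc)
  then have "wgen a (Xg t) (wsingle g w) h = wsingle (t \<circ> g) (wstep a t (t \<circ> g) w) h" for h
    using O23_S3_closed[OF assms] by (cases "h = t \<circ> g") (simp_all add: wsingle_def wgen_Xg)
  then show ?thesis by blast
qed

lemma wvec_eq_sum: "v \<in> wcarrier \<Longrightarrow> v = (\<Sum>g\<in>S3. wsingle g (v g))"
  using W.sum_Dl[of v] by (simp add: wgen_Dl_eq)

lemma wstep_simps [simp]:
  "wstep a s12 id w = (0, - (a s13 - a s23) * snd w)"
  "wstep a s13 id w = ((a s13 - a s23) * snd w, 0)"
  "wstep a s23 id w = (- (a s13 - a s23) * snd w, (a s13 - a s23) * snd w)"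
  "wstep a s12 s12 w = (fst w, 0)" "wstep a s13 s13 w = (snd w, 0)"
  "wstep a s23 s23 w = (- fst w - snd w, 0)"
  "wstep a s12 s13 w = ((a s12 - a s23) * fst w, snd w)"
  "wstep a s12 s23 w = ((a s12 - a s13) * fst w - snd w, snd w)"
  "wstep a s12 rot w = (fst w, (a s12 - a s23) * snd w)"
  "wstep a s12 tor w = (fst w + snd w, (a s12 - a s13) * snd w)"
  "wstep a s13 s12 w = ((a s13 - a s23) * fst w, snd w)"
  "wstep a s13 s23 w = ((a s13 - a s12) * fst w, snd w)"
  "wstep a s13 rot w = (fst w, (a s13 - a s12) * snd w)"
  "wstep a s13 tor w = (fst w, (a s13 - a s23) * snd w)"
  "wstep a s23 s12 w = ((a s23 - a s13) * fst w, snd w)"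
  "wstep a s23 s13 w = ((a s23 - a s12) * fst w + snd w, snd w)"
  "wstep a s23 rot w = (fst w, (a s23 - a s13) * snd w)"
  "wstep a s23 tor w = (fst w - snd w, (a s23 - a s12) * snd w)"
  by (simp_all add: wstep_def eps_def)

lemma wsubI:
  assumes "H \<subseteq> wcarrier" "0 \<in> H" "\<And>u v. u \<in> H \<Longrightarrow> v \<in> H \<Longrightarrow> u + v \<in> H"
    "\<And>c v. v \<in> H \<Longrightarrow> wscale c v \<in> H" "\<And>s v. s \<in> gens3 \<Longrightarrow> v \<in> H \<Longrightarrow> wgen a s v \<in> H"
  shows "wsub a H"
  unfolding wsub_def using assms by blast

lemma wsub_wcarrier: "wsub a wcarrier"
  by (rule wsubI) (fact subset_refl W.C_zero W.C_add W.C_scale W.C_gen)+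

lemma wgen_apply_cases:
  assumes "s \<in> gens3"
  obtains (Dl) h where "h \<in> S3" "\<And>v. wgen a s v = wsingle h (v h)"
  | (Xg) t where "t \<in> O23" "\<And>v g. wgen a s v g = (if g \<in> S3 then wstep a t g (v (t \<circ> g)) else 0)"
  using assms by (auto simp: wgen_Dl_eq wgen_Xg)

text \<open>Weight e is reached by \<open>x_t\<close> only from the top coordinate of weight t,
  which vanishes on \<open>wN\<close>. On the component at \<open>id\<close> every generator
  therefore acts by 0 or 1, so each line in it, together with the bottom copy, is stable.\<close>

lemma wN_gen:
  assumes "v \<in> wN" "s \<in> gens3"
  shows "wgen a s v \<in> wN" and "wgen a s v id = v id \<or> wgen a s v id = 0"
proof -
  have *: "snd (v g) = 0" if "g \<noteq> id" for g using assms(1) that by (auto simp: wN_def)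
  have 1: "snd (wstep a t g (v (t \<circ> g))) = 0" if "g \<in> S3" "g \<noteq> id" "t \<in> O23" for t g
    using that * unfolding S3_eq O23_eq by (elim insertE emptyE) simp_all
  have 2: "wstep a t id (v (t \<circ> id)) = 0" if "t \<in> O23" for t
    using that * unfolding O23_eq by (elim insertE emptyE) (simp_all add: zero_prod_def)
  have 3: "wgen a s v \<in> wcarrier"
    using assms W.C_gen by (auto simp: wN_def)
  show "wgen a s v \<in> wN"
    by (rule wgen_apply_cases[OF assms(2), of a]) (use 1 3 * in \<open>simp_all add: wN_def wsingle_def\<close>)
  show "wgen a s v id = v id \<or> wgen a s v id = 0"
    by (rule wgen_apply_cases[OF assms(2), of a]) (use 2 in \<open>simp_all add: wsingle_def\<close>)
qed

lemma wsub_wN: "wsub a wN"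
proof (rule wsubI)
  show "wgen a s v \<in> wN" if "s \<in> gens3" "v \<in> wN" for s v
    using wN_gen(1) that by blast
  show "wscale c v \<in> wN" if "v \<in> wN" for c and v :: "'a wvec"
  proof -
    have "wscale c v \<in> wcarrier" using that by (intro W.C_scale) (simp add: wN_def)
    then show ?thesis using that by (simp add: wN_def) (simp add: wscale_def)
  qed
qed (auto simp: wN_def W.C_zero W.C_add)

lemma wsub_wcyc: "wsub a (wcyc w)"
proof (rule wsubI)
  note N = wsub_wN[of a, unfolded wsub_def]
  show "wcyc w \<subseteq> wcarrier" by (auto simp: wcyc_def wN_def)
  show "0 \<in> wcyc w"
    using N by (auto simp: wcyc_def zero_prod_def intro!: exI[of _ 0])
  show "u + v \<in> wcyc w" if uv: "u \<in> wcyc w" "v \<in> wcyc w" for u v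
  proof -
    obtain c d where "u id = (c * fst w, c * snd w)" "v id = (d * fst w, d * snd w)"
      using uv by (auto simp: wcyc_def)
    then have "(u + v) id = ((c + d) * fst w, (c + d) * snd w)"
      by (simp add: algebra_simps)
    then show ?thesis using uv N unfolding wcyc_def by blast
  qed
  show "wscale c v \<in> wcyc w" if v: "v \<in> wcyc w" for c v
  proof -
    obtain d where "v id = (d * fst w, d * snd w)"
      using v by (auto simp: wcyc_def)
    then have "wscale c v id = ((c * d) * fst w, (c * d) * snd w)"
      by (simp add: wscale_def)
    then show ?thesis using v N unfolding wcyc_def by blast
  qed
  show "wgen a s v \<in> wcyc w" if s: "s \<in> gens3" and v: "v \<in> wcyc w" for s v
  proof -
    have "v \<in> wN" using v by (simp add: wcyc_def)
    have "\<exists>c. wgen a s v id = (c * fst w, c * snd w)"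
      using wN_gen(2)[OF \<open>v \<in> wN\<close> s, of a]
    proof
      assume "wgen a s v id = 0"
      then show ?thesis by (intro exI[of _ 0]) (simp add: zero_prod_def)
    qed (use v in \<open>auto simp: wcyc_def\<close>)
    then show ?thesis using wN_gen(1)[OF \<open>v \<in> wN\<close> s] by (simp add: wcyc_def)
  qed
qed

lemma wsoc_eq: "wsoc = wcyc 0"
  by (auto simp: wsoc_def wcyc_def wN_def zero_prod_def) (metis snd_conv)

lemma wsingle_wsoc: "h \<in> S3 \<Longrightarrow> h \<noteq> id \<Longrightarrow> snd w = 0 \<Longrightarrow> wsingle h w \<in> wsoc"
  by (simp add: wsoc_def) (simp add: wsingle_def)

lemma wsub_wsoc: "wsub a wsoc"
  unfolding wsoc_eq by (rule wsub_wcyc)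

section \<open>Submodules of the model that contain a given weight vector\<close>

locale wsubmodule =
  fixes a :: "perm3 \<Rightarrow> 'k::field" and H
  assumes sub: "wsub a H" and generic: "generic a"
begin

lemma generic' [simp]: "a s12 \<noteq> a s13" "a s12 \<noteq> a s23" "a s13 \<noteq> a s23"
    "a s13 \<noteq> a s12" "a s23 \<noteq> a s12" "a s23 \<noteq> a s13"
  using generic by (auto simp: generic_def s12_def s13_def s23_def)

lemma H_add: "u \<in> H \<Longrightarrow> v \<in> H \<Longrightarrow> u + v \<in> H"
  and H_scale: "v \<in> H \<Longrightarrow> wscale c v \<in> H"
  and H_zero [simp]: "0 \<in> H"
  and H_carrier: "v \<in> H \<Longrightarrow> v \<in> wcarrier"
  and H_gen: "s \<in> gens3 \<Longrightarrow> v \<in> H \<Longrightarrow> wgen a s v \<in> H"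
  using sub by (auto simp: wsub_def)

lemma H_component: "v \<in> H \<Longrightarrow> g \<in> S3 \<Longrightarrow> wsingle g (v g) \<in> H"
  using H_gen[of "Dl g" v] by (simp add: wgen_Dl_eq)

lemma H_components:
  assumes "v \<in> wcarrier" "\<And>g. g \<in> S3 \<Longrightarrow> wsingle g (v g) \<in> H"
  shows "v \<in> H"
proof -
  have "(\<Sum>g\<in>B. wsingle g (v g)) \<in> H" if "B \<subseteq> S3" for B
    using that assms(2) by (induction B rule: infinite_finite_induct) (auto intro: H_add)
  from this[OF subset_refl] show ?thesis using wvec_eq_sum[OF assms(1)] by metis
qed

lemma H_step: "wsingle g w \<in> H \<Longrightarrow> t \<in> O23 \<Longrightarrow> g \<in> S3 \<Longrightarrow>
    wsingle (t \<circ> g) (wstep a t (t \<circ> g) w) \<in> H"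
  using H_gen[of "Xg t" "wsingle g w"] by (simp add: wgen_Xg_wsingle)

lemma H_single_scale: "wsingle g (x, y) \<in> H \<Longrightarrow> wsingle g (c * x, c * y) \<in> H"
  using H_scale[of "wsingle g (x, y)" c] by (simp add: wsingle_scale)

lemma H_single_add: "wsingle g (x, y) \<in> H \<Longrightarrow> wsingle g (x', y') \<in> H \<Longrightarrow> wsingle g (x + x', y + y') \<in> H"
  using H_add[of "wsingle g (x, y)" "wsingle g (x', y')"] by (simp add: wsingle_add)

lemma H_fst_line:
  assumes "wsingle g (b, 0) \<in> H" "b \<noteq> 0"
  shows "wsingle g (c, 0) \<in> H"
  using H_single_scale[OF assms(1), of "c / b"] assms(2) by simp

lemma H_snd_line:
  assumes "wsingle g (0, b) \<in> H" "b \<noteq> 0"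
  shows "wsingle g (0, c) \<in> H"
  using H_single_scale[OF assms(1), of "c / b"] assms(2) by simp

lemma wsoc_subset:
  assumes "wsingle g (b, 0) \<in> H" "b \<noteq> 0" "g \<in> S3" "g \<noteq> id"
  shows "wsoc \<subseteq> H"
proof -
  \<comment> \<open>Every weight other than e leads to \<open>rot\<close>: the odd ones in one step,
    \<open>tor\<close> through \<open>s12\<close>. From \<open>rot\<close> the odd weights are
    reached, and \<open>tor\<close> again through \<open>s12\<close>. The coefficients met are 1 or
    differences of distinct a_t.\<close>
  define P where "P g \<longleftrightarrow> (\<forall>c. wsingle g (c, 0) \<in> H)" for g
  have step: "P h" if "P g" "t \<in> O23" "g \<in> S3" "h = t \<circ> g" "wstep a t h (1, 0) = (c, 0)" "c \<noteq> 0" for g h t c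
    using H_step[of g "(1, 0)" t] that H_fst_line unfolding P_def by auto
  have start: "P g"
    unfolding P_def using H_fst_line assms by blast
  have P_rot: "P rot \<Longrightarrow> P s12 \<and> P s13 \<and> P s23"
    using step[of rot s23 s12] step[of rot s12 s13] step[of rot s13 s23] by simp
  have P_tor: "P s12 \<Longrightarrow> P tor" "P tor \<Longrightarrow> P s12"
    using step[of s12 s13 tor] step[of tor s13 s12] by simp_all
  have "P s12 \<Longrightarrow> P rot" "P s13 \<Longrightarrow> P rot" "P s23 \<Longrightarrow> P rot"
    using step[of s12 s23 rot] step[of s13 s12 rot] step[of s23 s13 rot] by simp_all
  then have "P rot" using start assms(3,4) P_tor unfolding S3_eq by auto
  then have all: "P h" if "h \<in> S3" "h \<noteq> id" for h
    using that P_rot P_tor unfolding S3_eq by auto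
  show ?thesis
  proof
    fix v :: "'k wvec" assume v: "v \<in> wsoc"
    show "v \<in> H"
    proof (rule H_components)
      fix h assume "h \<in> S3"
      show "wsingle h (v h) \<in> H"
        using v all[OF \<open>h \<in> S3\<close>] unfolding P_def wsoc_def
        by (cases "h = id"; cases "v h") (auto, metis snd_conv)
    qed (use v in \<open>auto simp: wsoc_def\<close>)
  qed
qed

lemma wN_mem:
  assumes "v \<in> wN" "wsoc \<subseteq> H" "wsingle id (v id) \<in> H"
  shows "v \<in> H"
proof (rule H_components)
  show "v \<in> wcarrier" using assms(1) by (simp add: wN_def)
  fix g assume "g \<in> S3"
  show "wsingle g (v g) \<in> H"
  proof (cases "g = id")
    case False
    then have "wsingle g (v g) \<in> wsoc"
      using assms(1) \<open>g \<in> S3\<close> by (intro wsingle_wsoc) (simp_all add: wN_def)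
    then show ?thesis using assms(2) by blast
  qed (use assms(3) in simp)
qed

text \<open>x_12 and x_13 read off the two coordinates of \<open>w\<close> as multiples of bottom
  vectors. One of them is nonzero and brings in the whole bottom copy.\<close>

lemma wcyc_subset:
  assumes "wsingle id w \<in> H" "w \<noteq> 0"
  shows "wcyc w \<subseteq> H"
proof -
  have "wsingle s12 (fst w, 0) \<in> H" "wsingle s13 (snd w, 0) \<in> H"
    using H_step[OF assms(1), of s12] H_step[OF assms(1), of s13] by simp_all
  moreover have "fst w \<noteq> 0 \<or> snd w \<noteq> 0" using assms(2) by (auto simp: prod_eq_iff)
  ultimately have soc: "wsoc \<subseteq> H" using wsoc_subset[of s12] wsoc_subset[of s13] by auto
  show ?thesis
  proof
    fix v :: "'k wvec" assume v: "v \<in> wcyc w"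
    then obtain c where c: "v id = (c * fst w, c * snd w)" by (auto simp: wcyc_def)
    have "wsingle id (v id) \<in> H"
      using H_scale[OF assms(1), of c] c by (simp add: wsingle_scale)
    with v soc show "v \<in> H" using wN_mem by (auto simp: wcyc_def)
  qed
qed

text \<open>A nonzero top coordinate can be carried to weight \<open>rot\<close>. Two different
  words of length 2 lead from there to independent vectors of weight e, so all of M[e] and with it
  the bottom copy lie in \<open>H\<close>; modulo these the top coordinates can be moved around
  freely.\<close>

lemma wsub_eq_carrier:
  assumes "wsingle g (x, y) \<in> H" "y \<noteq> 0" "g \<in> S3" "g \<noteq> id"
  shows "H = wcarrier"
proof -
  define Q where "Q g \<longleftrightarrow> (\<exists>x y. y \<noteq> 0 \<and> wsingle g (x, y) \<in> H)" for g
  have step: "Q h" if Qg: "Q g" and t: "t \<in> O23" "g \<in> S3" "h = t \<circ> g"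
      and c: "\<And>w. snd (wstep a t h w) = c * snd w" "c \<noteq> 0" for g h t c
  proof -
    obtain x y where "y \<noteq> 0" "wsingle g (x, y) \<in> H" using Qg by (auto simp: Q_def)
    then have "wsingle h (wstep a t h (x, y)) \<in> H" using H_step[of g "(x, y)" t] t by simp
    then show ?thesis
      unfolding Q_def using c(1)[of "(x, y)"] \<open>y \<noteq> 0\<close> c(2)
      by (metis mult_eq_0_iff prod.collapse snd_conv)
  qed
  have "Q g" using assms by (auto simp: Q_def)
  moreover have "Q tor \<Longrightarrow> Q s12" using step[of tor s13 s12 1] by simp
  moreover have "Q s12 \<Longrightarrow> Q rot" "Q s13 \<Longrightarrow> Q rot" "Q s23 \<Longrightarrow> Q rot"
    using step[of s12 s23 rot "a s23 - a s13"] step[of s13 s12 rot "a s12 - a s23"]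
      step[of s23 s13 rot "a s13 - a s12"] by simp_all
  ultimately have "Q rot" using assms(3,4) unfolding S3_eq by auto
  then obtain x y where y: "y \<noteq> 0" and xy: "wsingle rot (x, y) \<in> H" by (auto simp: Q_def)
  let ?q = "a s13 - a s23"
  \<comment> \<open>The words x_13 x_12 and x_23 x_13 kill the bottom coordinate \<open>x\<close> of
    the starting vector, so only \<open>y\<close> enters.\<close>
  have id1: "wsingle id (?q * y, 0) \<in> H"
    using H_step[OF H_step[OF xy, of s12], of s13] by simp
  have id2: "wsingle id (- (?q * y), ?q * y) \<in> H"
    using H_step[OF H_step[OF xy, of s13], of s23] by (simp add: left_diff_distrib)
  have "wsingle id (0, ?q * y) \<in> H"
    using H_single_add[OF id1 id2] by simp
  then have idl: "wsingle id (b, 0) \<in> H" "wsingle id (0, b) \<in> H" for b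
    using H_fst_line[OF id1] H_snd_line y by simp_all
  have on_id: "wsingle id w \<in> H" for w
    using H_single_add[OF idl(1)[of "fst w"] idl(2)[of "snd w"]] by simp
  have "wsoc \<subseteq> H"
    using wcyc_subset[OF on_id[of "(1, 0)"]] wsub_wcyc
    using wsoc_subset[OF H_step[OF on_id[of "(1, 0)"], of s12, simplified]] by simp
  then have soc: "wsingle h (b, 0) \<in> H" if "h \<in> S3" "h \<noteq> id" for h b
    using wsingle_wsoc[OF that, of "(b, 0)"] by auto
  \<comment> \<open>With all bottom vectors at hand, the bottom coordinate can be subtracted and the
    top one rescaled.\<close>
  have on: "wsingle h w \<in> H" if "wsingle h (b, c) \<in> H" "c \<noteq> 0" "h \<in> S3" "h \<noteq> id" for h w b c
  proof -
    have "wsingle h (0, c) \<in> H"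
      using H_single_add[OF that(1) soc[OF that(3,4), of "- b"]] by simp
    then show ?thesis
      using H_single_add[OF H_snd_line[of h c "snd w"] soc[OF that(3,4), of "fst w"]] that(2) by simp
  qed
  have rot: "wsingle rot w \<in> H" for w using on[OF xy y] by simp
  have s12: "wsingle s12 w \<in> H" for w
    using on[OF H_step[OF rot[of "(0, 1)"], of s23, simplified]] by simp
  have "wsingle s13 w \<in> H" "wsingle s23 w \<in> H" "wsingle tor w \<in> H" for w
    using on[OF H_step[OF rot[of "(0, 1)"], of s12, simplified]]
      on[OF H_step[OF rot[of "(0, 1)"], of s13, simplified]]
      on[OF H_step[OF s12[of "(0, 1)"], of s13, simplified]] by simp_all
  with rot s12 on_id have "wsingle h w \<in> H" if "h \<in> S3" for h w
    using that unfolding S3_eq by (cases w) auto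
  then show ?thesis using H_components H_carrier by blast
qed

theorem classification:
  assumes "H \<noteq> {0}"
  obtains "H = wsoc" | w where "w \<noteq> 0" "H = wcyc w" | "H = wN" | "H = wcarrier"
proof (cases "H \<subseteq> wN")
  case False
  then obtain v g where v: "v \<in> H" "g \<noteq> id" "snd (v g) \<noteq> 0"
    using H_carrier by (auto simp: wN_def)
  then have "g \<in> S3" using H_carrier[of v] by (auto simp: wcarrier_def)
  then show ?thesis
    using wsub_eq_carrier[of g "fst (v g)" "snd (v g)"] v H_component[of v g] that(4) by simp
next
  case True
  obtain v where v: "v \<in> H" "v \<noteq> 0" using assms H_zero by blast
  show ?thesis
  proof (cases "\<exists>u\<in>H. u id \<noteq> 0")
    case False
    obtain g where g: "v g \<noteq> 0" using v(2) by (auto simp: fun_eq_iff)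
    then have "g \<in> S3" "g \<noteq> id" using H_carrier[OF v(1)] False v(1) by (auto simp: wcarrier_def)
    moreover from this have "snd (v g) = 0" using True v(1) by (auto simp: wN_def)
    moreover have "fst (v g) \<noteq> 0" using g calculation(3) by (auto simp: prod_eq_iff)
    ultimately have "wsoc \<subseteq> H"
      using wsoc_subset[of g "fst (v g)"] H_component[OF v(1), of g] by (metis prod.collapse)
    moreover have "H \<subseteq> wsoc"
    proof
      fix u assume "u \<in> H"
      then have "u \<in> wN" "u id = 0" using True False by auto
      moreover from this have "snd (u g) = 0" for g
        by (cases "g = id") (simp_all add: wN_def)
      ultimately show "u \<in> wsoc" by (simp add: wN_def wsoc_def)
    qed
    ultimately show ?thesis using that(1) by blast
  next
    case ex: True
    then obtain u where u: "u \<in> H" "u id \<noteq> 0" by blast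
    define w where "w = u id"
    have w: "wsingle id w \<in> H" "w \<noteq> 0" using H_component[OF u(1), of id] u(2) by (simp_all add: w_def)
    show ?thesis
    proof (cases "H \<subseteq> wcyc w")
      case True
      then show ?thesis using wcyc_subset[OF w] that(2) w(2) by blast
    next
      case False
      then obtain u' where u': "u' \<in> H" "u' \<notin> wcyc w" by blast
      define w' where "w' = u' id"
      have w': "wsingle id w' \<in> H" using H_component[OF u'(1), of id] by (simp add: w'_def)
      \<comment> \<open>The determinant of the two vectors \<open>w\<close> and \<open>w'\<close> of
        weight e. If it vanished, \<open>w'\<close> would be a multiple of \<open>w\<close>, with a
        factor read off from a coordinate in which \<open>w\<close> is nonzero.\<close>
      define d where "d = fst w * snd w' - snd w * fst w'"
      have "w' \<noteq> (c * fst w, c * snd w)" for c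
        using u' True by (auto simp: wcyc_def w'_def)
      from this[of "fst w' / fst w"] this[of "snd w' / snd w"] have "d \<noteq> 0"
        using w(2) by (auto simp: d_def prod_eq_iff field_simps)
      have all: "wsingle id z \<in> H" for z
      proof -
        \<comment> \<open>Cramer's rule for writing \<open>z\<close> as a combination of
          \<open>w\<close> and \<open>w'\<close>.\<close>
        let ?\<alpha> = "(fst z * snd w' - snd z * fst w') / d" and ?\<beta> = "(fst w * snd z - snd w * fst z) / d"
        have "?\<alpha> * fst w + ?\<beta> * fst w' = fst z" "?\<alpha> * snd w + ?\<beta> * snd w' = snd z"
          using \<open>d \<noteq> 0\<close> by (simp_all add: field_simps) (simp_all add: d_def algebra_simps)
        then show ?thesis
          using H_single_add[OF H_single_scale[of id "fst w" "snd w" ?\<alpha>] H_single_scale[of id "fst w'" "snd w'" ?\<beta>]]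
            w(1) w' by simp
      qed
      have "wN \<subseteq> H"
      proof
        fix v :: "'k wvec" assume v: "v \<in> wN"
        have "wsoc \<subseteq> wcyc w"
          by (auto simp: wsoc_def wcyc_def wN_def zero_prod_def intro: exI[of _ 0])
        then show "v \<in> H"
          using v wcyc_subset[OF w] all wN_mem by blast
      qed
      then show ?thesis using True that(3) by blast
    qed
  qed
qed

end

section \<open>The Verma module is isomorphic to the model\<close>

locale generic_verma =
  fixes a :: "perm3 \<Rightarrow> 'k::field"
  assumes generic_a: "generic a"
begin

sublocale verma_module a rot
  by (rule verma_module.intro) simp

lemma generic_neq [simp]: "a s12 \<noteq> a s13" "a s12 \<noteq> a s23" "a s13 \<noteq> a s23"
    "a s13 \<noteq> a s12" "a s23 \<noteq> a s12" "a s23 \<noteq> a s13"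
  using generic_a by (auto simp: generic_def s12_def s13_def s23_def)

abbreviation wact :: "(gen, 'k) nc_poly \<Rightarrow> 'k wvec \<Rightarrow> 'k wvec" where
  "wact \<equiv> nc_act wscale (wgen a)"

text \<open>The image of m_1: it has the weight of the Verma module, and its nonzero top coordinate
  makes it generate the model.\<close>

definition v0 :: "'k wvec" where
  "v0 = wsingle rot (0, 1)"

lemma v0_closed [simp, intro]: "v0 \<in> wcarrier"
  by (simp add: v0_def)

lemma T_imp_wact: "p \<in> carrier free3 \<Longrightarrow> q \<in> carrier free3 \<Longrightarrow> T p = T q \<Longrightarrow> wact p v0 = wact q v0"
  by (rule T_eq_imp_act_eq[OF alg_rep_wgen v0_closed])
     (auto simp: v0_def wgen_Dl_eq)

text \<open>Applied to \<open>v0\<close>, the twelve words fall into six pairs according to the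
  weight they reach, so the linear system splits into one system of size 2 for each weight. Its
  determinant is nonzero because the a_t are distinct.\<close>

lemma normal_words_independent:
  assumes "Poly_Mapping.keys r \<subseteq> map Xg ` normal_words" "wact r v0 = 0"
  shows "r = 0"
proof -
  let ?c = "\<lambda>w. Poly_Mapping.lookup r (map Xg w)"
  have "inj_on (map Xg) normal_words"
    by (auto simp: inj_on_def)
  have "finite (map Xg ` normal_words)" by (simp add: normal_words_def)
  then have "(\<Sum>w\<in>normal_words. wscale (?c w) (foldr (wgen a) (map Xg w) v0)) = 0"
    using assms W.act_superset[of "map Xg ` normal_words" r a v0] \<open>inj_on _ _\<close>
    by (simp add: sum.reindex)
  then have *: "(\<Sum>w\<in>normal_words. wscale (?c w) (foldr (wgen a) (map Xg w) v0)) g = 0" for g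
    by simp
  note simps = normal_words_def wgen_Xg_wsingle v0_def wsingle_scale zero_prod_def
  have "?c [s12, s13, s12] = 0" "?c [s23] = 0" "?c [s13, s12, s23] = 0" "?c [s12] = 0"
    using *[of s12] *[of s13] by (simp_all add: simps)
  moreover have xzx: "?c [s12, s23, s12] = 0" using *[of s23] by (simp add: simps)
  moreover have "?c [s13] = 0" using *[of s23] xzx by (auto simp: simps)
  moreover have "?c [s12, s23] = 0" "?c [s13, s12] = 0"
    using *[of id] by (simp_all add: simps)
  moreover have "?c [s12, s13] = 0" "?c [s23, s12] = 0"
  \<comment> \<open>At weight \<open>tor\<close> neither coordinate isolates a coefficient. The
    bottom one equates the two coefficients; inserted into the top one this leaves the factor
    \<open>a s23 - a s13\<close>.\<close>
  proof -
    have eq: "?c [s12, s13] = ?c [s23, s12]"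
      "?c [s12, s13] * (a s12 - a s13) + ?c [s23, s12] * (a s23 - a s12) = 0"
      using *[of tor] by (auto simp: simps)
    have "?c [s23, s12] * (a s23 - a s13)
        = ?c [s12, s13] * (a s12 - a s13) + ?c [s23, s12] * (a s23 - a s12)"
      unfolding eq(1) by (simp only: algebra_simps)
    then have "?c [s23, s12] * (a s23 - a s13) = 0" using eq(2) by metis
    then show "?c [s23, s12] = 0" by simp
    with eq(1) show "?c [s12, s13] = 0" by simp
  qed
  moreover have "?c [] = 0" "?c [s13, s12, s23, s12] = 0"
    using *[of rot] by (auto simp: simps)
  ultimately have "\<forall>w\<in>normal_words. ?c w = 0"
    by (simp add: normal_words_def)
  then have "Poly_Mapping.lookup r u = 0" for u
    using assms(1) by (cases "u \<in> map Xg ` normal_words") (auto simp: in_keys_iff)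
  then show ?thesis by (simp add: poly_mapping_eqI)
qed


text \<open>The difference reduces to a combination of normal words that still acts on
  \<open>v0\<close> by zero, and independence makes this combination trivial.\<close>

lemma wact_eq_imp_T:
  assumes "p \<in> carrier free3" "q \<in> carrier free3" "wact p v0 = wact q v0"
  shows "T p = T q"
proof -
  have pq: "p - q \<in> carrier free3" using assms by auto
  obtain r where r: "Poly_Mapping.keys r \<subseteq> map Xg ` normal_words" "T (p - q) = T r"
    using red_all[OF pq] by (auto simp: reducible_def)
  then have "wact r v0 = wact (p - q) v0"
    using pq normal_closed T_imp_wact by metis
  also have "\<dots> = 0" using assms(3) by (simp add: W.act_diff)
  finally have "T (p - q) = T 0" using normal_words_independent r by metis
  then have "T (p - q) \<oplus>\<^bsub>M\<^esub> T q = T 0 \<oplus>\<^bsub>M\<^esub> T q" by simp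
  then show ?thesis
    using assms pq by (simp add: T_add[symmetric])
qed

text \<open>The chosen representative does not matter, by \<open>T_imp_wact\<close>.\<close>

definition \<phi> :: "'k verma_el \<Rightarrow> 'k wvec" where
  "\<phi> X = wact (SOME p. p \<in> carrier free3 \<and> X = T p) v0"

lemma phi_T: "p \<in> carrier free3 \<Longrightarrow> \<phi> (T p) = wact p v0"
proof -
  assume p: "p \<in> carrier free3"
  define q where "q = (SOME q. q \<in> carrier free3 \<and> T p = T q)"
  have "q \<in> carrier free3 \<and> T p = T q"
    unfolding q_def by (rule someI[of _ p]) (use p in simp)
  then show ?thesis
    using p T_imp_wact unfolding \<phi>_def q_def[symmetric] by metis
qed

lemma phi_closed: "X \<in> carrier M \<Longrightarrow> \<phi> X \<in> wcarrier"
  using phi_T W.act_closed[OF _ v0_closed] by (metis T_surj)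

lemma phi_inj: "X \<in> carrier M \<Longrightarrow> Y \<in> carrier M \<Longrightarrow> \<phi> X = \<phi> Y \<Longrightarrow> X = Y"
  by (metis T_surj phi_T wact_eq_imp_T)

lemma phi_add: "X \<in> carrier M \<Longrightarrow> Y \<in> carrier M \<Longrightarrow> \<phi> (X \<oplus>\<^bsub>M\<^esub> Y) = \<phi> X + \<phi> Y"
  by (elim T_surj) (simp add: T_add[symmetric] phi_T W.act_add)

lemma phi_zero [simp]: "\<phi> \<zero>\<^bsub>M\<^esub> = 0"
  using phi_T[of 0] by (simp add: T_zero)

lemma M_smult_closed: "x \<in> carrier (alg a) \<Longrightarrow> X \<in> carrier M \<Longrightarrow> x \<odot>\<^bsub>M\<^esub> X \<in> carrier M"
  by (elim T_surj) (auto simp: carrier_alg T_smult intro!: T_closed free_alg_closed)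

lemma M_smult_assoc:
  "x \<in> carrier (alg a) \<Longrightarrow> y \<in> carrier (alg a) \<Longrightarrow> X \<in> carrier M \<Longrightarrow>
     x \<odot>\<^bsub>M\<^esub> (y \<odot>\<^bsub>M\<^esub> X) = (x \<otimes>\<^bsub>alg a\<^esub> y) \<odot>\<^bsub>M\<^esub> X"
  by (elim T_surj) (auto simp: carrier_alg T_smult alg_cls_mult mult.assoc)

lemma M_smult_add:
  "x \<in> carrier (alg a) \<Longrightarrow> X \<in> carrier M \<Longrightarrow> Y \<in> carrier M \<Longrightarrow>
     x \<odot>\<^bsub>M\<^esub> (X \<oplus>\<^bsub>M\<^esub> Y) = x \<odot>\<^bsub>M\<^esub> X \<oplus>\<^bsub>M\<^esub> x \<odot>\<^bsub>M\<^esub> Y"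
  by (elim T_surj) (auto simp: carrier_alg T_smult T_add[symmetric] distrib_left)

lemma M_smult_zero: "x \<in> carrier (alg a) \<Longrightarrow> x \<odot>\<^bsub>M\<^esub> \<zero>\<^bsub>M\<^esub> = \<zero>\<^bsub>M\<^esub>"
  by (auto simp: carrier_alg T_zero[symmetric] T_smult)

lemma M_smult_uminus:
  assumes "x \<in> carrier (alg a)" "X \<in> carrier M"
  shows "x \<odot>\<^bsub>M\<^esub> (\<ominus>\<^bsub>M\<^esub> X) = \<ominus>\<^bsub>M\<^esub> (x \<odot>\<^bsub>M\<^esub> X)"
  using M_smult_add[of x "\<ominus>\<^bsub>M\<^esub> X" X] assms M_smult_closed[of x]
  by (intro M.minus_equality[symmetric]) (auto simp: M.l_neg M_smult_zero)

lemma M_smult_one: "X \<in> carrier M \<Longrightarrow> \<one>\<^bsub>alg a\<^esub> \<odot>\<^bsub>M\<^esub> X = X"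
  by (elim T_surj) (simp add: alg_one T_smult)

lemma phi_smult:
  "p \<in> carrier free3 \<Longrightarrow> X \<in> carrier M \<Longrightarrow> \<phi> (alg_cls a p \<odot>\<^bsub>M\<^esub> X) = wact p (\<phi> X)"
  by (elim T_surj) (simp add: T_smult phi_T W.act_mult)

lemma phi_uminus: "X \<in> carrier M \<Longrightarrow> \<phi> (\<ominus>\<^bsub>M\<^esub> X) = - \<phi> X"
  using phi_add[of X "\<ominus>\<^bsub>M\<^esub> X"] by (simp add: M.r_neg eq_neg_iff_add_eq_0 add.commute)

lemma wsub_act_closed:
  assumes "wsub a H" "p \<in> carrier free3" "v \<in> H"
  shows "wact p v \<in> H"
proof -
  interpret nc_rep wscale "wgen a" gens3 H
    using assms(1) W.gen_add W.gen_scale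
    by unfold_locales (auto simp: wsub_def simp del: Un_iff)
  show ?thesis using assms(2,3) by (rule act_closed)
qed

text \<open>The image is a submodule of the model containing \<open>v0\<close>, whose top coordinate
  is nonzero; so it is everything.\<close>

lemma phi_surj: "\<phi> ` carrier M = wcarrier"
proof -
  let ?H = "\<phi> ` carrier M"
  have "wsub a ?H"
  proof (rule wsubI)
    show "0 \<in> ?H" using phi_zero M.zero_closed by (metis image_eqI)
    show "u + v \<in> ?H" if "u \<in> ?H" "v \<in> ?H" for u v
      using that by (auto simp: phi_add[symmetric])
    show "wscale c v \<in> ?H" if v: "v \<in> ?H" for c v
    proof -
      obtain X where X: "X \<in> carrier M" "v = \<phi> X" using v by blast
      then have "wscale c v = \<phi> (alg_cls a (Poly_Mapping.single [] c) \<odot>\<^bsub>M\<^esub> X)"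
        by (simp add: phi_smult)
      then show ?thesis using X M_smult_closed[of "alg_cls a (Poly_Mapping.single [] c)" X] by auto
    qed
    show "wgen a s v \<in> ?H" if s: "s \<in> gens3" and v: "v \<in> ?H" for s v
    proof -
      obtain X where X: "X \<in> carrier M" "v = \<phi> X" using v by blast
      have s: "Poly_Mapping.single [s] 1 \<in> carrier free3" using s by auto
      then have "wgen a s v = \<phi> (alg_cls a (Poly_Mapping.single [s] 1) \<odot>\<^bsub>M\<^esub> X)"
        using X phi_smult[OF s X(1)] by simp
      then show ?thesis using X s M_smult_closed[of "alg_cls a (Poly_Mapping.single [s] 1)" X] by auto
    qed
  qed (use phi_closed in auto)
  then interpret wsubmodule a ?H by unfold_locales (use generic_a in auto)
  have "T 1 \<in> carrier M" "\<phi> (T 1) = wsingle rot (0, 1)"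
    by (auto simp: phi_T v0_def)
  then have "wsingle rot (0, 1) \<in> ?H" by (metis image_eqI)
  then show ?thesis by (rule wsub_eq_carrier) simp_all
qed

section \<open>Transport of submodules between the model and the Verma module\<close>

definition phi_vimage :: "'k wvec set \<Rightarrow> 'k verma_el set" where
  "phi_vimage H = {X \<in> carrier M. \<phi> X \<in> H}"

lemma phi_image_vimage: "H \<subseteq> wcarrier \<Longrightarrow> \<phi> ` phi_vimage H = H"
  using phi_surj by (auto simp: phi_vimage_def image_iff)

lemma phi_vimage_image: "H \<subseteq> carrier M \<Longrightarrow> phi_vimage (\<phi> ` H) = H"
  using phi_inj by (auto simp: phi_vimage_def)

lemma phi_vimage_subset_iff:
  assumes "H \<subseteq> wcarrier"
  shows "phi_vimage H \<subseteq> phi_vimage H' \<longleftrightarrow> H \<subseteq> H'"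
proof
  assume "phi_vimage H \<subseteq> phi_vimage H'"
  then have "\<phi> ` phi_vimage H \<subseteq> \<phi> ` phi_vimage H'" by (rule image_mono)
  moreover have "\<phi> ` phi_vimage H' \<subseteq> H'" by (auto simp: phi_vimage_def)
  ultimately show "H \<subseteq> H'" using phi_image_vimage[OF assms] by blast
qed (auto simp: phi_vimage_def)

lemma phi_vimage_eq_iff: "H \<subseteq> wcarrier \<Longrightarrow> H' \<subseteq> wcarrier \<Longrightarrow> phi_vimage H = phi_vimage H' \<longleftrightarrow> H = H'"
  using phi_vimage_subset_iff[of H H'] phi_vimage_subset_iff[of H' H] by blast

lemma submodule_phi_vimage:
  assumes "wsub a H"
  shows "submodule (phi_vimage H) (alg a) M"
proof
  note H = assms[unfolded wsub_def]
  show "phi_vimage H \<subseteq> carrier (add_monoid M)" by (auto simp: phi_vimage_def)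
  show "x \<otimes>\<^bsub>add_monoid M\<^esub> y \<in> phi_vimage H" if "x \<in> phi_vimage H" "y \<in> phi_vimage H" for x y
    using that H by (auto simp: phi_vimage_def phi_add)
  show "\<one>\<^bsub>add_monoid M\<^esub> \<in> phi_vimage H" using H by (auto simp: phi_vimage_def)
  show "inv\<^bsub>add_monoid M\<^esub> x \<in> phi_vimage H" if "x \<in> phi_vimage H" for x
  proof -
    have "wscale (- 1) (\<phi> x) \<in> H" using that H unfolding phi_vimage_def by blast
    then have "\<ominus>\<^bsub>M\<^esub> x \<in> phi_vimage H"
      using that by (simp add: phi_vimage_def phi_uminus W.scale_minus_left)
    then show ?thesis by (simp add: a_inv_def)
  qed
  show "x \<odot>\<^bsub>M\<^esub> X \<in> phi_vimage H" if "x \<in> carrier (alg a)" "X \<in> phi_vimage H" for x X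
    using that M_smult_closed wsub_act_closed[OF assms] by (auto simp: phi_vimage_def carrier_alg phi_smult)
qed

lemma submodule_eq_phi_vimage:
  assumes "submodule H (alg a) M"
  shows "wsub a (\<phi> ` H)" "H = phi_vimage (\<phi> ` H)"
proof -
  interpret submodule H "alg a" M by fact
  have sub: "H \<subseteq> carrier M" using subset by simp
  have smult: "wact p (\<phi> X) \<in> \<phi> ` H" if "p \<in> carrier free3" "X \<in> H" for p X
  proof -
    have "alg_cls a p \<odot>\<^bsub>M\<^esub> X \<in> H" using that by (intro smult_closed) auto
    from imageI[OF this, of \<phi>] show ?thesis
      using phi_smult[OF that(1) subsetD[OF sub that(2)]] by simp
  qed
  show "wsub a (\<phi> ` H)"
  proof (rule wsubI)
    show "0 \<in> \<phi> ` H" using imageI[OF one_closed, of \<phi>] by simp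
    show "u + v \<in> \<phi> ` H" if "u \<in> \<phi> ` H" "v \<in> \<phi> ` H" for u v
      using that sub m_closed by (auto simp: phi_add[symmetric] subsetD)
    show "wscale c v \<in> \<phi> ` H" if "v \<in> \<phi> ` H" for c v
      using that smult[of "Poly_Mapping.single [] c"] by auto
    show "wgen a s v \<in> \<phi> ` H" if "s \<in> gens3" "v \<in> \<phi> ` H" for s v
      using that smult[of "Poly_Mapping.single [s] 1"] by auto
  qed (use sub phi_closed in auto)
  show "H = phi_vimage (\<phi> ` H)" using phi_vimage_image sub by blast
qed

text \<open>Turns the computation of a generated submodule into the search for a least submodule of
  the model. The point to check is that the additive group generated by the products is stable under
  the algebra, which goes by induction on its generation.\<close>

lemma mod_span_eq_phi_vimage:
  assumes "S \<subseteq> carrier M" "wsub a H" "\<phi> ` S \<subseteq> H"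
    and "\<And>H'. wsub a H' \<Longrightarrow> \<phi> ` S \<subseteq> H' \<Longrightarrow> H \<subseteq> H'"
  shows "mod_span M (carrier (alg a)) S = phi_vimage H"
proof
  let ?B = "{b \<odot>\<^bsub>M\<^esub> s |b s. b \<in> carrier (alg a) \<and> s \<in> S}"
  let ?N = "mod_span M (carrier (alg a)) S"
  interpret P: submodule "phi_vimage H" "alg a" M using assms(2) by (rule submodule_phi_vimage)
  have "?B \<subseteq> phi_vimage H"
    using assms(1,3) by (auto simp: phi_vimage_def intro!: P.smult_closed[unfolded phi_vimage_def, simplified])
  then show "?N \<subseteq> phi_vimage H"
    unfolding mod_span_def by (rule M.add.generate_subgroup_incl[OF _ P.subgroup_axioms])
  have B: "?B \<subseteq> carrier M" using assms(1) M_smult_closed by blast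
  have sub: "?N \<subseteq> carrier M" using \<open>?N \<subseteq> phi_vimage H\<close> by (auto simp: phi_vimage_def)
  have phiB: "wact p (\<phi> X) \<in> \<phi> ` ?N" if "p \<in> carrier free3" "X \<in> ?N" for p X
  proof -
    have "alg_cls a p \<odot>\<^bsub>M\<^esub> X \<in> ?N"
      using that(2) unfolding mod_span_def
    proof (induction X rule: generate.induct)
      case one
      have "alg_cls a p \<odot>\<^bsub>M\<^esub> \<zero>\<^bsub>M\<^esub> = \<zero>\<^bsub>M\<^esub>"
        using that(1) by (intro M_smult_zero) auto
      then show ?case using generate.one[of "add_monoid M" ?B] by simp
    next
      case (incl h)
      then obtain b s where h: "h = b \<odot>\<^bsub>M\<^esub> s" "b \<in> carrier (alg a)" "s \<in> S" by blast
      have "alg_cls a p \<odot>\<^bsub>M\<^esub> (b \<odot>\<^bsub>M\<^esub> s) = (alg_cls a p \<otimes>\<^bsub>alg a\<^esub> b) \<odot>\<^bsub>M\<^esub> s"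
        using h(2,3) that(1) assms(1) by (intro M_smult_assoc) auto
      then show ?case
        using h that(1) ring.ring_simprules(5)[OF ring_alg]
        by (intro generate.incl) (auto intro!: exI[of _ "alg_cls a p \<otimes>\<^bsub>alg a\<^esub> b"])
    next
      case (inv h)
      then obtain b s where h: "h = b \<odot>\<^bsub>M\<^esub> s" "b \<in> carrier (alg a)" "s \<in> S" by blast
      have "h \<in> carrier M" using B inv by blast
      have "alg_cls a p \<odot>\<^bsub>M\<^esub> (\<ominus>\<^bsub>M\<^esub> h) = \<ominus>\<^bsub>M\<^esub> ((alg_cls a p \<otimes>\<^bsub>alg a\<^esub> b) \<odot>\<^bsub>M\<^esub> s)"
        using h that(1) assms(1) \<open>h \<in> carrier M\<close> M_smult_assoc[of "alg_cls a p" b s]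
          M_smult_uminus[of "alg_cls a p" h] alg_cls_closed[of p a] by (simp add: subsetD)
      then show ?case
        using h that(1) ring.ring_simprules(5)[OF ring_alg]
        by (auto simp: a_inv_def intro!: generate.inv exI[of _ "alg_cls a p \<otimes>\<^bsub>alg a\<^esub> b"])
    next
      case (eng h1 h2)
      have h: "h1 \<in> carrier M" "h2 \<in> carrier M"
        using eng.hyps sub by (auto simp: mod_span_def)
      then have "alg_cls a p \<odot>\<^bsub>M\<^esub> (h1 \<oplus>\<^bsub>M\<^esub> h2) = alg_cls a p \<odot>\<^bsub>M\<^esub> h1 \<oplus>\<^bsub>M\<^esub> alg_cls a p \<odot>\<^bsub>M\<^esub> h2"
        using that(1) by (intro M_smult_add) auto
      then show ?case using generate.eng[OF eng.IH] by simp
    qed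
    from imageI[OF this, of \<phi>] show ?thesis
      using phi_smult[OF that(1) subsetD[OF sub that(2)]] by simp
  qed
  have "wsub a (\<phi> ` ?N)"
  proof (rule wsubI)
    show "0 \<in> \<phi> ` ?N"
      unfolding mod_span_def using imageI[OF generate.one[of "add_monoid M" ?B], of \<phi>] by simp
    show "u + v \<in> \<phi> ` ?N" if uv: "u \<in> \<phi> ` ?N" "v \<in> \<phi> ` ?N" for u v
    proof -
      obtain X Y where XY: "X \<in> ?N" "Y \<in> ?N" "u = \<phi> X" "v = \<phi> Y" using uv by blast
      then have "X \<oplus>\<^bsub>M\<^esub> Y \<in> ?N"
        unfolding mod_span_def using generate.eng[of X "add_monoid M" ?B Y] by simp
      then have "\<phi> (X \<oplus>\<^bsub>M\<^esub> Y) \<in> \<phi> ` ?N" by (rule imageI)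
      then show ?thesis using XY sub phi_add[of X Y] by (simp add: subsetD)
    qed
    show "wscale c v \<in> \<phi> ` ?N" if "v \<in> \<phi> ` ?N" for c v
      using that phiB[of "Poly_Mapping.single [] c"] by auto
    show "wgen a s v \<in> \<phi> ` ?N" if "s \<in> gens3" "v \<in> \<phi> ` ?N" for s v
      using that phiB[of "Poly_Mapping.single [s] 1"] by auto
  qed (use sub phi_closed in auto)
  moreover have "S \<subseteq> ?N"
  proof
    fix s assume "s \<in> S"
    then have "s \<in> carrier M" using assms(1) by blast
    then have "s = \<one>\<^bsub>alg a\<^esub> \<odot>\<^bsub>M\<^esub> s" by (simp add: M_smult_one)
    then have "s \<in> ?B"
      using \<open>s \<in> S\<close> ring.ring_simprules(6)[OF ring_alg] by blast
    then show "s \<in> ?N" unfolding mod_span_def by (rule generate.incl)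
  qed
  ultimately have "H \<subseteq> \<phi> ` ?N" using assms(4) by blast
  then show "phi_vimage H \<subseteq> ?N" using phi_vimage_image[OF sub] by (auto simp: phi_vimage_def)
qed

end

section \<open>Quotients\<close>

text \<open>The additive part is the isomorphism theorem for groups. For the scalar action, a union
  over the coset, the classes of \<open>r \<odot> y\<close> with y in the coset have the same image
  under the injective map \<open>f\<close>, hence are equal.\<close>

lemma quot_mod_isomorphic:
  fixes N :: "('r, 'v) module" and W :: "('r, 'w) module"
  assumes "group_hom (add_monoid N) (add_monoid W) h" and surj: "h ` carrier N = carrier W"
    and smult: "\<And>r x. r \<in> carrier R \<Longrightarrow> x \<in> carrier N \<Longrightarrow>
      r \<odot>\<^bsub>N\<^esub> x \<in> carrier N \<and> h (r \<odot>\<^bsub>N\<^esub> x) = r \<odot>\<^bsub>W\<^esub> h x"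
  shows "mod_isomorphic R (quot_mod N {x \<in> carrier N. h x = \<zero>\<^bsub>W\<^esub>}) W"
proof -
  let ?G = "add_monoid N" and ?H = "add_monoid W"
  interpret h: group_hom ?G ?H h by fact
  define K where "K = {x \<in> carrier N. h x = \<zero>\<^bsub>W\<^esub>}"
  define f where "f X = the_elem (h ` X)" for X
  have K: "K = kernel ?G ?H h" by (simp add: K_def kernel_def)
  have f: "f (r_coset ?G K x) = h x" if "x \<in> carrier N" for x
  proof -
    have "h ` r_coset ?G K x = {h x}"
      using that h.subgroup_kernel[THEN subgroup.one_closed]
      h.hom_mult[simplified] h.G.l_one[simplified] h.H.l_one[simplified] h.hom_closed[simplified]
      unfolding K r_coset_def by (auto simp: kernel_def image_iff intro!: exI[of _ "\<zero>\<^bsub>N\<^esub>"])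
    then show ?thesis by (simp add: f_def)
  qed
  have "f \<in> iso (?G Mod K) ?H"
    unfolding f_def K using surj by (intro h.FactGroup_iso_set) simp
  then have "f \<in> iso (add_monoid (quot_mod N K)) ?H"
    by (simp add: iso_def hom_def FactGroup_def quot_mod_def A_RCOSETS_def set_add_def)
  moreover have "f (r \<odot>\<^bsub>quot_mod N K\<^esub> X) = r \<odot>\<^bsub>W\<^esub> f X"
    if r: "r \<in> carrier R" and X: "X \<in> carrier (quot_mod N K)" for r X
  proof -
    obtain x where x: "x \<in> carrier N" "X = r_coset ?G K x"
      using X by (auto simp: quot_mod_def A_RCOSETS_def RCOSETS_def)
    have "r_coset ?G K (r \<odot>\<^bsub>N\<^esub> y) = r_coset ?G K (r \<odot>\<^bsub>N\<^esub> x)" if y: "y \<in> X" for y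
    proof -
      have "y \<in> carrier N"
        using y x K h.subgroup_kernel h.G.r_coset_subset_G[of K x] subgroup.subset by fastforce
      have "h y = h x"
        using y x \<open>y \<in> carrier N\<close> h.hom_mult[simplified] h.H.l_one[simplified] h.hom_closed[simplified]
        unfolding x(2) by (auto simp: r_coset_def K_def)
      then have "r_coset ?G K (r \<odot>\<^bsub>N\<^esub> y) \<in> carrier (?G Mod K)"
          "r_coset ?G K (r \<odot>\<^bsub>N\<^esub> x) \<in> carrier (?G Mod K)"
          "f (r_coset ?G K (r \<odot>\<^bsub>N\<^esub> y)) = f (r_coset ?G K (r \<odot>\<^bsub>N\<^esub> x))"
        using f smult[OF r] x(1) \<open>y \<in> carrier N\<close> by (auto simp: carrier_FactGroup)
      then show ?thesis
        using \<open>f \<in> iso (?G Mod K) ?H\<close> by (auto simp: iso_def bij_betw_def inj_on_def)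
    qed
    moreover have "x \<in> X"
      using x h.G.rcos_self[of x K] h.subgroup_kernel K by simp
    ultimately have "(\<Union>y\<in>X. r_coset ?G K (r \<odot>\<^bsub>N\<^esub> y)) = r_coset ?G K (r \<odot>\<^bsub>N\<^esub> x)"
      by blast
    then have "r \<odot>\<^bsub>quot_mod N K\<^esub> X = r_coset ?G K (r \<odot>\<^bsub>N\<^esub> x)"
      by (simp add: quot_mod_def a_r_coset_def)
    then show ?thesis using f x smult[OF r x(1)] by simp
  qed
  ultimately show ?thesis unfolding mod_isomorphic_def K_def by blast
qed

lemma (in nc_rep) comm_group_rep_mod: "comm_group (add_monoid (rep_mod C sc \<rho> :: ((_, _) nc_poly set, _) module))"
proof (rule comm_groupI)
  show "\<exists>y\<in>carrier (add_monoid (rep_mod C sc \<rho>)). y \<otimes>\<^bsub>add_monoid (rep_mod C sc \<rho>)\<^esub> x = \<one>\<^bsub>add_monoid (rep_mod C sc \<rho>)\<^esub>"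
    if "x \<in> carrier (add_monoid (rep_mod C sc \<rho>))" for x
    using that C_scale[of x "- 1"] by (intro bexI[of _ "- x"]) (simp_all add: rep_mod_def)
qed (auto simp: rep_mod_def add_ac C_zero C_add)

context generic_verma
begin

lemma intertwiner_act:
  assumes "nc_rep sc \<rho> gens3 C" and H: "wsub a H"
    and f_add: "\<And>u v. u \<in> H \<Longrightarrow> v \<in> H \<Longrightarrow> f (u + v) = f u + f v"
    and f_scale: "\<And>c v. v \<in> H \<Longrightarrow> f (wscale c v) = sc c (f v)"
    and f_gen: "\<And>s v. s \<in> gens3 \<Longrightarrow> v \<in> H \<Longrightarrow> f (wgen a s v) = \<rho> s (f v)"
    and p: "p \<in> carrier free3" and v: "v \<in> H"
  shows "f (wact p v) = nc_act sc \<rho> p (f v)"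
proof -
  interpret nc_rep sc \<rho> gens3 C by fact
  note H' = H[unfolded wsub_def]
  have f_zero: "f 0 = 0" using f_add[of 0 0] H' by auto
  have word: "foldr (wgen a) w v \<in> H \<and> f (foldr (wgen a) w v) = foldr \<rho> w (f v)" if "set w \<subseteq> gens3" for w
    using that
  proof (induction w)
    case (Cons s w)
    then have "s \<in> gens3" "foldr (wgen a) w v \<in> H" by auto
    then show ?case using H' f_gen Cons by (auto simp del: Un_iff)
  qed (use v in simp)
  \<comment> \<open>Membership in \<open>H\<close> is carried along because \<open>f\<close> is
    additive only there.\<close>
  have "(\<Sum>w\<in>S. wscale (c w) (foldr (wgen a) w v)) \<in> H \<and> 
      f (\<Sum>w\<in>S. wscale (c w) (foldr (wgen a) w v)) = (\<Sum>w\<in>S. sc (c w) (foldr \<rho> w (f v)))"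
    if "finite S" "\<forall>w\<in>S. set w \<subseteq> gens3" for S c
    using that
  proof (induction S)
    case (insert w S)
    let ?u = "wscale (c w) (foldr (wgen a) w v)" and ?s = "\<Sum>w\<in>S. wscale (c w) (foldr (wgen a) w v)"
    have "foldr (wgen a) w v \<in> H" "f (foldr (wgen a) w v) = foldr \<rho> w (f v)"
      using word[of w] insert.prems by auto
    then have "?u \<in> H" "f ?u = sc (c w) (foldr \<rho> w (f v))"
      using H' f_scale by auto
    moreover have "?s \<in> H" "f ?s = (\<Sum>w\<in>S. sc (c w) (foldr \<rho> w (f v)))"
      using insert.IH insert.prems by simp_all
    moreover from calculation have "?u + ?s \<in> H" "f (?u + ?s) = f ?u + f ?s"
      using H' f_add by blast+
    ultimately show ?case by (simp only: sum.insert[OF insert.hyps(1,2)])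
  qed (use H' f_zero in auto)
  from this[of "Poly_Mapping.keys p" "Poly_Mapping.lookup p"] p show ?thesis
    unfolding nc_act_def by (auto simp: free_alg_def)
qed

lemma group_sub_mod_phi_vimage:
  assumes "wsub a H"
  shows "group (add_monoid (sub_mod M (phi_vimage H)))"
proof -
  interpret submodule "phi_vimage H" "alg a" M using assms by (rule submodule_phi_vimage)
  have "group ((add_monoid M)\<lparr>carrier := phi_vimage H\<rparr>)"
    using subgroup_axioms M.add.subgroup_imp_group by blast
  then show ?thesis by (simp add: sub_mod_def)
qed

text \<open>Serves all four isomorphisms of the theorem: each comes from a linear map on a submodule
  of the model that commutes with the generators, and it remains to determine the kernel.\<close>

lemma isomorphism:
  assumes rep: "alg_rep sc \<rho> C a" and H: "wsub a H"
    and f_add: "\<And>u v. u \<in> H \<Longrightarrow> v \<in> H \<Longrightarrow> f (u + v) = f u + f v"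
    and f_scale: "\<And>c v. v \<in> H \<Longrightarrow> f (wscale c v) = sc c (f v)"
    and f_gen: "\<And>s v. s \<in> gens3 \<Longrightarrow> v \<in> H \<Longrightarrow> f (wgen a s v) = \<rho> s (f v)"
    and f_surj: "f ` H = C"
  shows "mod_isomorphic (alg a) (quot_mod (sub_mod M (phi_vimage H)) (phi_vimage {v \<in> H. f v = 0})) (rep_mod C sc \<rho>)"
    and "{v \<in> H. f v = 0} = {0} \<Longrightarrow> mod_isomorphic (alg a) (sub_mod M (phi_vimage H)) (rep_mod C sc \<rho>)"
proof -
  interpret rep: alg_rep sc \<rho> C a by (rule rep)
  let ?N = "sub_mod M (phi_vimage H)" and ?W = "rep_mod C sc \<rho>" and ?h = "\<lambda>X. f (\<phi> X)"
  interpret P: submodule "phi_vimage H" "alg a" M using H by (rule submodule_phi_vimage)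
  have N: "x \<in> carrier ?N \<longleftrightarrow> x \<in> carrier M \<and> \<phi> x \<in> H" for x
    by (simp add: sub_mod_def phi_vimage_def)
  have H_carrier: "H \<subseteq> wcarrier" using H by (simp add: wsub_def)
  interpret W: comm_group "add_monoid ?W" by (rule rep.comm_group_rep_mod)
  interpret N: group "add_monoid ?N" using H by (rule group_sub_mod_phi_vimage)
  have hom: "group_hom (add_monoid ?N) (add_monoid ?W) ?h"
  proof unfold_locales
    show "?h \<in> hom (add_monoid ?N) (add_monoid ?W)"
      using f_surj by (auto simp: hom_def N f_add phi_add) (auto simp: rep_mod_def sub_mod_def phi_vimage_def f_add phi_add)
  qed
  have surj: "?h ` carrier ?N = carrier ?W"
    using phi_image_vimage[OF H_carrier] f_surj by (simp add: sub_mod_def rep_mod_def image_image[symmetric])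
  have smult: "r \<odot>\<^bsub>?N\<^esub> x \<in> carrier ?N \<and> ?h (r \<odot>\<^bsub>?N\<^esub> x) = r \<odot>\<^bsub>?W\<^esub> ?h x"
    if r: "r \<in> carrier (alg a)" and x: "x \<in> carrier ?N" for r x
  proof -
    obtain p where p: "p \<in> carrier free3" "r = alg_cls a p" using r by (auto simp: carrier_alg)
    have "f (wact p (\<phi> x)) = rep.act p (f (\<phi> x))"
      by (rule intertwiner_act[OF rep.nc_rep_axioms H f_add f_scale f_gen p(1)])
         (use x N in auto)
    moreover have "f (\<phi> x) \<in> C" using f_surj x N by blast
    moreover have "r \<odot>\<^bsub>M\<^esub> x \<in> phi_vimage H" using r x by (intro P.smult_closed) (auto simp: sub_mod_def)
    ultimately show ?thesis
      using p x N phi_smult[OF p(1), of x] rep.rep_mod_smult[OF p(1), of "f (\<phi> x)"]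
      by (simp add: sub_mod_def)
  qed
  have ker: "{x \<in> carrier ?N. ?h x = \<zero>\<^bsub>?W\<^esub>} = phi_vimage {v \<in> H. f v = 0}"
    using N by (auto simp: phi_vimage_def[of "{v \<in> H. f v = 0}"] rep_mod_def)
  from quot_mod_isomorphic[OF hom surj smult, of "alg a"]
  show "mod_isomorphic (alg a) (quot_mod ?N (phi_vimage {v \<in> H. f v = 0})) ?W"
    by (simp only: ker)
  assume inj: "{v \<in> H. f v = 0} = {0}"
  interpret h: group_hom "add_monoid ?N" "add_monoid ?W" ?h by (rule hom)
  have "x = \<zero>\<^bsub>M\<^esub>" if "x \<in> carrier ?N" "?h x = 0" for x
    using that N inj phi_inj[of x "\<zero>\<^bsub>M\<^esub>"] by auto
  then have "inj_on ?h (carrier ?N)"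
    using h.inj_on_one_iff by (auto simp: rep_mod_def sub_mod_def)
  then have "?h \<in> iso (add_monoid ?N) (add_monoid ?W)"
    using h.homh surj by (simp add: iso_def bij_betw_def)
  then show "mod_isomorphic (alg a) ?N ?W"
    unfolding mod_isomorphic_def by (rule bexI[rotated]) (use smult in blast)
qed

end

section \<open>The modules \<open>L\<close> and \<open>k_e\<close> as representations of the
  algebra\<close>

lemma S3_minus_id: "S3 - {id} = {s12, s13, s23, rot, tor}"
  unfolding S3_eq by auto

abbreviation Lscale :: "'k::field \<Rightarrow> (perm3 \<Rightarrow>\<^sub>0 'k) \<Rightarrow> perm3 \<Rightarrow>\<^sub>0 'k" where
  "Lscale c \<equiv> Poly_Mapping.map (\<lambda>y. c * y)"

abbreviation Lcarrier :: "(perm3 \<Rightarrow>\<^sub>0 'k::field) set" where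
  "Lcarrier \<equiv> {u. Poly_Mapping.keys u \<subseteq> S3 - {id}}"

definition L_vec :: "(perm3 \<Rightarrow> 'k::field) \<Rightarrow> perm3 \<Rightarrow>\<^sub>0 'k" where
  "L_vec k = (\<Sum>g\<in>S3 - {id}. Poly_Mapping.single g (k g))"

lemma lookup_L_vec: "Poly_Mapping.lookup (L_vec k) g = (if g \<in> S3 - {id} then k g else 0)"
  by (simp add: L_vec_def lookup_sum lookup_single when_def sum.delta)

lemma L_vec_cong: "(\<And>g. g \<in> S3 - {id} \<Longrightarrow> k g = k' g) \<Longrightarrow> L_vec k = L_vec k'"
  unfolding L_vec_def by (intro sum.cong) auto

lemma L_vec_closed [simp]: "L_vec k \<in> Lcarrier"
  by (auto simp: in_keys_iff lookup_L_vec split: if_splits)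

lemma L_vec_lookup: "u \<in> Lcarrier \<Longrightarrow> L_vec (Poly_Mapping.lookup u) = u"
  by (rule poly_mapping_eqI) (auto simp: lookup_L_vec in_keys_iff subset_iff)

lemma L_vec_add: "L_vec k + L_vec k' = L_vec (\<lambda>g. k g + k' g)"
  by (rule poly_mapping_eqI) (simp add: lookup_L_vec lookup_add)

lemma lookup_Lscale [simp]: "Poly_Mapping.lookup (Lscale c u) g = c * Poly_Mapping.lookup u g"
  by (simp add: Poly_Mapping.map.rep_eq when_def)

lemma Lscale_L_vec: "Lscale c (L_vec k) = L_vec (\<lambda>g. c * k g)"
  by (rule poly_mapping_eqI) (simp add: lookup_L_vec)

lemma Lscale_single: "Lscale c (Poly_Mapping.single g x) = Poly_Mapping.single g (c * x)"
  by (rule poly_mapping_eqI) (simp add: lookup_single when_def)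

lemma Lscale_add: "Lscale c (u + v) = Lscale c u + Lscale c v"
  by (rule poly_mapping_eqI) (simp add: lookup_add distrib_left)

lemma Lscale_sum: "Lscale c (\<Sum>i\<in>I. u i) = (\<Sum>i\<in>I. Lscale c (u i))"
  by (rule poly_mapping_eqI) (simp add: lookup_sum sum_distrib_left)

lemma L_gen_Dl_L_vec: "L_gen a (Dl h) (L_vec k) = L_vec (\<lambda>g. if g = h then k g else 0)"
  by (rule poly_mapping_eqI) (simp add: L_gen_def lookup_L_vec lookup_single when_def)

text \<open>Coefficients are sorted by target instead of source, as in \<open>wstep\<close>. This
  flips the parity, while f_t has the same value at both ends of an edge; the target
  \<open>t\<close> gets 0 because its source e is not a weight of \<open>L\<close>.\<close>

lemma L_gen_Xg_L_vec:
  assumes "t \<in> O23"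
  shows "L_gen a (Xg t) (L_vec k) =
    L_vec (\<lambda>g. if g = t then 0 else (if sign g = 1 then ff a t g else 1) * k (t \<circ> g))"
  using assms unfolding O23_eq
  by (elim insertE emptyE)
     (simp add: L_gen_def lookup_L_vec S3_minus_id, simp add: L_vec_def S3_minus_id ac_simps)+

lemma nc_rep_L: "nc_rep Lscale (L_gen a) gens3 Lcarrier" for a :: "perm3 \<Rightarrow> 'k::field"
proof unfold_locales
  show "Lscale c (u + v) = Lscale c u + Lscale c v" for c and u v :: "perm3 \<Rightarrow>\<^sub>0 'k"
    by (rule Lscale_add)
  show "Lscale (c + d) u = Lscale c u + Lscale d u" "Lscale c (Lscale d u) = Lscale (c * d) u"
    "Lscale 1 u = u" for c d and u :: "perm3 \<Rightarrow>\<^sub>0 'k"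
    by (rule poly_mapping_eqI, simp only: lookup_Lscale lookup_add, simp add: algebra_simps)+
  show "L_gen a s (u + v) = L_gen a s u + L_gen a s v" for s u v
    by (cases s) (simp_all add: L_gen_def lookup_add single_add sum.distrib distrib_right)
  show "L_gen a s (Lscale c v) = Lscale c (L_gen a s v)" for s c v
    by (cases s) (simp_all add: L_gen_def Lscale_single Lscale_sum mult.assoc)
  show "0 \<in> Lcarrier" by simp
  show "u + v \<in> Lcarrier" if "u \<in> Lcarrier" "v \<in> Lcarrier" for u v :: "perm3 \<Rightarrow>\<^sub>0 'k"
    using L_vec_add[of "Poly_Mapping.lookup u" "Poly_Mapping.lookup v"] L_vec_closed
    unfolding L_vec_lookup[OF that(1)] L_vec_lookup[OF that(2)] by metis
  show "Lscale c v \<in> Lcarrier" if "v \<in> Lcarrier" for c and v :: "perm3 \<Rightarrow>\<^sub>0 'k"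
    using Lscale_L_vec[of c "Poly_Mapping.lookup v"] L_vec_closed
    unfolding L_vec_lookup[OF that] by metis
  show "L_gen a s v \<in> Lcarrier" if s: "s \<in> gens3" and v: "v \<in> Lcarrier" for s v
  proof -
    have "L_gen a s (L_vec (Poly_Mapping.lookup v)) \<in> Lcarrier"
      using s by (elim UnE imageE) (simp_all only: L_gen_Dl_L_vec L_gen_Xg_L_vec L_vec_closed)
    then show ?thesis unfolding L_vec_lookup[OF v] .
  qed
qed

text \<open>Relations pass to images. Applied to the top coordinates of the model, this yields the
  relations on \<open>L\<close> from those already checked.\<close>

lemma alg_rep_image:
  assumes "alg_rep sc \<rho> C a" and "nc_rep sc' \<rho>' gens3 C'"
    and f_add: "\<And>u v. u \<in> C \<Longrightarrow> v \<in> C \<Longrightarrow> f (u + v) = f u + f v"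
    and f_scale: "\<And>c v. v \<in> C \<Longrightarrow> f (sc c v) = sc' c (f v)"
    and f_gen: "\<And>s v. s \<in> gens3 \<Longrightarrow> v \<in> C \<Longrightarrow> f (\<rho> s v) = \<rho>' s (f v)"
    and f_surj: "f ` C = C'"
  shows "alg_rep sc' \<rho>' C' a"
proof -
  interpret R: alg_rep sc \<rho> C a by fact
  interpret R': nc_rep sc' \<rho>' gens3 C' by fact
  have f_zero: "f 0 = 0" using f_add[of 0 0] R.C_zero by simp
  have f_sum: "f (\<Sum>i\<in>I. u i) = (\<Sum>i\<in>I. f (u i))" if "\<And>i. i \<in> I \<Longrightarrow> u i \<in> C" for I :: "perm3 set" and u
    using that
  proof (induction I rule: infinite_finite_induct)
    case (insert i I)
    then show ?case using f_add[of "u i" "sum u I"] R.C_sum[of I u] by simp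
  qed (simp_all add: f_zero)
  have gen: "\<rho>' s (f v) = f (\<rho> s v)" "\<rho> s v \<in> C" if "s \<in> gens3" "v \<in> C" for s v
    using f_gen[OF that] R.C_gen[OF that] by simp_all
  have g: "h \<in> S3 \<Longrightarrow> Dl h \<in> gens3" "t \<in> O23 \<Longrightarrow> Xg t \<in> gens3" for h t
    by auto
  show ?thesis
  proof (rule alg_rep.intro[OF assms(2)], unfold_locales)
    fix v' assume "v' \<in> C'"
    then obtain v where v: "v' = f v" "v \<in> C" using f_surj by blast
    note gens = gen g R.C_gen v(2) R.C_add R.C_scale
    show "\<rho>' (Dl g) (\<rho>' (Dl h) v') = (if g = h then \<rho>' (Dl g) v' else 0)" if "g \<in> S3" "h \<in> S3" for g h
      using that R.Dl_Dl[OF v(2) that] by (simp add: v(1) gens f_zero del: Un_iff)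
    show "(\<Sum>g\<in>S3. \<rho>' (Dl g) v') = v'"
    proof -
      have "(\<Sum>g\<in>S3. \<rho>' (Dl g) v') = (\<Sum>g\<in>S3. f (\<rho> (Dl g) v))"
        by (simp add: v(1) gens del: Un_iff)
      also have "\<dots> = f (\<Sum>g\<in>S3. \<rho> (Dl g) v)"
        by (rule f_sum[symmetric]) (simp add: gens del: Un_iff)
      finally show ?thesis by (simp add: R.sum_Dl v)
    qed
    show "\<rho>' (Dl h) (\<rho>' (Xg t) v') = \<rho>' (Xg t) (\<rho>' (Dl (t \<circ> h)) v')" if "h \<in> S3" "t \<in> O23" for h t
      using that R.Dl_Xg[OF v(2) that] O23_S3_closed[OF that(2,1)] by (simp add: v(1) gens del: Un_iff)
    show "\<rho>' (Xg t) (\<rho>' (Xg t) v') = (\<Sum>g\<in>S3. sc' (ff a t g) (\<rho>' (Dl g) v'))" if "t \<in> O23" for t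
      using that R.Xg_sq[OF v(2) that] f_sum[of S3 "\<lambda>g. sc (ff a t g) (\<rho> (Dl g) v)"]
      by (simp add: v(1) gens f_scale del: Un_iff)
    show "\<rho>' (Xg s13) (\<rho>' (Xg s23) v') + \<rho>' (Xg s23) (\<rho>' (Xg s12) v') + \<rho>' (Xg s12) (\<rho>' (Xg s13) v') = 0"
      using arg_cong[OF R.Xg_cubic1[OF v(2)], of f] by (simp add: v(1) gens f_add f_zero del: Un_iff)
    show "\<rho>' (Xg s23) (\<rho>' (Xg s13) v') + \<rho>' (Xg s13) (\<rho>' (Xg s12) v') + \<rho>' (Xg s12) (\<rho>' (Xg s23) v') = 0"
      using arg_cong[OF R.Xg_cubic2[OF v(2)], of f] by (simp add: v(1) gens f_add f_zero del: Un_iff)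
  qed
qed

definition top_part :: "'k::field wvec \<Rightarrow> perm3 \<Rightarrow>\<^sub>0 'k" where
  "top_part v = L_vec (\<lambda>g. snd (v g))"

lemma top_part_add: "top_part (u + v) = top_part u + top_part v"
  by (simp add: top_part_def L_vec_add)

lemma top_part_scale: "top_part (wscale c v) = Lscale c (top_part v)"
  by (simp add: top_part_def Lscale_L_vec wscale_def)

text \<open>Away from e the top coordinate of the result depends only on the top coordinate of the
  argument, with exactly the coefficients of \<open>L\<close>: the top copy is a quotient.\<close>

lemma snd_wstep:
  "g \<noteq> id \<Longrightarrow> snd (wstep a t g w) = (if g = t then 0 else (if sign g = 1 then ff a t g else 1) * snd w)"
  by (simp add: wstep_def)

lemma top_part_gen:
  assumes "s \<in> gens3"
  shows "top_part (wgen a s v) = L_gen a s (top_part v)"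
proof (cases s)
  case (Dl h)
  then show ?thesis
    by (simp add: top_part_def L_gen_Dl_L_vec wgen_Dl if_distrib[of snd] cong: if_cong)
next
  case (Xg t)
  with assms have "t \<in> O23" by auto
  then have "L_gen a s (top_part v)
      = L_vec (\<lambda>g. if g = t then 0 else (if sign g = 1 then ff a t g else 1) * snd (v (t \<circ> g)))"
    unfolding top_part_def Xg by (rule L_gen_Xg_L_vec)
  also have "\<dots> = top_part (wgen a s v)"
    unfolding top_part_def Xg by (rule L_vec_cong) (simp add: wgen_Xg snd_wstep)
  finally show ?thesis by simp
qed

lemma top_part_surj: "top_part ` wcarrier = Lcarrier"
proof
  show "top_part ` wcarrier \<subseteq> Lcarrier"
    unfolding top_part_def using L_vec_closed by blast
  show "Lcarrier \<subseteq> top_part ` (wcarrier :: 'k::field wvec set)"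
  proof
    fix u :: "perm3 \<Rightarrow>\<^sub>0 'k" assume u: "u \<in> Lcarrier"
    let ?v = "\<lambda>g. if g \<in> S3 then (0, Poly_Mapping.lookup u g) else 0"
    have "top_part ?v = L_vec (Poly_Mapping.lookup u)"
      unfolding top_part_def by (intro L_vec_cong) simp
    then have "u = top_part ?v" using L_vec_lookup[OF u] by simp
    moreover have "?v \<in> wcarrier" by (simp add: wcarrier_def)
    ultimately show "u \<in> top_part ` wcarrier" by blast
  qed
qed

lemma alg_rep_L: "alg_rep Lscale (L_gen a) Lcarrier a"
  by (rule alg_rep_image[OF alg_rep_wgen nc_rep_L top_part_add top_part_scale top_part_gen top_part_surj])

definition k_gen :: "gen \<Rightarrow> 'k::field \<Rightarrow> 'k" where
  "k_gen s c = (case s of Dl g \<Rightarrow> if g = id then c else 0 | Xg t \<Rightarrow> 0)"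

lemma k_gen_simps [simp]: "k_gen (Dl g) c = (if g = id then c else 0)" "k_gen (Xg t) c = 0"
  by (simp_all add: k_gen_def)

text \<open>The relation for x_t^2 is consistent with x_t = 0 because f_t vanishes at e.\<close>

lemma alg_rep_k: "alg_rep (*) k_gen UNIV a"
proof unfold_locales
  show "k_gen s (x + y) = k_gen s x + k_gen s y" "k_gen s (c * x) = c * k_gen s x" for s and x y c :: 'a
    by (cases s; simp)+
qed (auto simp: algebra_simps if_distrib[of "(*) _"] cong: if_cong)

section \<open>The submodule lattice\<close>

lemma k_e_eq: "k_e = rep_mod UNIV (*) k_gen"
  unfolding k_e_def by (rule arg_cong[of _ _ "rep_mod UNIV (*)"]) (simp add: k_gen_def fun_eq_iff)

lemma L_mod_eq: "L_mod a = rep_mod Lcarrier Lscale (L_gen a)"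
  by (simp add: L_mod_def)

lemma wN_Xg_id:
  assumes "v \<in> wN" "t \<in> O23"
  shows "wgen a (Xg t) v id = 0"
proof -
  have "snd (v t) = 0" using assms by (auto simp: wN_def O23_eq)
  then show ?thesis
    using assms(2) unfolding O23_eq by (elim insertE emptyE) (simp_all add: wgen_Xg zero_prod_def)
qed

lemma wcyc_subset_wN: "wcyc w \<subseteq> wN" and wN_subset_wcarrier: "wN \<subseteq> wcarrier"
  and wsoc_subset_wcyc: "wsoc \<subseteq> wcyc w"
  by (auto simp: wcyc_def wN_def wsoc_def zero_prod_def intro: exI[of _ 0])

lemma wsingle_id_wN: "wsingle id w \<in> wN"
  by (simp add: wN_def)

lemma wsingle_id_wcyc: "wsingle id z \<in> wcyc w \<longleftrightarrow> (\<exists>c. z = (c * fst w, c * snd w))"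
  using wsingle_id_wN[of z] by (simp add: wcyc_def)

lemma wcyc_self: "wsingle id w \<in> wcyc w"
  unfolding wsingle_id_wcyc by (intro exI[of _ 1]) simp

lemma wcyc_ne_wN: "wcyc w \<noteq> wN"
proof
  assume "wcyc w = wN"
  then have "wsingle id (1, 0) \<in> wcyc w" "wsingle id (0, 1) \<in> wcyc w"
    using wsingle_id_wN by auto
  then show False unfolding wsingle_id_wcyc by auto
qed

lemma wsoc_ne_wcyc: "w \<noteq> 0 \<Longrightarrow> wsoc \<noteq> wcyc w"
proof
  assume "w \<noteq> 0" "wsoc = wcyc w"
  then have "wsingle id w \<in> wsoc" by (metis wcyc_self)
  with \<open>w \<noteq> 0\<close> show False by (simp add: wsoc_def)
qed

lemma wN_ne_wcarrier: "wN \<noteq> wcarrier"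
proof -
  have "wsingle rot (0, 1) \<notin> wN" by (auto simp: wN_def intro: exI[of _ rot])
  moreover have "wsingle rot (0, 1) \<in> wcarrier" by simp
  ultimately show ?thesis by blast
qed

lemma wcyc_eq_iff:
  assumes "v \<noteq> 0"
  shows "wcyc v = wcyc u \<longleftrightarrow> (\<exists>c. v = (c * fst u, c * snd u))"
proof
  assume "wcyc v = wcyc u"
  then show "\<exists>c. v = (c * fst u, c * snd u)"
    using wcyc_self[of v] by (simp add: wsingle_id_wcyc)
next
  assume "\<exists>c. v = (c * fst u, c * snd u)"
  then obtain c where c: "v = (c * fst u, c * snd u)" by blast
  with assms have "c \<noteq> 0" by (auto simp: zero_prod_def)
  show "wcyc v = wcyc u"
  proof (intro equalityI subsetI)
    fix x assume "x \<in> wcyc v"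
    then obtain d where d: "x \<in> wN" "x id = (d * fst v, d * snd v)" by (auto simp: wcyc_def)
    then have "x id = ((d * c) * fst u, (d * c) * snd u)" by (simp add: c)
    with d(1) show "x \<in> wcyc u" unfolding wcyc_def by blast
  next
    fix x assume "x \<in> wcyc u"
    then obtain d where d: "x \<in> wN" "x id = (d * fst u, d * snd u)" by (auto simp: wcyc_def)
    then have "x id = ((d / c) * fst v, (d / c) * snd v)" using \<open>c \<noteq> 0\<close> by (simp add: c)
    with d(1) show "x \<in> wcyc v" unfolding wcyc_def by blast
  qed
qed

lemma (in wsubmodule) wN_subset:
  assumes "\<And>w. wsingle id w \<in> H"
  shows "wN \<subseteq> H"
proof -
  have "wsoc \<subseteq> H"
    using wcyc_subset[OF assms, of "(1, 0)"] wsoc_subset_wcyc by (auto simp: zero_prod_def)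
  then show ?thesis using wN_mem assms by blast
qed

context generic_verma
begin

lemma wsubmoduleI: "wsub a H \<Longrightarrow> wsubmodule a H"
  by (rule wsubmodule.intro[OF _ generic_a])

section \<open>The submodules of the theorem, identified in the model\<close>

abbreviation "Me \<equiv> weight_space a M id"

text \<open>\<delta>_e is idempotent, so its image consists of the vectors that it fixes; in the
  model it is the projection to the component at \<open>id\<close>.\<close>

lemma Me_eq: "Me = phi_vimage (range (wsingle id))"
proof (intro equalityI subsetI)
  fix X assume "X \<in> Me"
  then obtain m where m: "X = alg_cls a (dl id) \<odot>\<^bsub>M\<^esub> m" "m \<in> carrier M"
    by (auto simp: weight_space_def)
  have "X \<in> carrier M" unfolding m(1) by (intro M_smult_closed m(2) alg_cls_closed dl_closed) simp
  moreover have "\<phi> X = wsingle id (\<phi> m id)"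
    unfolding m(1) by (subst phi_smult) (simp_all add: m(2) wgen_Dl_eq)
  ultimately show "X \<in> phi_vimage (range (wsingle id))" by (simp add: phi_vimage_def)
next
  fix X assume "X \<in> phi_vimage (range (wsingle id))"
  then obtain w where w: "X \<in> carrier M" "\<phi> X = wsingle id w" by (auto simp: phi_vimage_def)
  have "X = alg_cls a (dl id) \<odot>\<^bsub>M\<^esub> X"
  proof (rule phi_inj)
    show "alg_cls a (dl id) \<odot>\<^bsub>M\<^esub> X \<in> carrier M"
      by (intro M_smult_closed w(1) alg_cls_closed dl_closed) simp
    show "\<phi> X = \<phi> (alg_cls a (dl id) \<odot>\<^bsub>M\<^esub> X)"
      by (subst phi_smult) (simp_all add: w wgen_Dl_eq)
  qed (rule w(1))
  then show "X \<in> Me" unfolding weight_space_def using w(1) by (rule image_eqI)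
qed

lemma zero_eq: "{\<zero>\<^bsub>M\<^esub>} = phi_vimage {0}"
  using phi_inj[OF _ M.zero_closed] by (auto simp: phi_vimage_def)

lemma Me_nonzero:
  assumes "X \<in> Me - {\<zero>\<^bsub>M\<^esub>}"
  obtains w where "X \<in> carrier M" "\<phi> X = wsingle id w" "w \<noteq> 0"
proof -
  from assms obtain w where w: "X \<in> carrier M" "\<phi> X = wsingle id w"
    by (auto simp: Me_eq phi_vimage_def)
  moreover have "w \<noteq> 0"
    using assms w phi_inj[OF w(1) M.zero_closed] by auto
  ultimately show thesis using that by blast
qed

lemma Me_surj:
  assumes "w \<noteq> 0"
  obtains X where "X \<in> Me - {\<zero>\<^bsub>M\<^esub>}" "\<phi> X = wsingle id w"
proof -
  have "wsingle id w \<in> \<phi> ` carrier M" unfolding phi_surj by simp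
  then obtain X where X: "X \<in> carrier M" "\<phi> X = wsingle id w" by auto
  moreover have "X \<noteq> \<zero>\<^bsub>M\<^esub>"
  proof
    assume "X = \<zero>\<^bsub>M\<^esub>"
    then have "wsingle id w id = 0" using X(2) by (simp flip: X(2))
    with assms show False by simp
  qed
  ultimately show thesis using that[of X] by (auto simp: Me_eq phi_vimage_def)
qed

text \<open>The word of m_top takes \<open>v0\<close> to the vector of weight \<open>rot\<close>
  with bottom coordinate \<open>a s13 - a s23\<close> and top coordinate f_13((23)) f_23((13)). The
  scalar in \<open>m_soc\<close> is thus the one that removes the top coordinate, and a nonzero
  multiple of a bottom basis vector remains.\<close>

lemma m_soc_closed: "m_soc a \<in> carrier M"
  and phi_m_soc: "\<phi> (m_soc a) = wsingle rot (- (a s13 - a s23), 0)"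
proof -
  let ?c = "ff a s13 s23 * ff a s23 s13"
  let ?p = "Poly_Mapping.single [] ?c - xg s13 * xg s12 * xg s23 * xg s12"
  have p: "xg s13 * xg s12 * xg s23 * xg s12 \<in> carrier free3" by (intro free_alg_closed xg_closed) auto
  then have p': "?p \<in> carrier free3" by auto
  have m: "m_soc a = T ?p"
    using p unfolding m_soc_def rot_def[symmetric] s12_def[symmetric] s13_def[symmetric] s23_def[symmetric]
      m_one_def m_top_def scalar_def alg_one
    by (simp add: T_smult T_diff del: ff_eq)
  show "m_soc a \<in> carrier M" unfolding m using p' by (rule T_closed)
  show "\<phi> (m_soc a) = wsingle rot (- (a s13 - a s23), 0)"
    unfolding m phi_T[OF p']
    by (simp add: W.act_diff W.act_mult v0_def wgen_Xg_wsingle wsingle_scale del: ff_eq)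
       (auto simp: wsingle_def fun_eq_iff zero_prod_def algebra_simps)
qed

lemma cyc_eq_mod_span: "cyc a X = mod_span M (carrier (alg a)) {X}"
  by (simp add: cyc_def rot_def)

lemma cyc_m_soc: "cyc a (m_soc a) = phi_vimage wsoc"
  unfolding cyc_eq_mod_span
proof (rule mod_span_eq_phi_vimage)
  show "\<phi> ` {m_soc a} \<subseteq> wsoc" using phi_m_soc by (simp add: wsingle_wsoc)
  fix H' assume "wsub a H'" "\<phi> ` {m_soc a} \<subseteq> H'"
  then show "wsoc \<subseteq> H'"
    using wsubmodule.wsoc_subset[OF wsubmoduleI, of H' rot] by (simp add: phi_m_soc)
qed (use m_soc_closed wsub_wsoc in auto)

lemma cyc_eq:
  assumes "X \<in> carrier M" "\<phi> X = wsingle id w" "w \<noteq> 0"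
  shows "cyc a X = phi_vimage (wcyc w)"
  unfolding cyc_eq_mod_span
proof (rule mod_span_eq_phi_vimage)
  show "\<phi> ` {X} \<subseteq> wcyc w" using assms(2) wcyc_self by simp
  fix H' assume "wsub a H'" "\<phi> ` {X} \<subseteq> H'"
  then show "wcyc w \<subseteq> H'"
    using wsubmodule.wcyc_subset[OF wsubmoduleI, of H' w] assms by simp
qed (use assms wsub_wcyc[of a w] in auto)

lemma N1323_eq: "N1323 a = phi_vimage wN"
proof -
  have "N1323 a = mod_span M (carrier (alg a)) Me"
    by (simp add: N1323_def rot_def)
  also have "\<dots> = phi_vimage wN"
  proof (rule mod_span_eq_phi_vimage)
    have Me: "\<phi> ` Me = range (wsingle id)"
      unfolding Me_eq by (rule phi_image_vimage) auto
    show "\<phi> ` Me \<subseteq> wN" using Me wsingle_id_wN by auto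
    fix H' assume "wsub a H'" "\<phi> ` Me \<subseteq> H'"
    then show "wN \<subseteq> H'"
      using wsubmodule.wN_subset[OF wsubmoduleI, of H'] Me by auto
  qed (auto simp: wsub_wN Me_eq phi_vimage_def)
  finally show ?thesis .
qed

lemma carrier_eq: "carrier M = phi_vimage wcarrier"
  using phi_closed by (auto simp: phi_vimage_def)

text \<open>The scalar multiples of \<open>X\<close> already form an additive group, so generation
  adds nothing to them.\<close>

lemma line_eq:
  assumes "X \<in> carrier M"
  shows "line a X = phi_vimage (range (\<lambda>c. wscale c (\<phi> X)))"
proof -
  let ?R = "range (\<lambda>c. wscale c (\<phi> X))"
  let ?B = "{b \<odot>\<^bsub>M\<^esub> s |b s. b \<in> range (scalar a) \<and> s \<in> {X}}"
  have smult: "\<phi> (scalar a c \<odot>\<^bsub>M\<^esub> X) = wscale c (\<phi> X)" "scalar a c \<odot>\<^bsub>M\<^esub> X \<in> carrier M" for c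
    unfolding scalar_def using assms by (auto simp: phi_smult intro!: M_smult_closed)
  have "generate (add_monoid M) ?B = phi_vimage ?R"
  proof (intro equalityI subsetI)
    fix Y assume "Y \<in> generate (add_monoid M) ?B"
    then show "Y \<in> phi_vimage ?R"
    proof (induction Y rule: generate.induct)
      case one
      have "0 = wscale 0 (\<phi> X)" by simp
      then show ?case by (auto simp: phi_vimage_def)
    next
      case (incl h)
      then show ?case using smult by (auto simp: phi_vimage_def)
    next
      case (inv h)
      then obtain c where h: "h = scalar a c \<odot>\<^bsub>M\<^esub> X" by auto
      then have "\<phi> (\<ominus>\<^bsub>M\<^esub> h) = wscale (- c) (\<phi> X)" "\<ominus>\<^bsub>M\<^esub> h \<in> carrier M"
        using smult[of c] by (simp_all add: phi_uminus)
      then have "\<ominus>\<^bsub>M\<^esub> h \<in> phi_vimage ?R" unfolding phi_vimage_def by blast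
      then show ?case by (simp add: a_inv_def)
    next
      case (eng h1 h2)
      then obtain c d where h: "h1 \<in> carrier M" "h2 \<in> carrier M"
          "\<phi> h1 = wscale c (\<phi> X)" "\<phi> h2 = wscale d (\<phi> X)" by (auto simp: phi_vimage_def)
      then have "\<phi> (h1 \<oplus>\<^bsub>M\<^esub> h2) = wscale (c + d) (\<phi> X)"
        by (simp add: phi_add W.scale_left_distrib)
      then have "\<phi> (h1 \<oplus>\<^bsub>M\<^esub> h2) \<in> ?R" by (metis rangeI)
      then show ?case using h by (simp add: phi_vimage_def)
    qed
  next
    fix Y assume "Y \<in> phi_vimage ?R"
    then obtain c where Y: "Y \<in> carrier M" "\<phi> Y = wscale c (\<phi> X)" by (auto simp: phi_vimage_def)
    then have "Y = scalar a c \<odot>\<^bsub>M\<^esub> X" using phi_inj smult[of c] by metis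
    then show "Y \<in> generate (add_monoid M) ?B" by (intro generate.incl) blast
  qed
  then show ?thesis by (simp add: line_def mod_span_def rot_def)
qed

section \<open>The composition factors\<close>

lemma iso_wcyc:
  assumes "w \<noteq> 0"
  shows "mod_isomorphic (alg a) (quot_mod (sub_mod M (phi_vimage (wcyc w))) (phi_vimage wsoc)) k_e"
proof -
  \<comment> \<open>On \<open>wcyc w\<close> this is the factor \<open>c\<close> of the component
    \<open>c w\<close> at \<open>id\<close>, read off from a coordinate in which \<open>w\<close> is
    nonzero.\<close>
  define f where "f v = (if fst w \<noteq> 0 then fst (v id) / fst w else snd (v id) / snd w)" for v :: "'k wvec"
  have w: "fst w \<noteq> 0 \<or> snd w \<noteq> 0" using assms by (auto simp: prod_eq_iff)
  have f_c: "f v = c" if "v id = (c * fst w, c * snd w)" for v c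
    using w that by (auto simp: f_def)
  have "{v \<in> wcyc w. f v = 0} = wsoc"
  proof (intro equalityI subsetI)
    fix v assume v: "v \<in> {v \<in> wcyc w. f v = 0}"
    then obtain c where "v id = (c * fst w, c * snd w)" by (auto simp: wcyc_def)
    moreover have "c = 0" using f_c[of v c] calculation v by simp
    ultimately have "v id = 0" by (simp add: zero_prod_def)
    moreover from this have "snd (v g) = 0" for g
      using v by (cases "g = id") (auto simp: wcyc_def wN_def)
    ultimately show "v \<in> wsoc" using v by (auto simp: wsoc_def wcyc_def wN_def)
  next
    fix v :: "'k wvec" assume "v \<in> wsoc"
    then show "v \<in> {v \<in> wcyc w. f v = 0}"
      using wsoc_subset_wcyc[of w] by (auto simp: wsoc_def f_def)
  qed
  moreover have "mod_isomorphic (alg a) (quot_mod (sub_mod M (phi_vimage (wcyc w))) (phi_vimage {v \<in> wcyc w. f v = 0}))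
      (rep_mod UNIV (*) k_gen)"
  proof (rule isomorphism(1)[OF alg_rep_k wsub_wcyc])
    show "f (u + v) = f u + f v" for u v by (simp add: f_def add_divide_distrib)
    show "f (wscale c v) = c * f v" for c v by (simp add: f_def wscale_def)
    show "f (wgen a s v) = k_gen s (f v)" if "s \<in> gens3" "v \<in> wcyc w" for s v
      using that wN_Xg_id[of v] wcyc_subset_wN[of w] 
      by (auto simp: f_def wgen_Dl_eq wsingle_def subset_iff)
    have "f (wsingle id (c * fst w, c * snd w)) = c" "wsingle id (c * fst w, c * snd w) \<in> wcyc w" for c
      unfolding wsingle_id_wcyc using f_c by auto
    then show "f ` wcyc w = UNIV" by (metis UNIV_eq_I image_eqI)
  qed
  ultimately show ?thesis by (simp add: k_e_eq)
qed

lemma iso_wN: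
  assumes "w \<noteq> 0"
  shows "mod_isomorphic (alg a) (quot_mod (sub_mod M (phi_vimage wN)) (phi_vimage (wcyc w))) k_e"
proof -
  \<comment> \<open>The determinant against \<open>w\<close>: a linear form on the plane M[e] whose
    kernel is the line through \<open>w\<close>.\<close>
  define f where "f v = fst (v id) * snd w - snd (v id) * fst w" for v :: "'k wvec"
  have w: "fst w \<noteq> 0 \<or> snd w \<noteq> 0" using assms by (auto simp: prod_eq_iff)
  have "{v \<in> wN. f v = 0} = wcyc w"
  proof (intro equalityI subsetI)
    fix v assume v: "v \<in> {v \<in> wN. f v = 0}"
    have "\<exists>c. v id = (c * fst w, c * snd w)"
    proof (cases "fst w = 0")
      case True
      then show ?thesis
        using v w by (intro exI[of _ "snd (v id) / snd w"]) (auto simp: f_def prod_eq_iff)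
    next
      case False
      then show ?thesis
        using v by (intro exI[of _ "fst (v id) / fst w"]) (auto simp: f_def prod_eq_iff field_simps)
    qed
    then show "v \<in> wcyc w" using v by (simp add: wcyc_def)
  qed (auto simp: wcyc_def f_def)
  moreover have "mod_isomorphic (alg a) (quot_mod (sub_mod M (phi_vimage wN)) (phi_vimage {v \<in> wN. f v = 0}))
      (rep_mod UNIV (*) k_gen)"
  proof (rule isomorphism(1)[OF alg_rep_k wsub_wN])
    show "f (u + v) = f u + f v" for u v by (simp add: f_def algebra_simps)
    show "f (wscale c v) = c * f v" for c v by (simp add: f_def wscale_def algebra_simps)
    show "f (wgen a s v) = k_gen s (f v)" if "s \<in> gens3" "v \<in> wN" for s v
      using that wN_Xg_id[of v] by (auto simp: f_def wgen_Dl_eq wsingle_def)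
    have "\<exists>z. f (wsingle id z) = c" for c
    proof (cases "fst w = 0")
      case True
      then show ?thesis using w by (intro exI[of _ "(c / snd w, 0)"]) (simp add: f_def)
    next
      case False
      then show ?thesis by (intro exI[of _ "(0, - c / fst w)"]) (simp add: f_def)
    qed
    then show "f ` wN = UNIV" using wsingle_id_wN by (metis UNIV_eq_I image_eqI)
  qed
  ultimately show ?thesis by (simp add: k_e_eq)
qed

lemma iso_top: "mod_isomorphic (alg a) (quot_mod M (phi_vimage wN)) (L_mod a)"
proof -
  have "sub_mod M (phi_vimage wcarrier) = M"
    by (simp add: sub_mod_def carrier_eq[symmetric])
  moreover have "{v \<in> wcarrier. top_part v = 0} = (wN :: 'k wvec set)"
  proof -
    have "top_part v = 0 \<longleftrightarrow> (\<forall>g. g \<noteq> id \<longrightarrow> snd (v g) = 0)" if "v \<in> wcarrier" for v :: "'k wvec"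
    proof -
      have "top_part v = 0 \<longleftrightarrow> (\<forall>g\<in>S3 - {id}. snd (v g) = 0)"
        unfolding top_part_def poly_mapping_eq_iff fun_eq_iff by (auto simp: lookup_L_vec)
      also have "\<dots> \<longleftrightarrow> (\<forall>g. g \<noteq> id \<longrightarrow> snd (v g) = 0)"
        using that by (auto simp: wcarrier_def)
      finally show ?thesis .
    qed
    then show ?thesis unfolding wN_def by blast
  qed
  ultimately show ?thesis
    using isomorphism(1)[OF alg_rep_L wsub_wcarrier top_part_add top_part_scale top_part_gen top_part_surj]
    by (simp add: L_mod_eq)
qed

text \<open>In the bottom copy \<open>x\<^sub>t\<close> has coefficient \<open>1\<close> on odd weights and \<open>f\<^sub>t\<close> on even ones, in \<open>L\<close> it is
  the other way round; \<open>kappa\<close> rescales one basis to the other.\<close>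

definition kappa :: "perm3 \<Rightarrow> 'k" where
  "kappa g = (if g = s12 then 1 / (a s13 - a s23) else if g = s13 then 1 / (a s23 - a s12)
     else if g = s23 then 1 / (a s12 - a s13) else if g = rot then - 1 else 1)"

definition soc_part :: "'k wvec \<Rightarrow> perm3 \<Rightarrow>\<^sub>0 'k" where
  "soc_part v = L_vec (\<lambda>g. kappa g * fst (v g))"

lemma kappa_ne_0: "kappa g \<noteq> 0"
  by (simp add: kappa_def)

text \<open>For odd \<open>g\<close> the condition is
  \<open>kappa (t \<circ> g) = ff a t g * kappa g\<close>, and for even \<open>g\<close> it is the
  same condition at \<open>t \<circ> g\<close>. The two transpositions other than an odd
  \<open>g\<close> have opposite values of f_t at \<open>g\<close>, so the choice 1 at
  \<open>tor\<close> and -1 at \<open>rot\<close> is consistent along all edges.\<close>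

lemma kappa_step:
  assumes "t \<in> O23" "g \<in> S3 - {id}" "g \<noteq> t"
  shows "kappa g * (if sign g = 1 then 1 else ff a t g)
    = (if sign g = 1 then ff a t g else 1) * kappa (t \<circ> g)"
  using assms unfolding O23_eq S3_minus_id
  by (elim insertE emptyE) (simp_all add: kappa_def field_simps)

lemma soc_part_gen:
  assumes "s \<in> gens3" "v \<in> wsoc"
  shows "soc_part (wgen a s v) = L_gen a s (soc_part v)"
proof (cases s)
  case (Dl h)
  then show ?thesis
    unfolding soc_part_def by (simp add: L_gen_Dl_L_vec wgen_Dl) (rule L_vec_cong, simp)
next
  case (Xg t)
  with assms have t: "t \<in> O23" by auto
  then have "L_gen a s (soc_part v) = L_vec (\<lambda>g. if g = t then 0
      else (if sign g = 1 then ff a t g else 1) * (kappa (t \<circ> g) * fst (v (t \<circ> g))))"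
    unfolding soc_part_def Xg by (rule L_gen_Xg_L_vec)
  also have "\<dots> = soc_part (wgen a s v)"
    unfolding soc_part_def Xg
  proof (rule L_vec_cong)
    fix g assume g: "g \<in> S3 - {id}"
    have v: "snd (v h) = 0" "v id = 0" for h using assms(2) by (auto simp: wsoc_def)
    show "(if g = t then 0 else (if sign g = 1 then ff a t g else 1) * (kappa (t \<circ> g) * fst (v (t \<circ> g))))
        = kappa g * fst (wgen a (Xg t) v g)"
    proof (cases "g = t")
      case True
      then show ?thesis using g t v by (simp add: wgen_Xg wstep_def O23_involution)
    next
      case False
      then have "fst (wgen a (Xg t) v g) = (if sign g = 1 then 1 else ff a t g) * fst (v (t \<circ> g))"
        using g v by (simp add: wgen_Xg wstep_def)
      then show ?thesis using kappa_step[OF t g False] False by (simp add: mult.assoc[symmetric])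
    qed
  qed
  finally show ?thesis by simp
qed

lemma iso_soc: "mod_isomorphic (alg a) (sub_mod M (phi_vimage wsoc)) (L_mod a)"
  unfolding L_mod_eq
proof (rule isomorphism(2)[OF alg_rep_L wsub_wsoc])
  show "soc_part (u + v) = soc_part u + soc_part v" for u v
    by (simp add: soc_part_def L_vec_add distrib_left)
  show "soc_part (wscale c v) = Lscale c (soc_part v)" for c v
    by (simp add: soc_part_def Lscale_L_vec wscale_def mult.left_commute)
  show "soc_part ` wsoc = Lcarrier"
  proof
    show "soc_part ` wsoc \<subseteq> Lcarrier"
      unfolding soc_part_def using L_vec_closed by blast
    show "Lcarrier \<subseteq> soc_part ` wsoc"
    proof
      fix u :: "perm3 \<Rightarrow>\<^sub>0 'k" assume u: "u \<in> Lcarrier"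
      let ?v = "\<lambda>g. if g \<in> S3 - {id} then (Poly_Mapping.lookup u g / kappa g, 0) else 0"
      have "soc_part ?v = L_vec (Poly_Mapping.lookup u)"
        unfolding soc_part_def by (intro L_vec_cong) (simp add: kappa_ne_0)
      then have "u = soc_part ?v" using L_vec_lookup[OF u] by simp
      moreover have "?v \<in> wsoc" by (simp add: wsoc_def wcarrier_def)
      ultimately show "u \<in> soc_part ` wsoc" by blast
    qed
  qed
  show "{v \<in> wsoc. soc_part v = 0} = {0}"
  proof (intro equalityI subsetI)
    fix v assume v: "v \<in> {v \<in> wsoc. soc_part v = 0}"
    then have z: "Poly_Mapping.lookup (soc_part v) g = 0" for g by simp
    have "v g = 0" for g
    proof (cases "g \<in> S3 - {id}")
      case True
      then show ?thesis
        using z[of g] v by (simp add: soc_part_def lookup_L_vec kappa_ne_0 wsoc_def prod_eq_iff)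
    next
      case False
      then show ?thesis using v by (auto simp: wsoc_def wcarrier_def)
    qed
    then show "v \<in> {0}" by (simp add: fun_eq_iff)
  qed (auto simp: wsoc_def wcarrier_def soc_part_def L_vec_def)
qed (rule soc_part_gen)

section \<open>The lattice of submodules\<close>

lemma N1323_decomposition: "phi_vimage wN = Me <+>\<^bsub>M\<^esub> phi_vimage wsoc"
proof (intro equalityI subsetI)
  fix X assume "X \<in> phi_vimage wN"
  then have X: "X \<in> carrier M" "\<phi> X \<in> wN" by (auto simp: phi_vimage_def)
  have "wsingle id (\<phi> X id) \<in> \<phi> ` carrier M" unfolding phi_surj by simp
  then obtain Y where Y: "Y \<in> carrier M" "\<phi> Y = wsingle id (\<phi> X id)" by auto
  let ?Z = "\<ominus>\<^bsub>M\<^esub> Y \<oplus>\<^bsub>M\<^esub> X"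
  have "\<phi> ?Z = \<phi> X - wsingle id (\<phi> X id)" using X Y by (simp add: phi_add phi_uminus)
  moreover have "(\<phi> X - wsingle id (\<phi> X id)) g = (if g = id then 0 else \<phi> X g)" for g
    by simp
  ultimately have "\<phi> ?Z = (\<lambda>g. if g = id then 0 else \<phi> X g)" by (metis ext)
  moreover have "(\<lambda>g. if g = id then 0 else \<phi> X g) \<in> wsoc"
    using X(2) by (auto simp: wN_def wsoc_def wcarrier_def)
  ultimately have "?Z \<in> phi_vimage wsoc" using X Y by (simp add: phi_vimage_def)
  moreover have "X = Y \<oplus>\<^bsub>M\<^esub> ?Z" using X Y by (simp add: M.r_neg2)
  moreover have "Y \<in> Me" using Y by (simp add: Me_eq phi_vimage_def)
  ultimately show "X \<in> Me <+>\<^bsub>M\<^esub> phi_vimage wsoc" unfolding set_add_def' by blast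
next
  fix X assume "X \<in> Me <+>\<^bsub>M\<^esub> phi_vimage wsoc"
  then obtain Y Z where "X = Y \<oplus>\<^bsub>M\<^esub> Z" "Y \<in> Me" "Z \<in> phi_vimage wsoc"
    unfolding set_add_def' by blast
  moreover from this obtain w where "Y \<in> carrier M" "\<phi> Y = wsingle id w"
    by (auto simp: Me_eq phi_vimage_def)
  moreover have "wsingle id w \<in> wN" by (rule wsingle_id_wN)
  moreover have "\<phi> Z \<in> wN"
    using calculation(3) wsoc_subset_wcyc[of 0] wcyc_subset_wN[of 0] by (auto simp: phi_vimage_def)
  ultimately show "X \<in> phi_vimage wN"
    using wsub_wN[of a] by (simp add: phi_vimage_def phi_add wsub_def)
qed

lemma Me_inter_soc: "Me \<inter> phi_vimage wsoc = {\<zero>\<^bsub>M\<^esub>}"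
proof -
  have "range (wsingle id) \<inter> wsoc = {0 :: 'k wvec}"
    by (auto simp: wsoc_def wcarrier_def) (auto intro: range_eqI[of _ _ 0])
  moreover have "Me \<inter> phi_vimage wsoc = phi_vimage (range (wsingle id) \<inter> wsoc)"
    by (auto simp: Me_eq phi_vimage_def)
  ultimately show ?thesis by (simp add: zero_eq)
qed

lemma submodules:
  "{H. submodule H (alg a) M \<and> H \<noteq> {\<zero>\<^bsub>M\<^esub>}} =
     {phi_vimage wsoc} \<union> {cyc a v | v. v \<in> Me - {\<zero>\<^bsub>M\<^esub>}} \<union> {phi_vimage wN, carrier M}"
proof (intro equalityI subsetI)
  fix H assume "H \<in> {H. submodule H (alg a) M \<and> H \<noteq> {\<zero>\<^bsub>M\<^esub>}}"
  then have H: "wsub a (\<phi> ` H)" "H = phi_vimage (\<phi> ` H)" "H \<noteq> {\<zero>\<^bsub>M\<^esub>}"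
    using submodule_eq_phi_vimage by auto
  then have "\<phi> ` H \<noteq> {0}" using zero_eq by metis
  then show "H \<in> {phi_vimage wsoc} \<union> {cyc a v | v. v \<in> Me - {\<zero>\<^bsub>M\<^esub>}} \<union> {phi_vimage wN, carrier M}"
  proof (rule wsubmodule.classification[OF wsubmoduleI[OF H(1)]])
    fix w assume w: "w \<noteq> 0" "\<phi> ` H = wcyc w"
    obtain X where X: "X \<in> Me - {\<zero>\<^bsub>M\<^esub>}" "\<phi> X = wsingle id w" using Me_surj[OF w(1)] .
    then have "X \<in> carrier M" by (auto simp: Me_eq phi_vimage_def)
    then have "H = cyc a X" using cyc_eq X(2) w H(2) by simp
    then show ?thesis using X(1) by blast
  qed (use H(2) carrier_eq in auto)
next
  fix H assume "H \<in> {phi_vimage wsoc} \<union> {cyc a v | v. v \<in> Me - {\<zero>\<^bsub>M\<^esub>}} \<union> {phi_vimage wN, carrier M}"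
  then consider "H = phi_vimage wsoc" | v where "v \<in> Me - {\<zero>\<^bsub>M\<^esub>}" "H = cyc a v" | "H = phi_vimage wN" | "H = phi_vimage wcarrier"
    using carrier_eq by blast
  \<comment> \<open>Every listed submodule contains the bottom copy and is therefore
    nonzero.\<close>
  then obtain H' where H': "H = phi_vimage H'" "wsub a H'" "wsoc \<subseteq> H'"
  proof cases
    case 2
    then obtain w where "v \<in> carrier M" "\<phi> v = wsingle id w" "w \<noteq> 0" using Me_nonzero by metis
    then show thesis using that[of "wcyc w"] 2(2) cyc_eq wsub_wcyc wsoc_subset_wcyc by metis
  qed (use that wsub_wsoc wsub_wN wsub_wcarrier in \<open>auto simp: wsoc_def wN_def\<close>)
  have "wsingle rot (1, 0) \<in> H'"
    using subsetD[OF H'(3) wsingle_wsoc[of rot "(1, 0)"]] by simp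
  moreover have "wsingle rot (1, 0) \<noteq> (0 :: 'k wvec)"
  proof
    assume "wsingle rot (1, 0) = (0 :: 'k wvec)"
    from fun_cong[OF this, of rot] show False by (simp add: zero_prod_def)
  qed
  ultimately have "phi_vimage H' \<noteq> phi_vimage {0}"
    using H'(2) phi_vimage_eq_iff[of H' "{0}"] by (auto simp: wsub_def wcarrier_def)
  then show "H \<in> {H. submodule H (alg a) M \<and> H \<noteq> {\<zero>\<^bsub>M\<^esub>}}"
    using submodule_phi_vimage H' zero_eq by simp
qed

lemma submodule_chain:
  assumes "v \<in> Me - {\<zero>\<^bsub>M\<^esub>}"
  shows "phi_vimage wsoc \<subset> cyc a v" "cyc a v \<subset> phi_vimage wN" "phi_vimage wN \<subset> carrier M"
proof -
  obtain w where w: "v \<in> carrier M" "\<phi> v = wsingle id w" "w \<noteq> 0" using Me_nonzero[OF assms] .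
  have "(wsoc :: 'k wvec set) \<subset> wcyc w" "wcyc w \<subset> wN" "(wN :: 'k wvec set) \<subset> wcarrier"
    by (rule psubsetI[OF wsoc_subset_wcyc wsoc_ne_wcyc[OF w(3)]],
        rule psubsetI[OF wcyc_subset_wN wcyc_ne_wN],
        rule psubsetI[OF wN_subset_wcarrier wN_ne_wcarrier])
  moreover from this have "(wsoc :: 'k wvec set) \<subseteq> wcarrier" "wcyc w \<subseteq> wcarrier" "(wN :: 'k wvec set) \<subseteq> wcarrier"
    by blast+
  ultimately show "phi_vimage wsoc \<subset> cyc a v" "cyc a v \<subset> phi_vimage wN" "phi_vimage wN \<subset> carrier M"
    unfolding cyc_eq[OF w] carrier_eq by (simp_all add: psubset_eq phi_vimage_subset_iff phi_vimage_eq_iff)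
qed

lemma cyc_eq_iff:
  assumes "u \<in> Me - {\<zero>\<^bsub>M\<^esub>}" "v \<in> Me - {\<zero>\<^bsub>M\<^esub>}"
  shows "cyc a v = cyc a u \<longleftrightarrow> v \<in> line a u"
proof -
  obtain w where w: "v \<in> carrier M" "\<phi> v = wsingle id w" "w \<noteq> 0" using Me_nonzero[OF assms(2)] .
  obtain z where z: "u \<in> carrier M" "\<phi> u = wsingle id z" "z \<noteq> 0" using Me_nonzero[OF assms(1)] .
  have c: "wcyc x \<subseteq> wcarrier" for x :: "'k \<times> 'k"
    using wcyc_subset_wN[of x] wN_subset_wcarrier by blast
  have "cyc a v = cyc a u \<longleftrightarrow> wcyc w = wcyc z"
    using c by (simp add: cyc_eq[OF w] cyc_eq[OF z] phi_vimage_eq_iff)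
  also have "\<dots> \<longleftrightarrow> (\<exists>c. w = (c * fst z, c * snd z))"
    using w(3) by (rule wcyc_eq_iff)
  also have "\<dots> \<longleftrightarrow> (\<exists>c. wsingle id w = wsingle id (c * fst z, c * snd z))"
    by (metis wsingle_apply(1))
  also have "\<dots> \<longleftrightarrow> v \<in> line a u"
    using w z by (auto simp: line_eq phi_vimage_def wsingle_scale)
  finally show ?thesis .
qed

end

theorem lemma13:
  fixes a :: "perm3 \<Rightarrow> 'k :: {alg_closed_field, field_char_0}"
  assumes "param_A3 a" and "generic a"
  shows
    "N1323 a = M1323_e a <+>\<^bsub>M1323 a\<^esub> cyc a (m_soc a)
    \<and> M1323_e a \<inter> cyc a (m_soc a) = {\<zero>\<^bsub>M1323 a\<^esub>}
    \<and> {H. submodule H (alg a) (M1323 a) \<and> H \<noteq> {\<zero>\<^bsub>M1323 a\<^esub>}} =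
        {cyc a (m_soc a)} \<union> {cyc a v | v. v \<in> M1323_e a - {\<zero>\<^bsub>M1323 a\<^esub>}}
          \<union> {N1323 a, carrier (M1323 a)}
    \<and> (\<forall>v \<in> M1323_e a - {\<zero>\<^bsub>M1323 a\<^esub>}.
        cyc a (m_soc a) \<subset> cyc a v \<and> cyc a v \<subset> N1323 a \<and> N1323 a \<subset> carrier (M1323 a))
    \<and> (\<forall>u \<in> M1323_e a - {\<zero>\<^bsub>M1323 a\<^esub>}. \<forall>v \<in> M1323_e a - {\<zero>\<^bsub>M1323 a\<^esub>}.
        cyc a v = cyc a u \<longleftrightarrow> v \<in> line a u)
    \<and> (\<forall>v \<in> M1323_e a - {\<zero>\<^bsub>M1323 a\<^esub>}.
        mod_isomorphic (alg a) (quot_mod (sub_mod (M1323 a) (cyc a v)) (cyc a (m_soc a))) k_e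
        \<and> mod_isomorphic (alg a) (quot_mod (sub_mod (M1323 a) (N1323 a)) (cyc a v)) k_e)
    \<and> mod_isomorphic (alg a) (quot_mod (M1323 a) (N1323 a)) (L_mod a)
    \<and> mod_isomorphic (alg a) (sub_mod (M1323 a) (cyc a (m_soc a))) (L_mod a)"
proof -
  interpret generic_verma a using assms(2) by (rule generic_verma.intro)
  have iso: "mod_isomorphic (alg a) (quot_mod (sub_mod M (cyc a v)) (phi_vimage wsoc)) k_e"
    "mod_isomorphic (alg a) (quot_mod (sub_mod M (phi_vimage wN)) (cyc a v)) k_e"
    if v: "v \<in> Me - {\<zero>\<^bsub>M\<^esub>}" for v
  proof -
    obtain w where w: "v \<in> carrier M" "\<phi> v = wsingle id w" "w \<noteq> 0" using Me_nonzero[OF v] .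
    show "mod_isomorphic (alg a) (quot_mod (sub_mod M (cyc a v)) (phi_vimage wsoc)) k_e"
      "mod_isomorphic (alg a) (quot_mod (sub_mod M (phi_vimage wN)) (cyc a v)) k_e"
      unfolding cyc_eq[OF w] by (rule iso_wcyc[OF w(3)], rule iso_wN[OF w(3)])
  qed
  show ?thesis
    unfolding rot_def[symmetric] cyc_m_soc N1323_eq
    by (intro conjI ballI N1323_decomposition Me_inter_soc submodules submodule_chain cyc_eq_iff iso iso_top iso_soc)
qed

end
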